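(* Let $G$ be a connected solvable algebraic group over an algebraically closed field $k$ and let $\varphi\in\mathrm{Aut}_{\mathrm{alg}}(G)$. Then $R(\varphi)\in\{1,\infty\}$; that is, the $\varphi$-twisted conjugacy action of $G$ on itself either is transitive or has infinitely many orbits.
   Context: An algebraic group over an algebraically closed field $k$ means a Zariski-closed subgroup of $\mathrm{GL}_n(k)$ for some $n\ge 1$. $\mathrm{Aut}_{\mathrm{alg}}(G)$ is the group of abstract group automorphisms $\varphi$ of $G$ such that $\varphi$ and $\varphi^{-1}$ are morphisms of the underlying affine variety. The $\varphi$-twisted conjugacy action of $G$ on itself is $(g,x)\mapsto gx\varphi(g^{-1})$. $R(\varphi)$ denotes the number of orbits of this action, and $R(\varphi)=\infty$ means that the set of orbits is infinite. *)

theory Defs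
  imports
    "HOL-Analysis.Abstract_Topology"
    "HOL-Library.Extended_Nat"
    "HOL-Algebra.Group_Action"
    "HOL-Algebra.Solvable_Groups"
    "Jordan_Normal_Form.Determinant"
begin

abbreviation GL :: "nat \<Rightarrow> 'k::field mat monoid" where
  "GL n \<equiv> units_of (ring_mat TYPE('k) n ())"

lemma group_GL: "group (GL n :: 'k::field mat monoid)"
proof -
  interpret ring "ring_mat TYPE('k) n ()" by (rule ring_mat)
  show ?thesis by (rule units_group)
qed

text \<open>The coordinate ring of the affine variety $GL_n$: the $k$-algebra of functions generated by
  the matrix entries and the inverse of the determinant. Only the values on \<^term>\<open>carrier (GL n)\<close>
  matter.\<close>

inductive_set regular_fun :: "nat \<Rightarrow> ('k::field mat \<Rightarrow> 'k) set" for n :: nat where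
  const: "(\<lambda>_. c) \<in> regular_fun n"
| entry: "i < n \<Longrightarrow> j < n \<Longrightarrow> (\<lambda>A. A $$ (i, j)) \<in> regular_fun n"
| inv_det: "(\<lambda>A. inverse (det A)) \<in> regular_fun n"
| add: "f \<in> regular_fun n \<Longrightarrow> g \<in> regular_fun n \<Longrightarrow> (\<lambda>A. f A + g A) \<in> regular_fun n"
| mult: "f \<in> regular_fun n \<Longrightarrow> g \<in> regular_fun n \<Longrightarrow> (\<lambda>A. f A * g A) \<in> regular_fun n"

definition zero_locus :: "nat \<Rightarrow> ('k::field mat \<Rightarrow> 'k) set \<Rightarrow> 'k mat set" where
  "zero_locus n F = {A \<in> carrier (GL n). \<forall>f\<in>F. f A = 0}"

definition zariski :: "nat \<Rightarrow> 'k::field mat topology" where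
  "zariski n = topology (\<lambda>U. \<exists>F \<subseteq> regular_fun n. U = carrier (GL n) - zero_locus n F)"

lemma istopology_zariski:
  "istopology (\<lambda>U :: 'k::field mat set.
     \<exists>F \<subseteq> regular_fun n. U = carrier (GL n) - zero_locus n F)"
  unfolding istopology_def
proof (intro conjI allI impI)
  fix U V :: "'k mat set"
  assume "\<exists>F \<subseteq> regular_fun n. U = carrier (GL n) - zero_locus n F"
    and "\<exists>F \<subseteq> regular_fun n. V = carrier (GL n) - zero_locus n F"
  then obtain F H where F: "F \<subseteq> regular_fun n" "U = carrier (GL n) - zero_locus n F"
    and H: "H \<subseteq> regular_fun n" "V = carrier (GL n) - zero_locus n H" by blast
  let ?P = "{\<lambda>A. f A * h A | f h. f \<in> F \<and> h \<in> H}"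
  have "?P \<subseteq> regular_fun n" using F(1) H(1) by (auto intro: regular_fun.mult)
  moreover have "U \<inter> V = carrier (GL n) - zero_locus n ?P"
    unfolding F(2) H(2) zero_locus_def by fastforce
  ultimately show "\<exists>F \<subseteq> regular_fun n. U \<inter> V = carrier (GL n) - zero_locus n F" by blast
next
  fix \<U> :: "'k mat set set"
  assume "\<forall>U\<in>\<U>. \<exists>F \<subseteq> regular_fun n. U = carrier (GL n) - zero_locus n F"
  then obtain F where F: "\<And>U. U \<in> \<U> \<Longrightarrow> F U \<subseteq> regular_fun n \<and> U = carrier (GL n) - zero_locus n (F U)"
    by metis
  have "(\<Union>U\<in>\<U>. F U) \<subseteq> regular_fun n" using F by blast
  moreover have "\<Union>\<U> = (\<Union>U\<in>\<U>. carrier (GL n) - zero_locus n (F U))"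
    using F by blast
  then have "\<Union>\<U> = carrier (GL n) - zero_locus n (\<Union>U\<in>\<U>. F U)"
    unfolding zero_locus_def by auto
  ultimately show "\<exists>F \<subseteq> regular_fun n. \<Union>\<U> = carrier (GL n) - zero_locus n F" by blast
qed

lemma openin_zariski:
  "openin (zariski n) U \<longleftrightarrow> (\<exists>F \<subseteq> regular_fun n. U = carrier (GL n) - zero_locus n F)"
  unfolding zariski_def by (simp add: topology_inverse' istopology_zariski)

lemma topspace_zariski: "topspace (zariski n :: 'k::field mat topology) = carrier (GL n)"
proof -
  have "openin (zariski n :: 'k mat topology) (carrier (GL n))"
    unfolding openin_zariski zero_locus_def
    by (rule exI[of _ "{\<lambda>_. 1}"]) (auto intro: regular_fun.const)
  moreover have "\<And>U :: 'k mat set. openin (zariski n) U \<Longrightarrow> U \<subseteq> carrier (GL n)"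
    unfolding openin_zariski by blast
  ultimately show ?thesis unfolding topspace_def by blast
qed

lemma closedin_zariski:
  "closedin (zariski n) V \<longleftrightarrow> (\<exists>F \<subseteq> regular_fun n. V = zero_locus n F)"
proof -
  have sub: "zero_locus n F \<subseteq> carrier (GL n)" for F :: "('a mat \<Rightarrow> 'a) set"
    unfolding zero_locus_def by blast
  show ?thesis
    unfolding closedin_def topspace_zariski openin_zariski
  proof (intro iffI; elim conjE exE)
    fix F assume "V \<subseteq> carrier (GL n)" "F \<subseteq> regular_fun n"
      "carrier (GL n) - V = carrier (GL n) - zero_locus n F"
    moreover from this have "V = zero_locus n F" using sub[of F] by blast
    ultimately show "\<exists>F \<subseteq> regular_fun n. V = zero_locus n F" by blast
  qed (use sub in blast)
qed

definition algebraic_group :: "nat \<Rightarrow> 'k::field mat set \<Rightarrow> bool" where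
  "algebraic_group n G \<longleftrightarrow> n \<ge> 1 \<and> subgroup G (GL n) \<and> closedin (zariski n) G"

text \<open>Morphisms of affine varieties are the maps that pull regular functions back to regular
  functions; regular functions on a closed subset of $GL_n$ are restrictions of those on $GL_n$.\<close>

definition variety_morphism ::
  "nat \<Rightarrow> 'k::field mat set \<Rightarrow> nat \<Rightarrow> 'k mat set \<Rightarrow> ('k mat \<Rightarrow> 'k mat) \<Rightarrow> bool" where
  "variety_morphism n X m Y \<phi> \<longleftrightarrow> \<phi> \<in> X \<rightarrow> Y \<and>
     (\<forall>f \<in> regular_fun m. \<exists>h \<in> regular_fun n. \<forall>A \<in> X. f (\<phi> A) = h A)"

definition Aut_alg :: "nat \<Rightarrow> 'k::field mat set \<Rightarrow> ('k mat \<Rightarrow> 'k mat) set" where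
  "Aut_alg n G = {\<phi> \<in> auto (GL n\<lparr>carrier := G\<rparr>).
     variety_morphism n G n G \<phi> \<and> variety_morphism n G n G (inv_into G \<phi>)}"

definition twisted_conj ::
  "('a, 'b) monoid_scheme \<Rightarrow> ('a \<Rightarrow> 'a) \<Rightarrow> 'a \<Rightarrow> 'a \<Rightarrow> 'a" where
  "twisted_conj G \<phi> g = (\<lambda>x \<in> carrier G. g \<otimes>\<^bsub>G\<^esub> x \<otimes>\<^bsub>G\<^esub> \<phi> (inv\<^bsub>G\<^esub> g))"

lemma group_action_twisted_conj:
  fixes G (structure)
  assumes "group G" and "\<phi> \<in> hom G G"
  shows "group_action G (carrier G) (twisted_conj G \<phi>)"
proof -
  interpret group_hom G G \<phi>
    using assms by (simp add: group_hom_def group_hom_axioms_def)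
  have cl: "twisted_conj G \<phi> g x \<in> carrier G"
    if "g \<in> carrier G" "x \<in> carrier G" for g x
    using that by (simp add: twisted_conj_def)
  have comp: "twisted_conj G \<phi> (g \<otimes> h) x = twisted_conj G \<phi> g (twisted_conj G \<phi> h x)"
    if "g \<in> carrier G" "h \<in> carrier G" "x \<in> carrier G" for g h x
    using that by (simp add: twisted_conj_def inv_mult_group m_assoc)
  have one: "twisted_conj G \<phi> \<one> x = x" if "x \<in> carrier G" for x
    using that by (simp add: twisted_conj_def)
  have bij: "twisted_conj G \<phi> g \<in> Bij (carrier G)" if g: "g \<in> carrier G" for g
  proof -
    have "bij_betw (twisted_conj G \<phi> g) (carrier G) (carrier G)"
      by (rule bij_betw_byWitness[where f' = "twisted_conj G \<phi> (inv g)"])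
         (use g in \<open>auto simp: cl comp[symmetric] one\<close>)
    then show ?thesis by (simp add: Bij_def twisted_conj_def)
  qed
  have "twisted_conj G \<phi> (g \<otimes> h)
      = twisted_conj G \<phi> g \<otimes>\<^bsub>BijGroup (carrier G)\<^esub> twisted_conj G \<phi> h"
    if "g \<in> carrier G" "h \<in> carrier G" for g h
  proof (rule extensionalityI[where A = "carrier G"])
    show "twisted_conj G \<phi> (g \<otimes> h) \<in> extensional (carrier G)"
      by (simp add: twisted_conj_def)
  qed (use that in \<open>auto simp: BijGroup_def bij comp compose_def\<close>)
  moreover have "twisted_conj G \<phi> \<in> carrier G \<rightarrow> carrier (BijGroup (carrier G))"
    using bij by (simp add: BijGroup_def)
  ultimately have "twisted_conj G \<phi> \<in> hom G (BijGroup (carrier G))"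
    by (intro homI) blast+
  then show ?thesis
    by (simp only: group_action_def group_hom_def group_hom_axioms_def group_BijGroup assms(1) simp_thms)
qed

definition Reidemeister_number :: "('a, 'b) monoid_scheme \<Rightarrow> ('a \<Rightarrow> 'a) \<Rightarrow> enat" where
  "Reidemeister_number G \<phi> =
     (let Orb = orbits G (carrier G) (twisted_conj G \<phi>)
      in if finite Orb then enat (card Orb) else \<infinity>)"

end

theory Submission
  imports Defs "HOL-Library.Function_Algebras"
begin

text \<open>
  Write \<open>c(g) = g \<phi>(g)\<^sup>-\<^sup>1\<close>. If there are finitely many orbits, one of them is dense because \<open>G\<close> is
  irreducible, and after composing \<open>\<phi>\<close> with an inner automorphism it is \<open>c(G)\<close>. The fibres of \<open>c\<close> are
  the cosets of the group of fixed points of \<open>\<phi>\<close>. A dominant endomorphism of an irreducible variety has a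
  finite fibre, so \<open>\<phi>\<close> has finitely many fixed points, also on each term \<open>N\<close> of the series of Zariski
  closures of the derived series. Conversely an endomorphism with finite fibres is dominant, so \<open>c(N)\<close>
  contains a nonempty open subset of \<open>N\<close>, and every element of \<open>N\<close> is a product of two elements of
  \<open>c(N)\<close>. Since \<open>c\<close> is multiplicative modulo commutators, descending induction on the solvable series
  gives \<open>c(N) = N\<close>; no quotient groups are needed.

  The two dimension statements are proved with transcendence degrees of rings of functions. If \<open>c\<close> has
  finite fibres, then so have its powers, so every regular function is algebraic over the image of
  \<open>(c\<^sup>m)\<^sup>*\<close>; a relation of minimal degree for an element of the kernel has a nonzero constant term
  in the kernel of \<open>(c\<^sup>m)\<^sup>*\<close>, which is impossible once the transcendence degree of that image is stable.
\<close>

section \<open>Subrings, polynomials and homomorphisms\<close>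

text \<open>Finiteness of the number of orbits does not obviously pass from \<open>G\<close> to a
  subgroup \<open>N\<close>, but finiteness of the group of fixed points does. This is why both
  dimension statements are needed: density on \<open>G\<close> yields finitely many fixed points,
  and these yield density back on every \<open>N\<close>. The geometry is reduced to subrings of a
  ring of functions whose type has zero divisors. In place of fraction fields there is
  pseudo-division, and a nonzero element of the base records where specialisation is allowed. Points
  come from extending homomorphisms into the algebraically closed field: applied to the image of the
  comorphism this gives an open set in the image of the map, applied after adjoining a
  transcendental function it gives an infinite fibre. Powers of c enter because the constant term of
  the relation only lies in the image of the comorphism, on which the comorphism may still have a
  kernel. A power whose image has the least transcendence degree is injective on its own image.
  Hilbert's basis theorem serves to deduce irreducibility from connectedness.\<close>

definition is_subring :: "'r::comm_ring_1 set \<Rightarrow> bool" where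
  "is_subring A \<longleftrightarrow> 0 \<in> A \<and> 1 \<in> A \<and> (\<forall>x\<in>A. - x \<in> A) \<and> (\<forall>x\<in>A. \<forall>y\<in>A. x + y \<in> A \<and> x * y \<in> A)"

lemma is_subringD:
  assumes "is_subring A"
  shows "0 \<in> A" "1 \<in> A" "x \<in> A \<Longrightarrow> - x \<in> A" "x \<in> A \<Longrightarrow> y \<in> A \<Longrightarrow> x + y \<in> A"
    "x \<in> A \<Longrightarrow> y \<in> A \<Longrightarrow> x * y \<in> A"
  using assms by (auto simp: is_subring_def)

lemma is_subring_diff: "is_subring A \<Longrightarrow> x \<in> A \<Longrightarrow> y \<in> A \<Longrightarrow> x - y \<in> A"
  using is_subringD(3,4)[of A] by (metis add_uminus_conv_diff)

lemma is_subring_sum: "is_subring A \<Longrightarrow> (\<And>i. i \<in> I \<Longrightarrow> f i \<in> A) \<Longrightarrow> sum f I \<in> A"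
  by (induction I rule: infinite_finite_induct) (auto intro: is_subringD)

lemma is_subring_prod: "is_subring A \<Longrightarrow> (\<And>i. i \<in> I \<Longrightarrow> f i \<in> A) \<Longrightarrow> prod f I \<in> A"
  by (induction I rule: infinite_finite_induct) (auto intro: is_subringD)

lemma is_subring_power: "is_subring A \<Longrightarrow> x \<in> A \<Longrightarrow> x ^ m \<in> A"
  by (induction m) (auto intro: is_subringD)

definition polys_over :: "'r::comm_ring_1 set \<Rightarrow> 'r poly set" where
  "polys_over A = {p. \<forall>i. coeff p i \<in> A}"

lemma coeff_polys_over: "p \<in> polys_over A \<Longrightarrow> coeff p i \<in> A"
  by (simp add: polys_over_def)

lemma polys_over_const [simp]: "is_subring A \<Longrightarrow> [:a:] \<in> polys_over A \<longleftrightarrow> a \<in> A"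
  by (auto simp: polys_over_def coeff_pCons is_subringD split: nat.splits)

lemma is_subring_polys_over: "is_subring A \<Longrightarrow> is_subring (polys_over A)"
  unfolding is_subring_def[of "polys_over A"]
  by (auto simp: polys_over_def coeff_mult is_subringD intro: is_subring_sum)

lemma monom_polys_over: "is_subring A \<Longrightarrow> a \<in> A \<Longrightarrow> monom a i \<in> polys_over A"
  by (auto simp: polys_over_def is_subringD)

lemma smult_polys_over: "is_subring A \<Longrightarrow> a \<in> A \<Longrightarrow> p \<in> polys_over A \<Longrightarrow> smult a p \<in> polys_over A"
  by (auto simp: polys_over_def is_subringD)

lemma pCons_polys_over:
  "is_subring A \<Longrightarrow> pCons a p \<in> polys_over A \<longleftrightarrow> a \<in> A \<and> p \<in> polys_over A"
  by (force simp: polys_over_def coeff_pCons is_subringD split: nat.splits)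

lemma poly_in_subring:
  "is_subring A \<Longrightarrow> p \<in> polys_over A \<Longrightarrow> y \<in> A \<Longrightarrow> poly p y \<in> A"
  by (auto simp: poly_altdef polys_over_def intro!: is_subring_sum is_subring_power is_subringD(5))

definition adjoin :: "'r::comm_ring_1 set \<Rightarrow> 'r \<Rightarrow> 'r set" where
  "adjoin A y = (\<lambda>p. poly p y) ` polys_over A"

lemma adjoin_base: "is_subring A \<Longrightarrow> A \<subseteq> adjoin A y"
  by (force simp: adjoin_def image_iff intro: bexI[of _ "[:_:]"])

lemma adjoin_gen: "is_subring A \<Longrightarrow> y \<in> adjoin A y"
  unfolding adjoin_def by (rule image_eqI[of _ _ "[:0,1:]"]) (auto simp: pCons_polys_over is_subringD is_subring_polys_over)

lemma is_subring_adjoin: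
  assumes "is_subring A"
  shows "is_subring (adjoin A y)"
proof -
  note S = is_subringD[OF is_subring_polys_over[OF assms]]
  have eval: "poly p y \<in> adjoin A y" if "p \<in> polys_over A" for p
    using that by (auto simp: adjoin_def)
  have "0 \<in> adjoin A y" "1 \<in> adjoin A y" using eval[OF S(1)] eval[OF S(2)] by simp_all
  moreover have "- u \<in> adjoin A y" if "u \<in> adjoin A y" for u
    using that eval[OF S(3)] by (auto simp: adjoin_def)
  moreover have "u + v \<in> adjoin A y \<and> u * v \<in> adjoin A y" if uv: "u \<in> adjoin A y" "v \<in> adjoin A y" for u v
  proof -
    from uv obtain p q where pq: "p \<in> polys_over A" "q \<in> polys_over A" "u = poly p y" "v = poly q y"
      by (auto simp: adjoin_def)
    show ?thesis using eval[OF S(4)[OF pq(1,2)]] eval[OF S(5)[OF pq(1,2)]] by (simp add: pq)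
  qed
  ultimately show ?thesis by (simp add: is_subring_def)
qed

lemma adjoin_subset: "is_subring B \<Longrightarrow> A \<subseteq> B \<Longrightarrow> y \<in> B \<Longrightarrow> adjoin A y \<subseteq> B"
  unfolding adjoin_def using poly_in_subring[of B _ y] by (auto simp: polys_over_def)

definition adjoin_list :: "'r::comm_ring_1 set \<Rightarrow> 'r list \<Rightarrow> 'r set" where
  "adjoin_list A ys = foldr (\<lambda>y B. adjoin B y) ys A"

lemma adjoin_list_simps [simp]:
  "adjoin_list A [] = A" "adjoin_list A (y # ys) = adjoin (adjoin_list A ys) y"
  by (simp_all add: adjoin_list_def)

lemma is_subring_adjoin_list: "is_subring A \<Longrightarrow> is_subring (adjoin_list A ys)"
  by (induction ys) (auto intro: is_subring_adjoin)

lemma adjoin_list_base: "is_subring A \<Longrightarrow> A \<subseteq> adjoin_list A ys"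
proof (induction ys)
  case (Cons y ys)
  then show ?case using adjoin_base[OF is_subring_adjoin_list[OF Cons.prems, of ys], of y] by simp
qed simp

lemma adjoin_list_gen: "is_subring A \<Longrightarrow> set ys \<subseteq> adjoin_list A ys"
proof (induction ys)
  case (Cons y ys)
  then show ?case
    using adjoin_gen[OF is_subring_adjoin_list[OF Cons.prems, of ys], of y]
      adjoin_base[OF is_subring_adjoin_list[OF Cons.prems, of ys], of y] by auto
qed simp

lemma adjoin_list_subset: "is_subring B \<Longrightarrow> A \<subseteq> B \<Longrightarrow> set ys \<subseteq> B \<Longrightarrow> adjoin_list A ys \<subseteq> B"
  by (induction ys) (simp_all add: adjoin_subset)

definition integral_domain_on :: "'r::comm_ring_1 set \<Rightarrow> bool" where
  "integral_domain_on R \<longleftrightarrow> is_subring R \<and> (\<forall>x\<in>R. \<forall>y\<in>R. x * y = 0 \<longrightarrow> x = 0 \<or> y = 0)"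

text \<open>Leading coefficients need not be invertible, so \<open>p\<close> is multiplied by the
  leading coefficient of \<open>r\<close> before each cancellation of its top term; \<open>s\<close>
  counts these multiplications.\<close>

lemma pseudo_division:
  fixes r :: "'r::comm_ring_1 poly"
  assumes A: "is_subring A" and r: "r \<in> polys_over A" and p: "p \<in> polys_over A" and r0: "degree r > 0"
  shows "\<exists>s. \<exists>w\<in>polys_over A. \<exists>r'\<in>polys_over A.
    smult (lead_coeff r ^ s) p = r * w + r' \<and> degree r' < degree r"
  using p
proof (induction "degree p" arbitrary: p rule: less_induct)
  case less
  note P = is_subringD[OF is_subring_polys_over[OF A]]
  show ?case
  proof (cases "degree p < degree r")
    case True
    then show ?thesis using less.prems P(1) by (intro exI[of _ 0] bexI[of _ 0] bexI[of _ p]) auto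
  next
    case False
    define l where "l = lead_coeff r"
    define m where "m = monom (lead_coeff p) (degree p - degree r)"
    define p' where "p' = smult l p - r * m"
    have l: "l \<in> A" using r by (simp add: l_def polys_over_def)
    have m: "m \<in> polys_over A" using less.prems A by (simp add: m_def monom_polys_over coeff_polys_over)
    have p': "p' \<in> polys_over A" unfolding p'_def
      by (intro is_subring_diff is_subring_polys_over smult_polys_over P A l r m less.prems)
    have "degree p' \<le> degree p"
      unfolding p'_def
    proof (rule degree_diff_le)
      show "degree (smult l p) \<le> degree p" by (rule degree_smult_le)
      have "degree (r * m) \<le> degree r + degree m" by (rule degree_mult_le)
      also have "degree m \<le> degree p - degree r" by (simp add: m_def degree_monom_le)
      finally show "degree (r * m) \<le> degree p" using False by simp
    qed
    moreover have "coeff p' (degree p) = 0"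
      using False by (simp add: p'_def m_def l_def mult.commute[of r] coeff_monom_mult mult.commute[of "lead_coeff r"])
    \<comment> \<open>A vanishing top coefficient lowers the degree because \<open>degree p\<close>,
      being at least \<open>degree r\<close>, is positive.\<close>
    ultimately have "degree p' < degree p"
      using False r0 by (metis le_neq_implies_less leading_coeff_0_iff degree_0 gr0I not_less)
    from less.hyps[OF this p'] obtain s w r' where
      *: "w \<in> polys_over A" "r' \<in> polys_over A" "smult (l ^ s) p' = r * w + r'" "degree r' < degree r"
      unfolding l_def by blast
    have "smult (l ^ Suc s) p = r * (w + smult (l ^ s) m) + r'"
      using *(3) by (simp add: p'_def smult_diff_right algebra_simps)
    moreover have "w + smult (l ^ s) m \<in> polys_over A"
      by (intro P *(1) smult_polys_over A m is_subring_power l)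
    ultimately show ?thesis using *(2,4) unfolding l_def by blast
  qed
qed

text \<open>Only \<open>R\<close> is a domain, not the surrounding type, so the degree formula has
  to come from leading coefficients that lie in \<open>R\<close>.\<close>

lemma degree_mult_domain:
  assumes R: "integral_domain_on R" and "p \<in> polys_over R" "q \<in> polys_over R" "p \<noteq> 0" "q \<noteq> 0"
  shows "degree (p * q) = degree p + degree q" "p * q \<noteq> 0"
proof -
  have "lead_coeff p * lead_coeff q \<noteq> 0"
    using assms unfolding integral_domain_on_def by (metis coeff_polys_over leading_coeff_0_iff)
  then have "coeff (p * q) (degree p + degree q) \<noteq> 0" by (simp add: coeff_mult_degree_sum)
  then show "degree (p * q) = degree p + degree q" "p * q \<noteq> 0"
    using degree_mult_le le_degree le_antisym by (blast, fastforce)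
qed

definition transcendental_over :: "'r::comm_ring_1 set \<Rightarrow> 'r \<Rightarrow> bool" where
  "transcendental_over A y \<longleftrightarrow> (\<forall>p\<in>polys_over A. poly p y = 0 \<longrightarrow> p = 0)"

section \<open>Homomorphisms on subrings\<close>

definition ring_hom_on :: "'r::comm_ring_1 set \<Rightarrow> ('r \<Rightarrow> 's::comm_ring_1) \<Rightarrow> bool" where
  "ring_hom_on A \<psi> \<longleftrightarrow> \<psi> 0 = 0 \<and> \<psi> 1 = 1 \<and> (\<forall>x\<in>A. \<forall>y\<in>A. \<psi> (x + y) = \<psi> x + \<psi> y \<and> \<psi> (x * y) = \<psi> x * \<psi> y)"

lemma ring_hom_onD:
  assumes "ring_hom_on A \<psi>"
  shows "\<psi> 0 = 0" "\<psi> 1 = 1" "x \<in> A \<Longrightarrow> y \<in> A \<Longrightarrow> \<psi> (x + y) = \<psi> x + \<psi> y"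
    "x \<in> A \<Longrightarrow> y \<in> A \<Longrightarrow> \<psi> (x * y) = \<psi> x * \<psi> y"
  using assms by (auto simp: ring_hom_on_def)

lemma ring_hom_on_subset: "ring_hom_on B \<psi> \<Longrightarrow> A \<subseteq> B \<Longrightarrow> ring_hom_on A \<psi>"
  by (auto simp: ring_hom_on_def)

lemma ring_hom_on_sum:
  "is_subring A \<Longrightarrow> ring_hom_on A \<psi> \<Longrightarrow> (\<And>i. i \<in> I \<Longrightarrow> f i \<in> A) \<Longrightarrow> \<psi> (sum f I) = (\<Sum>i\<in>I. \<psi> (f i))"
  by (induction I rule: infinite_finite_induct) (auto simp: ring_hom_onD is_subring_sum)

lemma ring_hom_on_prod:
  "is_subring A \<Longrightarrow> ring_hom_on A \<psi> \<Longrightarrow> (\<And>i. i \<in> I \<Longrightarrow> f i \<in> A) \<Longrightarrow> \<psi> (prod f I) = (\<Prod>i\<in>I. \<psi> (f i))"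
  by (induction I rule: infinite_finite_induct) (auto simp: ring_hom_onD is_subring_prod)

lemma ring_hom_on_power:
  "is_subring A \<Longrightarrow> ring_hom_on A \<psi> \<Longrightarrow> x \<in> A \<Longrightarrow> \<psi> (x ^ m) = \<psi> x ^ m"
  by (induction m) (auto simp: ring_hom_onD is_subring_power)

lemma ring_hom_on_uminus:
  assumes "is_subring A" "ring_hom_on A \<psi>" "x \<in> A" shows "\<psi> (- x) = - \<psi> x"
  using assms ring_hom_onD(1,3)[of A \<psi>] is_subringD(3)[of A x] by (metis eq_neg_iff_add_eq_0 add.left_inverse)

context
  fixes A :: "'r::comm_ring_1 set" and \<psi> :: "'r \<Rightarrow> 's::comm_ring_1"
  assumes A: "is_subring A" and \<psi>: "ring_hom_on A \<psi>"
begin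

lemma coeff_map_poly_hom: "coeff (map_poly \<psi> p) i = \<psi> (coeff p i)"
  by (rule coeff_map_poly) (rule ring_hom_onD(1)[OF \<psi>])

lemma ring_hom_on_map_poly: "ring_hom_on (polys_over A) (map_poly \<psi>)"
  unfolding ring_hom_on_def
  by (auto intro!: poly_eqI simp: coeff_map_poly_hom coeff_mult ring_hom_on_sum[OF A \<psi>] A
      coeff_polys_over is_subringD[OF A] ring_hom_onD[OF \<psi>] )

lemma hom_poly: "p \<in> polys_over A \<Longrightarrow> y \<in> A \<Longrightarrow> \<psi> (poly p y) = poly (map_poly \<psi> p) (\<psi> y)"
proof (induction p)
  case (pCons a p)
  then show ?case
    using pCons_polys_over[OF A, of a p] poly_in_subring[OF A, of p y]
    by (simp add: ring_hom_onD[OF \<psi>] map_poly_pCons is_subringD[OF A])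
qed (simp add: ring_hom_onD[OF \<psi>])

lemma map_poly_smult_hom:
  "a \<in> A \<Longrightarrow> p \<in> polys_over A \<Longrightarrow> map_poly \<psi> (smult a p) = smult (\<psi> a) (map_poly \<psi> p)"
  by (auto intro!: poly_eqI simp: coeff_map_poly_hom ring_hom_onD[OF \<psi>] coeff_polys_over)

text \<open>The ring \<open>adjoin A y\<close> is the polynomial ring over \<open>A\<close> modulo
  the relations of \<open>y\<close>, so \<open>y\<close> may be sent to any \<open>t\<close> that
  satisfies the images of these relations.\<close>

lemma hom_extend:
  assumes rel: "\<And>q. q \<in> polys_over A \<Longrightarrow> poly q y = 0 \<Longrightarrow> poly (map_poly \<psi> q) t = 0"
  obtains \<psi>' where "ring_hom_on (adjoin A y) \<psi>'" "\<And>x. x \<in> A \<Longrightarrow> \<psi>' x = \<psi> x"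
    "\<And>q. q \<in> polys_over A \<Longrightarrow> \<psi>' (poly q y) = poly (map_poly \<psi> q) t"
proof -
  note P = is_subringD[OF is_subring_polys_over[OF A]]
  note H = ring_hom_onD[OF ring_hom_on_map_poly]
  \<comment> \<open>An arbitrary representing polynomial is chosen; \<open>rel\<close> applied to
    the difference of two representatives shows independence of the choice.\<close>
  define \<psi>' where "\<psi>' z = poly (map_poly \<psi> (SOME q. q \<in> polys_over A \<and> poly q y = z)) t" for z
  have val: "\<psi>' (poly q y) = poly (map_poly \<psi> q) t" if q: "q \<in> polys_over A" for q
  proof -
    define q' where "q' = (SOME q'. q' \<in> polys_over A \<and> poly q' y = poly q y)"
    have q': "q' \<in> polys_over A" "poly q' y = poly q y"
      unfolding q'_def using someI[of "\<lambda>q'. q' \<in> polys_over A \<and> poly q' y = poly q y", of q] q by auto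
    have "map_poly \<psi> (q' + - q) = map_poly \<psi> q' + - map_poly \<psi> q"
      using ring_hom_on_uminus[OF is_subring_polys_over[OF A] ring_hom_on_map_poly q] q q'
      by (simp only: H P)
    then have "poly (map_poly \<psi> q') t = poly (map_poly \<psi> q) t"
      using rel[OF P(4)[OF q'(1) P(3)[OF q]]] q'(2) by simp
    then show ?thesis by (simp add: \<psi>'_def q'_def)
  qed
  show ?thesis
  proof
    show "ring_hom_on (adjoin A y) \<psi>'"
      unfolding ring_hom_on_def
    proof (intro conjI ballI)
      show "\<psi>' 0 = 0" using val[OF P(1)] by simp
      show "\<psi>' 1 = 1" using val[OF P(2)] by (simp add: H)
      fix u v assume "u \<in> adjoin A y" "v \<in> adjoin A y"
      then obtain p q where pq: "p \<in> polys_over A" "q \<in> polys_over A" "u = poly p y" "v = poly q y"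
        by (auto simp: adjoin_def)
      show "\<psi>' (u + v) = \<psi>' u + \<psi>' v" "\<psi>' (u * v) = \<psi>' u * \<psi>' v"
        using val[OF P(4)[OF pq(1,2)]] val[OF P(5)[OF pq(1,2)]] val[OF pq(1)] val[OF pq(2)] pq(1,2)
        by (simp_all add: pq(3,4) H)
    qed
    show "\<psi>' x = \<psi> x" if "x \<in> A" for x
      using val[of "[:x:]"] that A by (simp add: map_poly_pCons ring_hom_onD[OF \<psi>])
  qed (rule val)
qed

end

section \<open>Extension of homomorphisms\<close>

text \<open>In a finite field the product of all \<open>X - a\<close>, plus 1, takes the value 1
  everywhere although it has positive degree.\<close>

lemma alg_closed_infinite: "infinite (UNIV :: 'k::alg_closed_field set)"
proof
  assume fin: "finite (UNIV :: 'k set)"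
  define p where "p = (\<Prod>a\<in>(UNIV :: 'k set). [:- a, 1:]) + 1"
  have "degree (\<Prod>a\<in>(UNIV :: 'k set). [:- a, 1:]) = card (UNIV :: 'k set)"
    by (subst degree_prod_sum_eq) auto
  then have "degree p > 0"
    using fin unfolding p_def by (subst degree_add_eq_left) (auto simp: card_gt_0_iff)
  then obtain x where "poly p x = 0" using alg_closed_imp_poly_has_root by blast
  moreover have "poly p x = 1"
    using fin by (auto simp: p_def poly_prod prod_zero_iff)
  ultimately show False by simp
qed

text \<open>A nonzero multiple of \<open>b\<close> of least degree in \<open>y\<close> is constant: otherwise it would divide the minimal
  relation \<open>p\<close> up to a scalar.\<close>

lemma algebraic_multiple_in_base:
  assumes R: "integral_domain_on R" and A: "is_subring A" "A \<subseteq> R" and y: "y \<in> R"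
    and b: "b \<in> adjoin A y" "b \<noteq> 0"
    and p: "p \<in> polys_over A" "poly p y = 0" "p \<noteq> 0"
      and min: "\<And>q. q \<in> polys_over A \<Longrightarrow> poly q y = 0 \<Longrightarrow> degree q < degree p \<Longrightarrow> q = 0"
  obtains u where "u \<in> adjoin A y" "u * b \<in> A" "u * b \<noteq> 0"
proof -
  have sR: "is_subring R" using R by (simp add: integral_domain_on_def)
  have dom: "u = 0 \<or> v = 0" if "u * v = 0" "u \<in> R" "v \<in> R" for u v
    using R that by (auto simp: integral_domain_on_def)
  have PR: "polys_over A \<subseteq> polys_over R" using A(2) by (auto simp: polys_over_def)
  note P = is_subringD[OF is_subring_polys_over[OF A(1)]]
  note S = is_subringD[OF is_subring_adjoin[OF A(1), of y]]
  have eval: "poly q y \<in> adjoin A y" if "q \<in> polys_over A" for q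
    using that by (auto simp: adjoin_def)
  have evalR: "poly q y \<in> R" if "q \<in> polys_over A" for q
    using that PR y poly_in_subring[OF sR] by blast
  have powR: "lead_coeff q ^ s \<noteq> 0" if "q \<in> polys_over A" "q \<noteq> 0" for q s
  proof (induction s)
    case 0
    show ?case using b(2) by (metis mult_1 mult_zero_left power_0)
  next
    case (Suc s)
    have "lead_coeff q \<in> R" using that(1) A(2) coeff_polys_over by blast
    then show ?case using Suc that(2) dom[of "lead_coeff q" "lead_coeff q ^ s"]
        is_subring_power[OF sR, of "lead_coeff q" s] by auto
  qed
  have pos: "degree p > 0"
  proof (rule ccontr)
    assume "\<not> degree p > 0"
    then obtain a where "p = [:a:]" by (metis degree_eq_zeroE gr0I)
    then show False using p(2,3) by simp
  qed
  define Q where "Q r \<longleftrightarrow> r \<in> polys_over A \<and> poly r y \<noteq> 0 \<and> (\<exists>u\<in>adjoin A y. poly r y = u * b)" for r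
  obtain q where q: "q \<in> polys_over A" "b = poly q y" using b(1) by (auto simp: adjoin_def)
  have "Q q" unfolding Q_def using q b(2) S(2) by (auto intro!: bexI[of _ 1])
  then obtain r where Qr: "Q r" and rmin: "\<And>r'. Q r' \<Longrightarrow> degree r \<le> degree r'"
    using ex_has_least_nat[of Q q degree] by blast
  then obtain u where u: "u \<in> adjoin A y" "poly r y = u * b" and r: "r \<in> polys_over A" "poly r y \<noteq> 0"
    by (auto simp: Q_def)
  have "degree r = 0"
  proof (rule ccontr)
    assume dr: "degree r \<noteq> 0"
    \<comment> \<open>Reducing \<open>r\<close> modulo \<open>p\<close> multiplies its value at
      \<open>y\<close> by a power of the leading coefficient of \<open>p\<close>, so the remainder
      is again a candidate; minimality puts \<open>degree r\<close> below
      \<open>degree p\<close>.\<close>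
    obtain s w r' where 1: "w \<in> polys_over A" "r' \<in> polys_over A"
      "smult (lead_coeff p ^ s) r = p * w + r'" "degree r' < degree p"
      using pseudo_division[OF A(1) p(1) r(1) pos] by blast
    have lA: "lead_coeff p ^ s \<in> A" using p(1) coeff_polys_over is_subring_power[OF A(1)] by blast
    have "poly r' y = lead_coeff p ^ s * poly r y"
      using arg_cong[OF 1(3), of "\<lambda>q. poly q y"] p(2) by simp
    moreover from this have "poly r' y \<noteq> 0"
      using dom powR[OF p(1,3), of s] r lA A(2) evalR[OF r(1)] by fastforce
    ultimately have "Q r'"
      unfolding Q_def using 1(2) u lA adjoin_base[OF A(1), of y] S(5)[of "lead_coeff p ^ s" u]
      by (auto simp: mult.assoc intro!: bexI[of _ "lead_coeff p ^ s * u"])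
    then have rp: "degree r < degree p" using rmin[of r'] 1(4) by simp
    have r0: "r \<noteq> 0" using dr by auto
    \<comment> \<open>Now \<open>p\<close> is divided by \<open>r\<close>. The remainder represents
      a multiple of \<open>b\<close> and has smaller degree, so it is a relation and then 0; in the
      domain the quotient \<open>w\<close> becomes a relation of \<open>y\<close> of degree below
      that of \<open>p\<close>.\<close>
    obtain s w r' where 2: "w \<in> polys_over A" "r' \<in> polys_over A"
      "smult (lead_coeff r ^ s) p = r * w + r'" "degree r' < degree r"
      using pseudo_division[OF A(1) r(1) p(1)] dr by blast
    have eq: "poly r' y = - (poly w y * u) * b"
      using arg_cong[OF 2(3), of "\<lambda>q. poly q y"] p(2) u(2)
      by (simp add: eq_neg_iff_add_eq_0 algebra_simps)
    have "poly r' y = 0"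
    proof (rule ccontr)
      assume "poly r' y \<noteq> 0"
      then have "Q r'" unfolding Q_def using eq 2(2) S(3,5) eval[OF 2(1)] u(1) by blast
      then show False using rmin[of r'] 2(4) by simp
    qed
    then have r'0: "r' = 0" using min 2(2,4) rp by simp
    have "poly w y * poly r y = 0"
      using arg_cong[OF 2(3), of "\<lambda>q. poly q y"] p(2) r'0 by (simp add: mult.commute)
    then have wy: "poly w y = 0" using dom evalR r 2(1) by blast
    have nz: "smult (lead_coeff r ^ s) p \<noteq> 0"
    proof
      assume "smult (lead_coeff r ^ s) p = 0"
      then have "lead_coeff r ^ s * lead_coeff p = 0" by (metis coeff_smult coeff_0)
      moreover have "lead_coeff r ^ s \<in> R" "lead_coeff p \<in> R"
        using r(1) p(1) A(2) coeff_polys_over is_subring_power[OF sR] by blast+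
      ultimately show False using dom[of "lead_coeff r ^ s" "lead_coeff p"] powR[OF r(1) r0, of s] p(3) by simp
    qed
    then have w0: "w \<noteq> 0" using 2(3) r'0 by auto
    have "degree r + degree w = degree (smult (lead_coeff r ^ s) p)"
      using degree_mult_domain[OF R _ _ r0 w0] r(1) 2(1,3) PR r'0 by fastforce
    also have "\<dots> \<le> degree p" by (rule degree_smult_le)
    finally have "degree w < degree p" using dr by simp
    then show False using min[OF 2(1) wy] w0 by simp
  qed
  then obtain a where "r = [:a:]" by (metis degree_eq_zeroE)
  then show ?thesis using that[OF u(1)] u(2) r polys_over_const[OF A(1)] by simp
qed

text \<open>The element \<open>a\<close> controls the bad specialisations. If \<open>y\<close> is
  transcendental, its image is free up to finitely many values; otherwise it must be a root of the
  specialised minimal relation, and \<open>b\<close> is controlled by a nonzero multiple of it that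
  lies in \<open>A\<close>.\<close>

lemma extension_adjoin:
  fixes R :: "'r::comm_ring_1 set"
  assumes R: "integral_domain_on R" and A: "is_subring A" "A \<subseteq> R" and y: "y \<in> R"
    and b: "b \<in> adjoin A y" "b \<noteq> 0"
  obtains a where "a \<in> A" "a \<noteq> 0"
    "\<And>\<psi> :: 'r \<Rightarrow> 'k::alg_closed_field. ring_hom_on A \<psi> \<Longrightarrow> \<psi> a \<noteq> 0 \<Longrightarrow>
      \<exists>\<psi>'. ring_hom_on (adjoin A y) \<psi>' \<and> (\<forall>x\<in>A. \<psi>' x = \<psi> x) \<and> \<psi>' b \<noteq> 0"
proof (cases "transcendental_over A y")
  case True
  obtain q where q: "q \<in> polys_over A" "b = poly q y" using b(1) by (auto simp: adjoin_def)
  then have q0: "q \<noteq> 0" using b(2) by auto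
  show ?thesis
  \<comment> \<open>A nonzero image of the leading coefficient makes the specialised
    \<open>q\<close> nonzero, so some \<open>t\<close> avoids its roots.\<close>
  proof (rule that[of "lead_coeff q"])
    fix \<psi> :: "'r \<Rightarrow> 'k" assume \<psi>: "ring_hom_on A \<psi>" "\<psi> (lead_coeff q) \<noteq> 0"
    have "map_poly \<psi> q \<noteq> 0"
      using \<psi>(2) coeff_map_poly_hom[OF A(1) \<psi>(1), of q "degree q"] by auto
    then have "finite {t. poly (map_poly \<psi> q) t = 0}" by (rule poly_roots_finite)
    then obtain t where t: "poly (map_poly \<psi> q) t \<noteq> 0"
      using alg_closed_infinite[where ?'k = 'k] by (metis (mono_tags, lifting) UNIV_eq_I mem_Collect_eq)
    obtain \<psi>' where "ring_hom_on (adjoin A y) \<psi>'" "\<And>x. x \<in> A \<Longrightarrow> \<psi>' x = \<psi> x"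
      "\<And>q. q \<in> polys_over A \<Longrightarrow> \<psi>' (poly q y) = poly (map_poly \<psi> q) t"
      using True by (elim hom_extend[OF A(1) \<psi>(1), of y t, rotated]) (auto simp: transcendental_over_def)
    then show "\<exists>\<psi>'. ring_hom_on (adjoin A y) \<psi>' \<and> (\<forall>x\<in>A. \<psi>' x = \<psi> x) \<and> \<psi>' b \<noteq> 0"
      using q t by auto
  qed (use q q0 in \<open>auto simp: coeff_polys_over\<close>)
next
  case False
  have sR: "is_subring R" using R by (simp add: integral_domain_on_def)
  define P where "P p \<longleftrightarrow> p \<in> polys_over A \<and> poly p y = 0 \<and> p \<noteq> 0" for p
  from False obtain p0 where "P p0" by (auto simp: transcendental_over_def P_def)
  then obtain p where "P p" and pmin: "\<And>q. P q \<Longrightarrow> degree p \<le> degree q"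
    using ex_has_least_nat[of P p0 degree] by blast
  then have p: "p \<in> polys_over A" "poly p y = 0" "p \<noteq> 0" by (auto simp: P_def)
  have min: "q = 0" if "q \<in> polys_over A" "poly q y = 0" "degree q < degree p" for q
    using pmin[of q] that by (auto simp: P_def)
  obtain u where u: "u \<in> adjoin A y" "u * b \<in> A" "u * b \<noteq> 0"
    by (rule algebraic_multiple_in_base[OF R A y b p min])
  have pos: "degree p > 0"
  proof (rule ccontr)
    assume "\<not> degree p > 0"
    then obtain a where "p = [:a:]" by (metis degree_eq_zeroE gr0I)
    then show False using p(2,3) by simp
  qed
  have l: "lead_coeff p \<in> A" using p(1) by (rule coeff_polys_over)
  show ?thesis
  \<comment> \<open>The first factor keeps the degree of the specialised relation positive and can
    be cancelled after pseudo-division; the second keeps the image of \<open>b\<close>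
    nonzero.\<close>
  proof (rule that[of "lead_coeff p * (u * b)"])
    show "lead_coeff p * (u * b) \<in> A" using is_subringD(5)[OF A(1) l u(2)] .
    show "lead_coeff p * (u * b) \<noteq> 0" using R l u(2,3) A(2) p(3) unfolding integral_domain_on_def
      by (metis leading_coeff_0_iff subsetD)
    fix \<psi> :: "'r \<Rightarrow> 'k" assume \<psi>: "ring_hom_on A \<psi>" "\<psi> (lead_coeff p * (u * b)) \<noteq> 0"
    note H = ring_hom_onD[OF \<psi>(1)]
    note HP = ring_hom_onD[OF ring_hom_on_map_poly[OF A(1) \<psi>(1)]]
    have nz: "\<psi> (lead_coeff p) \<noteq> 0" "\<psi> (u * b) \<noteq> 0" using \<psi>(2) H(4)[OF l u(2)] by auto
    then have "coeff (map_poly \<psi> p) (degree p) \<noteq> 0"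
      by (simp add: coeff_map_poly_hom[OF A(1) \<psi>(1)])
    then have "degree (map_poly \<psi> p) \<ge> degree p" by (rule le_degree)
    then obtain t where t: "poly (map_poly \<psi> p) t = 0"
      using pos alg_closed_imp_poly_has_root[of "map_poly \<psi> p"] by auto
    \<comment> \<open>By minimality every relation \<open>q\<close> is a multiple of
      \<open>p\<close> up to a power of the leading coefficient, so a root of the image of
      \<open>p\<close> is a root of the image of \<open>q\<close>.\<close>
    have "poly (map_poly \<psi> q) t = 0" if q: "q \<in> polys_over A" "poly q y = 0" for q
    proof -
      obtain s w r' where 1: "w \<in> polys_over A" "r' \<in> polys_over A"
        "smult (lead_coeff p ^ s) q = p * w + r'" "degree r' < degree p"
        using pseudo_division[OF A(1) p(1) q(1) pos] by blast
      have "poly r' y = 0" using arg_cong[OF 1(3), of "\<lambda>q. poly q y"] p(2) q(2) by simp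
      then have "r' = 0" using min 1(2,4) by blast
      then have "map_poly \<psi> (smult (lead_coeff p ^ s) q) = map_poly \<psi> p * map_poly \<psi> w"
        using 1 HP(4)[OF p(1) 1(1)] by simp
      then have "smult (\<psi> (lead_coeff p) ^ s) (map_poly \<psi> q) = map_poly \<psi> p * map_poly \<psi> w"
        using map_poly_smult_hom[OF A(1) \<psi>(1) is_subring_power[OF A(1) l, of s] q(1)]
          ring_hom_on_power[OF A(1) \<psi>(1) l, of s] by simp
      from arg_cong[OF this, of "\<lambda>q. poly q t"] show ?thesis using t nz(1) by simp
    qed
    then obtain \<psi>' where \<psi>': "ring_hom_on (adjoin A y) \<psi>'" "\<And>x. x \<in> A \<Longrightarrow> \<psi>' x = \<psi> x"
      using hom_extend[OF A(1) \<psi>(1), of y t] by blast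
    have "\<psi>' u * \<psi>' b = \<psi> (u * b)"
      using ring_hom_onD(4)[OF \<psi>'(1) u(1) b(1)] \<psi>'(2)[OF u(2)] by simp
    then have "\<psi>' b \<noteq> 0" using nz(2) by auto
    then show "\<exists>\<psi>'. ring_hom_on (adjoin A y) \<psi>' \<and> (\<forall>x\<in>A. \<psi>' x = \<psi> x) \<and> \<psi>' b \<noteq> 0"
      using \<psi>' by blast
  qed
qed

text \<open>Iteration of the one-element case. A general \<open>b\<close> is carried for the sake of
  the induction: the \<open>a\<close> found for the last adjunction is the \<open>b\<close> of the
  remaining list. The applications take \<open>b = 1\<close>.\<close>

lemma extension_adjoin_list:
  fixes R :: "'r::comm_ring_1 set"
  assumes R: "integral_domain_on R" and A: "is_subring A" "A \<subseteq> R"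
    and "set ys \<subseteq> R" "b \<in> adjoin_list A ys" "b \<noteq> 0"
  shows "\<exists>a\<in>A. a \<noteq> 0 \<and> (\<forall>\<psi> :: 'r \<Rightarrow> 'k::alg_closed_field. ring_hom_on A \<psi> \<longrightarrow> \<psi> a \<noteq> 0 \<longrightarrow>
      (\<exists>\<psi>'. ring_hom_on (adjoin_list A ys) \<psi>' \<and> (\<forall>x\<in>A. \<psi>' x = \<psi> x) \<and> \<psi>' b \<noteq> 0))"
  using assms(4-)
proof (induction ys arbitrary: b)
  case (Cons y ys)
  let ?B = "adjoin_list A ys"
  have sR: "is_subring R" using R by (simp add: integral_domain_on_def)
  have B: "is_subring ?B" "?B \<subseteq> R"
    using is_subring_adjoin_list[OF A(1)] adjoin_list_subset[OF sR A(2)] Cons.prems(1) by auto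
  obtain a where a: "a \<in> ?B" "a \<noteq> 0" "\<And>\<psi> :: 'r \<Rightarrow> 'k. ring_hom_on ?B \<psi> \<Longrightarrow> \<psi> a \<noteq> 0 \<Longrightarrow>
      \<exists>\<psi>'. ring_hom_on (adjoin ?B y) \<psi>' \<and> (\<forall>x\<in>?B. \<psi>' x = \<psi> x) \<and> \<psi>' b \<noteq> 0"
    using extension_adjoin[OF R B, of y b] Cons.prems by auto
  obtain a' where a': "a' \<in> A" "a' \<noteq> 0" "\<And>\<psi> :: 'r \<Rightarrow> 'k. ring_hom_on A \<psi> \<Longrightarrow> \<psi> a' \<noteq> 0 \<Longrightarrow>
      \<exists>\<psi>'. ring_hom_on ?B \<psi>' \<and> (\<forall>x\<in>A. \<psi>' x = \<psi> x) \<and> \<psi>' a \<noteq> 0"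
    using Cons.IH[OF _ a(1,2)] Cons.prems(1) by auto
  show ?case
  proof (intro bexI[OF _ a'(1)] conjI allI impI a'(2))
    fix \<psi> :: "'r \<Rightarrow> 'k" assume "ring_hom_on A \<psi>" "\<psi> a' \<noteq> 0"
    from a'(3)[OF this] obtain \<psi>1 where 1: "ring_hom_on ?B \<psi>1" "\<forall>x\<in>A. \<psi>1 x = \<psi> x" "\<psi>1 a \<noteq> 0" by blast
    from a(3)[OF 1(1,3)] obtain \<psi>2 where "ring_hom_on (adjoin ?B y) \<psi>2" "\<forall>x\<in>?B. \<psi>2 x = \<psi>1 x" "\<psi>2 b \<noteq> 0"
      by blast
    then show "\<exists>\<psi>'. ring_hom_on (adjoin_list A (y # ys)) \<psi>' \<and> (\<forall>x\<in>A. \<psi>' x = \<psi> x) \<and> \<psi>' b \<noteq> 0"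
      using 1(2) adjoin_list_base[OF A(1), of ys] by (intro exI[of _ \<psi>2]) auto
  qed
qed auto

section \<open>Transcendence degree\<close>

text \<open>The chain runs in the order in which \<open>adjoin_list\<close> adjoins, so prepending
  an element to an independent list costs a single transcendence check over a ring already at
  hand.\<close>

fun alg_indep :: "'r::comm_ring_1 set \<Rightarrow> 'r list \<Rightarrow> bool" where
  "alg_indep K [] \<longleftrightarrow> True"
| "alg_indep K (x # xs) \<longleftrightarrow> transcendental_over (adjoin_list K xs) x \<and> alg_indep K xs"

text \<open>Every exponent is bounded separately, instead of the total degree, so that the count is
  a pure power of \<open>D + 1\<close>.\<close>

fun monomials :: "nat \<Rightarrow> 'r::comm_ring_1 list \<Rightarrow> 'r set" where
  "monomials D [] = {1}"
| "monomials D (x # xs) = (\<lambda>(i, m). x ^ i * m) ` ({..D} \<times> monomials D xs)"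

lemma monomials_finite: "finite (monomials D xs)"
  by (induction xs) auto

lemma monomials_card: "card (monomials D xs) \<le> (D + 1) ^ length xs"
proof (induction xs)
  case (Cons x xs)
  have "card (monomials D (x # xs)) \<le> card ({..D} \<times> monomials D xs)"
    unfolding monomials.simps by (rule card_image_le) (simp add: monomials_finite)
  also have "\<dots> \<le> (D + 1) * (D + 1) ^ length xs"
    using mult_le_mono2[OF Cons, of "D + 1"] by (simp add: card_cartesian_product)
  finally show ?case by simp
qed simp

lemma monomials_mono: "D \<le> E \<Longrightarrow> monomials D xs \<subseteq> monomials E xs"
  by (induction xs) (fastforce simp: image_iff)+

lemma monomials_mult: "m \<in> monomials D xs \<Longrightarrow> m' \<in> monomials E xs \<Longrightarrow> m * m' \<in> monomials (D + E) xs"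
proof (induction xs arbitrary: m m')
  case (Cons x xs)
  then obtain i n j n' where "m = x ^ i * n" "i \<le> D" "n \<in> monomials D xs"
    "m' = x ^ j * n'" "j \<le> E" "n' \<in> monomials E xs" by auto
  then show ?case using Cons.IH[of n n']
    by (auto simp: image_iff power_add mult_ac intro!: bexI[of _ "i + j"] bexI[of _ "n * n'"])
qed simp

lemma one_in_monomials: "1 \<in> monomials D xs"
proof (induction xs)
  case (Cons x xs)
  then show ?case by (auto intro!: image_eqI[of _ _ "(0, 1)"])
qed simp

lemma gen_in_monomials: "x \<in> set xs \<Longrightarrow> x \<in> monomials 1 xs"
proof (induction xs)
  case (Cons y xs)
  show ?case
  proof (cases "x = y")
    case True
    then show ?thesis using one_in_monomials[of 1 xs]
      by (auto intro!: image_eqI[of _ _ "(1, 1)"])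
  next
    case False
    then show ?thesis using Cons by (auto intro!: image_eqI[of _ _ "(0, x)"])
  qed
qed simp

lemma monomials_adjoin_list: "is_subring K \<Longrightarrow> monomials D xs \<subseteq> adjoin_list K xs"
proof (induction xs)
  case (Cons x xs)
  note B = is_subring_adjoin_list[OF Cons.prems, of xs]
  show ?case
    using Cons adjoin_base[OF B, of x] is_subring_power[OF is_subring_adjoin[OF B] adjoin_gen[OF B]]
      is_subringD(5)[OF is_subring_adjoin[OF B, of x]] by fastforce
qed (simp add: is_subringD)

text \<open>Scalars act through constant functions, so that spans interact with the ring
  multiplication by mere commutativity.\<close>

definition fscale :: "'k::field \<Rightarrow> ('a \<Rightarrow> 'k) \<Rightarrow> 'a \<Rightarrow> 'k" where
  "fscale c f = (\<lambda>_. c) * f"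

lemma fscale_mult: "f * fscale c g = fscale c (f * g)" "fscale c f * g = fscale c (f * g)"
  by (simp_all add: fscale_def mult.left_commute mult.assoc)

interpretation fn: vector_space "fscale :: 'k::field \<Rightarrow> ('a \<Rightarrow> 'k) \<Rightarrow> 'a \<Rightarrow> 'k"
  by unfold_locales (auto simp: fscale_def fun_eq_iff algebra_simps)

abbreviation consts_fn :: "('a \<Rightarrow> 'k::field) set" where
  "consts_fn \<equiv> range (\<lambda>c _. c)"

lemma is_subring_consts_fn: "is_subring (consts_fn :: ('a \<Rightarrow> 'k::field) set)"
  unfolding is_subring_def by (auto simp: fun_eq_iff image_iff)

text \<open>Grouped by powers of \<open>x\<close>, a linear relation between monomials is a
  polynomial relation of \<open>x\<close> over the ring of the remaining entries; transcendence
  kills its coefficients, which are linear relations between the monomials of the tail.\<close>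

lemma monomials_independent:
  fixes xs :: "('a \<Rightarrow> 'k::field) list"
  assumes "alg_indep consts_fn xs"
  shows "fn.independent (monomials D xs) \<and> card (monomials D xs) = (D + 1) ^ length xs"
  using assms
proof (induction xs)
  case Nil
  show ?case by (simp add: fn.dependent_single)
next
  case (Cons x xs)
  let ?B = "adjoin_list consts_fn xs" and ?M = "monomials D xs"
  have B: "is_subring ?B" by (simp add: is_subring_adjoin_list is_subring_consts_fn)
  have ind: "fn.independent ?M" and card: "card ?M = (D + 1) ^ length xs"
    and tr: "transcendental_over ?B x" using Cons by auto
  have MB: "?M \<subseteq> ?B" by (simp add: monomials_adjoin_list is_subring_consts_fn)
  have zero: "0 \<notin> ?M" using ind fn.dependent_zero by blast
  \<comment> \<open>Two coinciding products would make \<open>monom m i - monom m' j\<close> a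
    relation of \<open>x\<close>. Since 0 is not among the monomials, equality of the two
    polynomials forces equal exponents and coefficients.\<close>
  have inj: "inj_on (\<lambda>(i, m). x ^ i * m) ({..D} \<times> ?M)"
  proof (rule inj_onI, clarsimp)
    fix i m j m' assume *: "m \<in> ?M" "m' \<in> ?M" "x ^ i * m = x ^ j * m'"
    have "monom m i - monom m' j \<in> polys_over ?B"
      using * MB by (intro is_subring_diff is_subring_polys_over monom_polys_over B) auto
    moreover have "poly (monom m i - monom m' j) x = 0"
      using *(3) by (simp add: poly_monom mult.commute)
    ultimately have eq: "monom m i = monom m' j" using tr by (auto simp: transcendental_over_def)
    moreover have "m \<noteq> 0" "m' \<noteq> 0" using * zero by auto
    ultimately show "i = j \<and> m = m'" by (metis degree_monom_eq coeff_monom)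
  qed
  have "u v = 0" if u: "(\<Sum>v\<in>monomials D (x # xs). fscale (u v) v) = 0"
    and v: "v \<in> monomials D (x # xs)" for u v
  proof -
    obtain i m where im: "i \<le> D" "m \<in> ?M" "v = x ^ i * m" using v by auto
    define p where "p = (\<Sum>i\<le>D. monom (\<Sum>m\<in>?M. fscale (u (x ^ i * m)) m) i)"
    have "(\<Sum>m\<in>?M. fscale (u (x ^ i * m)) m) \<in> ?B" for i
      using MB adjoin_list_base[OF is_subring_consts_fn, of xs]
      unfolding fscale_def by (intro is_subring_sum B is_subringD(5)[OF B]) auto
    then have pB: "p \<in> polys_over ?B" unfolding p_def
      by (intro is_subring_sum[OF is_subring_polys_over[OF B]] monom_polys_over[OF B]) simp
    have "poly p x = (\<Sum>i\<le>D. \<Sum>m\<in>?M. fscale (u (x ^ i * m)) (x ^ i * m))"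
      unfolding p_def poly_sum poly_monom sum_distrib_right by (simp add: fscale_mult mult.commute)
    also have "\<dots> = (\<Sum>(i, m)\<in>{..D} \<times> ?M. fscale (u (x ^ i * m)) (x ^ i * m))"
      by (rule sum.cartesian_product)
    also have "\<dots> = sum ((\<lambda>v. fscale (u v) v) \<circ> (\<lambda>(i, m). x ^ i * m)) ({..D} \<times> ?M)"
      by (rule sum.cong[OF refl]) (simp only: comp_apply split_paired_all prod.case)
    also have "\<dots> = (\<Sum>v\<in>monomials D (x # xs). fscale (u v) v)"
      by (simp only: monomials.simps sum.reindex[OF inj])
    also have "\<dots> = 0" by (fact u)
    finally have "p = 0" using tr pB unfolding transcendental_over_def by blast
    moreover have "coeff p i = (\<Sum>m\<in>?M. fscale (u (x ^ i * m)) m)"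
      using im(1) by (simp add: p_def coeff_sum sum.delta)
    ultimately have "(\<Sum>m\<in>?M. fscale (u (x ^ i * m)) m) = 0" by simp
    then show "u v = 0"
      using fn.independentD[OF ind monomials_finite subset_refl, of "\<lambda>m. u (x ^ i * m)" m] im(2,3)
      by simp
  qed
  then have "fn.independent (monomials D (x # xs))"
    unfolding fn.dependent_finite[OF monomials_finite] by blast
  moreover have "card (monomials D (x # xs)) = (D + 1) ^ length (x # xs)"
    using card_image[OF inj] card by (simp add: card_cartesian_product)
  ultimately show ?case by (rule conjI)
qed

lemma span_monomials_mult:
  fixes xs :: "('a \<Rightarrow> 'k::field) list"
  assumes "f \<in> fn.span (monomials D xs)" "g \<in> fn.span (monomials E xs)"
  shows "f * g \<in> fn.span (monomials (D + E) xs)"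
proof -
  let ?S = "fn.span (monomials (D + E) xs)"
  have *: "m * g \<in> ?S" if m: "m \<in> monomials D xs" for m
  proof (rule fn.span_induct[OF assms(2)])
    show "fn.subspace {g. m * g \<in> ?S}"
      by (rule fn.subspaceI) (auto simp: fn.span_zero fn.span_add distrib_left fscale_mult fn.span_scale)
    show "m * m' \<in> ?S" if "m' \<in> monomials E xs" for m'
      using monomials_mult[OF m that] by (rule fn.span_base)
  qed
  show ?thesis
  proof (rule fn.span_induct[OF assms(1)])
    show "fn.subspace {f. f * g \<in> ?S}"
      by (rule fn.subspaceI) (auto simp: fn.span_zero fn.span_add distrib_right fscale_mult fn.span_scale)
  qed (rule *)
qed

text \<open>Exponent bounds add under products, so the union of the spans over all bounds is itself
  a subring; it contains the constants and the generators.\<close>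

lemma adjoin_list_in_span:
  fixes xs :: "('a \<Rightarrow> 'k::field) list"
  assumes "f \<in> adjoin_list consts_fn xs"
  shows "\<exists>E. f \<in> fn.span (monomials E xs)"
proof -
  let ?V = "{f. \<exists>E. f \<in> fn.span (monomials E xs)}"
  have c: "(\<lambda>_. c) \<in> ?V" for c
  proof -
    have "fscale c 1 \<in> ?V"
      using fn.span_scale[OF fn.span_base[OF one_in_monomials[of 0 xs]], of c] by blast
    also have "fscale c 1 = (\<lambda>_. c)" by (simp add: fscale_def)
    finally show ?thesis .
  qed
  have mult: "f * g \<in> ?V" if fg: "f \<in> ?V" "g \<in> ?V" for f g
  proof -
    from fg obtain D E where "f \<in> fn.span (monomials D xs)" "g \<in> fn.span (monomials E xs)" by auto
    from span_monomials_mult[OF this] show ?thesis by blast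
  qed
  have add: "f + g \<in> ?V" if fg: "f \<in> ?V" "g \<in> ?V" for f g
  proof -
    from fg obtain D E where DE: "f \<in> fn.span (monomials D xs)" "g \<in> fn.span (monomials E xs)" by auto
    have "f \<in> fn.span (monomials (max D E) xs)"
      using DE(1) fn.span_mono[OF monomials_mono[of D "max D E" xs]] by auto
    moreover have "g \<in> fn.span (monomials (max D E) xs)"
      using DE(2) fn.span_mono[OF monomials_mono[of E "max D E" xs]] by auto
    ultimately show ?thesis using fn.span_add by blast
  qed
  have neg: "- f \<in> ?V" if f: "f \<in> ?V" for f
  proof -
    from f obtain D where "f \<in> fn.span (monomials D xs)" by auto
    from fn.span_neg[OF this] show ?thesis by blast
  qed
  have "is_subring ?V"
    unfolding is_subring_def
  proof (intro conjI ballI)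
    show "0 \<in> ?V" using c[of 0] unfolding zero_fun_def .
    show "1 \<in> ?V" using c[of 1] unfolding one_fun_def .
  qed (fact neg add mult)+
  moreover have "set xs \<subseteq> ?V" using gen_in_monomials by (auto intro: fn.span_base)
  ultimately have "adjoin_list consts_fn xs \<subseteq> ?V" using c by (intro adjoin_list_subset) auto
  then show ?thesis using assms by blast
qed

text \<open>Counting monomials: an algebraically independent family of length \<open>d\<close> has \<open>(D + 1)\<^sup>d\<close> monomials,
  which lie in a space of dimension \<open>O(D\<^sup>n)\<close>.\<close>

lemma alg_indep_length_le:
  fixes xs ys :: "('a \<Rightarrow> 'k::field) list"
  assumes xs: "set xs \<subseteq> adjoin_list consts_fn ys" and ind: "alg_indep consts_fn xs"
  shows "length xs \<le> length ys"
proof (rule ccontr)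
  assume less: "\<not> length xs \<le> length ys"
  have "\<exists>E. \<forall>x\<in>set xs. x \<in> fn.span (monomials E ys)"
    using xs
  proof (induction xs)
    case (Cons x xs)
    then obtain D E where "\<forall>x\<in>set xs. x \<in> fn.span (monomials D ys)" "x \<in> fn.span (monomials E ys)"
      using adjoin_list_in_span[of x ys] by auto
    then have "\<forall>x\<in>set (x # xs). x \<in> fn.span (monomials (max D E) ys)"
      using fn.span_mono[OF monomials_mono[of D "max D E" ys]]
        fn.span_mono[OF monomials_mono[of E "max D E" ys]] by auto
    then show ?case by blast
  qed simp
  then obtain E where E: "\<And>x. x \<in> set xs \<Longrightarrow> x \<in> fn.span (monomials E ys)" by blast
  have pow: "x ^ i \<in> fn.span (monomials (i * E) ys)" if "x \<in> set xs" for x i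
  proof (induction i)
    case 0
    show ?case unfolding power_0 by (rule fn.span_base[OF one_in_monomials])
  next
    case (Suc i)
    show ?case unfolding power_Suc mult_Suc by (rule span_monomials_mult[OF E[OF that] Suc])
  qed
  have sub: "monomials D zs \<subseteq> fn.span (monomials (length zs * (D * E)) ys)" if "set zs \<subseteq> set xs" for D zs
    using that
  proof (induction zs)
    case (Cons z zs)
    have "z ^ i * m \<in> fn.span (monomials (length (z # zs) * (D * E)) ys)"
      if "i \<le> D" "m \<in> monomials D zs" for i m
    proof -
      have "z ^ i * m \<in> fn.span (monomials (i * E + length zs * (D * E)) ys)"
        using Cons that by (intro span_monomials_mult pow) auto
      moreover have "i * E + length zs * (D * E) \<le> length (z # zs) * (D * E)"
        using that by simp
      ultimately show ?thesis using fn.span_mono monomials_mono by blast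
    qed
    then show ?case by auto
  next
    case Nil
    show ?case unfolding monomials.simps using fn.span_base[OF one_in_monomials] by blast
  qed
  define n where "n = length ys"
  \<comment> \<open>A monomial with exponents up to \<open>D\<close> in \<open>xs\<close> lies in
    the span of those with exponents up to \<open>length xs * (D * E)\<close> in \<open>ys\<close>,
    of which there are at most \<open>((D + 1) * M) ^ n\<close>. With \<open>D = M ^ n\<close> this
    is \<open>(D + 1) ^ n * D\<close>, just below \<open>(D + 1) ^ (n + 1)\<close>.\<close>
  define M where "M = length xs * E + 1"
  define D where "D = M ^ n"
  have "(D + 1) ^ (n + 1) \<le> (D + 1) ^ length xs"
    using less by (intro power_increasing) (auto simp: n_def)
  also have "\<dots> = card (monomials D xs)" using monomials_independent[OF ind] by simp
  also have "\<dots> \<le> card (monomials (length xs * (D * E)) ys)"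
    using fn.independent_span_bound[OF monomials_finite _ sub[of xs D]] monomials_independent[OF ind] by blast
  also have "\<dots> \<le> (length xs * (D * E) + 1) ^ n" unfolding n_def by (rule monomials_card)
  also have "\<dots> \<le> ((D + 1) * M) ^ n"
    by (rule power_mono) (auto simp: M_def algebra_simps)
  also have "\<dots> = (D + 1) ^ n * D" by (simp only: power_mult_distrib D_def)
  also have "\<dots> < (D + 1) ^ (n + 1)" by simp
  finally show False by simp
qed

section \<open>Images and preimages of independent lists under a homomorphism\<close>

lemma is_subring_image:
  assumes "is_subring R" "ring_hom_on R \<theta>"
  shows "is_subring (\<theta> ` R)"
  unfolding is_subring_def
proof (intro conjI ballI; (elim imageE)?)
  note S = is_subringD[OF assms(1)] and H = ring_hom_onD[OF assms(2)]
  show "0 \<in> \<theta> ` R" by (rule image_eqI[where x = 0]) (simp_all add: H S)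
  show "1 \<in> \<theta> ` R" by (rule image_eqI[where x = 1]) (simp_all add: H S)
  show "- x \<in> \<theta> ` R" if "x = \<theta> u" "u \<in> R" for x u
    by (rule image_eqI[where x = "- u"]) (use that ring_hom_on_uminus[OF assms] S(3) in simp_all)
  fix x y u v assume uv: "x = \<theta> u" "u \<in> R" "y = \<theta> v" "v \<in> R"
  show "x + y \<in> \<theta> ` R" by (rule image_eqI[where x = "u + v"]) (use uv in \<open>simp_all add: H S\<close>)
  show "x * y \<in> \<theta> ` R" by (rule image_eqI[where x = "u * v"]) (use uv in \<open>simp_all add: H S\<close>)
qed

lemma polys_over_image:
  assumes B: "is_subring B" "ring_hom_on B \<theta>" and "p \<in> polys_over (\<theta> ` B)"
  shows "\<exists>p'\<in>polys_over B. p = map_poly \<theta> p'"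
  using assms(3)
proof (induction p)
  case 0
  show ?case using is_subringD(1)[OF is_subring_polys_over[OF B(1)]] by (intro bexI[of _ 0]) auto
next
  case (pCons a p)
  then have "a \<in> \<theta> ` B" "p \<in> polys_over (\<theta> ` B)"
    using pCons_polys_over[OF is_subring_image[OF B], of a p] by auto
  with pCons obtain b p' where "b \<in> B" "a = \<theta> b" "p' \<in> polys_over B" "p = map_poly \<theta> p'" by blast
  then show ?case
    using pCons_polys_over[OF B(1), of b p'] ring_hom_onD(1)[OF B(2)]
    by (intro bexI[of _ "pCons b p'"]) (simp_all add: map_poly_pCons)
qed

lemma adjoin_image:
  assumes R: "is_subring R" "ring_hom_on R \<theta>" and B: "is_subring B" "B \<subseteq> R" and x: "x \<in> R"
  shows "adjoin (\<theta> ` B) (\<theta> x) = \<theta> ` adjoin B x"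
proof -
  have hom: "\<theta> (poly p x) = poly (map_poly \<theta> p) (\<theta> x)" if "p \<in> polys_over B" for p
    using hom_poly[OF R, of p x] that x B(2) by (auto simp: polys_over_def)
  have hB: "ring_hom_on B \<theta>" using R(2) B(2) by (rule ring_hom_on_subset)
  show ?thesis
  proof
    show "adjoin (\<theta> ` B) (\<theta> x) \<subseteq> \<theta> ` adjoin B x"
    proof
      fix z assume "z \<in> adjoin (\<theta> ` B) (\<theta> x)"
      then obtain p where p: "p \<in> polys_over (\<theta> ` B)" "z = poly p (\<theta> x)" by (auto simp: adjoin_def)
      then obtain p' where p': "p' \<in> polys_over B" "p = map_poly \<theta> p'"
        using polys_over_image[OF B(1) hB] by blast
      then have "z = \<theta> (poly p' x)" using p(2) hom by simp
      then show "z \<in> \<theta> ` adjoin B x" using p'(1) unfolding adjoin_def by blast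
    qed
    show "\<theta> ` adjoin B x \<subseteq> adjoin (\<theta> ` B) (\<theta> x)"
    proof (rule image_subsetI)
      fix z assume "z \<in> adjoin B x"
      then obtain p where p: "p \<in> polys_over B" "z = poly p x" by (auto simp: adjoin_def)
      then have "map_poly \<theta> p \<in> polys_over (\<theta> ` B)"
        by (simp add: polys_over_def coeff_map_poly_hom[OF B(1) hB])
      then show "\<theta> z \<in> adjoin (\<theta> ` B) (\<theta> x)"
        using hom[OF p(1)] p(2) by (auto simp: adjoin_def)
    qed
  qed
qed

lemma adjoin_list_image:
  assumes R: "is_subring R" "ring_hom_on R \<theta>" and K: "is_subring K" "K \<subseteq> R" "\<And>c. c \<in> K \<Longrightarrow> \<theta> c = c"
    and "set xs \<subseteq> R"
  shows "adjoin_list K (map \<theta> xs) = \<theta> ` adjoin_list K xs"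
  using assms(6)
proof (induction xs)
  case (Cons x xs)
  then show ?case
    using adjoin_image[OF R is_subring_adjoin_list[OF K(1)] adjoin_list_subset[OF R(1) K(2)], of xs x] by simp
qed (use K(3) in simp)

text \<open>The transcendence degree, bounded by \<open>N\<close>, is encoded as the length of the longest chain-wise
  algebraically independent lists.\<close>

locale bounded_trdeg =
  fixes K R :: "'r::comm_ring_1 set" and N :: nat and \<theta> :: "'r \<Rightarrow> 'r"
  assumes dom: "integral_domain_on R" and K: "is_subring K" "K \<subseteq> R"
    and bound: "\<And>xs. set xs \<subseteq> R \<Longrightarrow> alg_indep K xs \<Longrightarrow> length xs \<le> N"
    and \<theta>: "ring_hom_on R \<theta>" "\<theta> ` R \<subseteq> R" "\<And>c. c \<in> K \<Longrightarrow> \<theta> c = c"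
begin

lemma R: "is_subring R" using dom by (simp add: integral_domain_on_def)

lemma adjoin_sub: "set xs \<subseteq> R \<Longrightarrow> adjoin_list K xs \<subseteq> R"
  using adjoin_list_subset[OF R K(2)] .

text \<open>If \<theta> kills \<open>poly p x\<close>, the image of \<open>p\<close> is a relation
  of \<open>\<theta> x\<close>, hence zero, and injectivity on \<open>B\<close> gives
  \<open>p = 0\<close>. Both conclusions are this one implication.\<close>

lemma transcendental_image_iff:
  assumes B: "is_subring B" "B \<subseteq> R" and inj: "\<And>f. f \<in> B \<Longrightarrow> \<theta> f = 0 \<Longrightarrow> f = 0"
    and x: "x \<in> R" "transcendental_over (\<theta> ` B) (\<theta> x)"
  shows "transcendental_over B x" "\<And>f. f \<in> adjoin B x \<Longrightarrow> \<theta> f = 0 \<Longrightarrow> f = 0"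
proof -
  have hB: "ring_hom_on B \<theta>" using \<theta>(1) B(2) by (rule ring_hom_on_subset)
  have key: "p = 0" if p: "p \<in> polys_over B" "\<theta> (poly p x) = 0" for p
  proof -
    have "\<theta> (poly p x) = poly (map_poly \<theta> p) (\<theta> x)"
      using hom_poly[OF R \<theta>(1), of p x] p(1) x B(2) by (auto simp: polys_over_def)
    moreover have "map_poly \<theta> p \<in> polys_over (\<theta> ` B)"
      using p(1) by (auto simp: polys_over_def coeff_map_poly_hom[OF B(1) hB])
    ultimately have "map_poly \<theta> p = 0" using x(2) p(2) by (auto simp: transcendental_over_def)
    then have "\<theta> (coeff p i) = 0" for i using coeff_map_poly_hom[OF B(1) hB, of p i] by simp
    then show "p = 0" using inj p(1) by (auto intro: poly_eqI simp: polys_over_def)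
  qed
  show "transcendental_over B x"
    using key ring_hom_onD(1)[OF \<theta>(1)] by (auto simp: transcendental_over_def)
  show "f = 0" if f: "f \<in> adjoin B x" "\<theta> f = 0" for f
  proof -
    from f(1) obtain p where p: "p \<in> polys_over B" "f = poly p x" by (auto simp: adjoin_def)
    then have "p = 0" using key f(2) by blast
    then show ?thesis using p(2) by simp
  qed
qed

text \<open>Independence and injectivity are carried together, because the step for \<open>x\<close>
  needs \<theta> to be injective on the ring generated by the tail.\<close>

lemma alg_indep_pullback:
  assumes "set xs \<subseteq> R" "alg_indep K (map \<theta> xs)"
  shows "alg_indep K xs \<and> (\<forall>f\<in>adjoin_list K xs. \<theta> f = 0 \<longrightarrow> f = 0)"
  using assms
proof (induction xs)
  case (Cons x xs)
  let ?B = "adjoin_list K xs"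
  have B: "is_subring ?B" "?B \<subseteq> R" using is_subring_adjoin_list[OF K(1)] adjoin_sub Cons.prems by auto
  have IH: "alg_indep K xs" "\<And>f. f \<in> ?B \<Longrightarrow> \<theta> f = 0 \<Longrightarrow> f = 0" using Cons by auto
  have x: "x \<in> R" "transcendental_over (\<theta> ` ?B) (\<theta> x)"
    using Cons.prems adjoin_list_image[OF R \<theta>(1) K \<theta>(3), of xs] by auto
  note * = transcendental_image_iff[OF B IH(2) x]
  show ?case unfolding alg_indep.simps adjoin_list_simps using *(1) IH(1) *(2) by blast
qed (use \<theta>(3) in auto)

lemma alg_indep_map:
  assumes inj: "\<And>f. f \<in> R \<Longrightarrow> \<theta> f = 0 \<Longrightarrow> f = 0"
  shows "set xs \<subseteq> R \<Longrightarrow> alg_indep K xs \<Longrightarrow> alg_indep K (map \<theta> xs)"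
proof (induction xs)
  case (Cons x xs)
  let ?B = "adjoin_list K xs"
  have B: "is_subring ?B" "?B \<subseteq> R" using is_subring_adjoin_list[OF K(1)] adjoin_sub Cons.prems by auto
  have hB: "ring_hom_on ?B \<theta>" using \<theta>(1) B(2) by (rule ring_hom_on_subset)
  have "transcendental_over (\<theta> ` ?B) (\<theta> x)"
    unfolding transcendental_over_def
  proof (intro ballI impI)
    fix p assume p: "p \<in> polys_over (\<theta> ` ?B)" "poly p (\<theta> x) = 0"
    then obtain p' where p': "p' \<in> polys_over ?B" "p = map_poly \<theta> p'" using polys_over_image[OF B(1) hB] by blast
    have pR: "p' \<in> polys_over R" using p'(1) B(2) by (auto simp: polys_over_def)
    have xR: "x \<in> R" using Cons.prems(1) by simp
    have "\<theta> (poly p' x) = 0" using hom_poly[OF R \<theta>(1) pR xR] p(2) p'(2) by simp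
    then have "poly p' x = 0" by (rule inj[OF poly_in_subring[OF R pR xR]])
    moreover have "transcendental_over ?B x" using Cons.prems(2) by simp
    ultimately have "p' = 0" using p'(1) unfolding transcendental_over_def by blast
    then show "p = 0" using p' by simp
  qed
  moreover have "adjoin_list K (map \<theta> xs) = \<theta> ` ?B" "alg_indep K (map \<theta> xs)"
    using Cons adjoin_list_image[OF R \<theta>(1) K \<theta>(3), of xs] by simp_all
  ultimately show ?case by simp
qed simp

lemma longest_alg_indep:
  assumes "S \<subseteq> R"
  obtains xs where "set xs \<subseteq> S" "alg_indep K xs"
    "\<And>ys. set ys \<subseteq> S \<Longrightarrow> alg_indep K ys \<Longrightarrow> length ys \<le> length xs"
proof -
  define P where "P xs \<longleftrightarrow> set xs \<subseteq> S \<and> alg_indep K xs" for xs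
  have "P []" by (simp add: P_def)
  moreover have "\<forall>xs. P xs \<longrightarrow> length xs < Suc N"
    using bound assms unfolding P_def by (meson order_trans less_Suc_eq_le)
  ultimately have "\<exists>xs. P xs \<and> (\<forall>ys. P ys \<longrightarrow> length ys \<le> length xs)"
    by (rule ex_has_greatest_nat[of P "[]" length "Suc N"])
  then obtain xs where xs: "P xs" "\<And>ys. P ys \<Longrightarrow> length ys \<le> length xs" by (elim exE conjE) simp
  show ?thesis by (rule that[of xs]) (use xs in \<open>simp_all add: P_def\<close>)
qed

lemma transcendental_antimono: "transcendental_over A y \<Longrightarrow> B \<subseteq> A \<Longrightarrow> transcendental_over B y"
  by (auto simp: transcendental_over_def polys_over_def)

text \<open>An injective \<theta> carries a longest independent list to one of the same length
  inside the image; an element transcendental over the image could be prepended to it.\<close>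

lemma algebraic_over_image:
  assumes inj: "\<And>f. f \<in> R \<Longrightarrow> \<theta> f = 0 \<Longrightarrow> f = 0" and y: "y \<in> R"
  shows "\<not> transcendental_over (\<theta> ` R) y"
proof
  assume tr: "transcendental_over (\<theta> ` R) y"
  obtain xs where xs: "set xs \<subseteq> R" "alg_indep K xs"
    and max: "\<And>ys. set ys \<subseteq> R \<Longrightarrow> alg_indep K ys \<Longrightarrow> length ys \<le> length xs"
    using longest_alg_indep[OF order_refl] by metis
  have "adjoin_list K (map \<theta> xs) \<subseteq> \<theta> ` R"
    using adjoin_list_image[OF R \<theta>(1) K \<theta>(3) xs(1)] adjoin_sub[OF xs(1)] by auto
  then have "alg_indep K (y # map \<theta> xs)"
    using alg_indep_map[OF inj xs] transcendental_antimono[OF tr] by simp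
  then show False using max[of "y # map \<theta> xs"] y xs(1) \<theta>(2) by auto
qed

text \<open>In a relation of least degree a vanishing constant term could be divided out, since
  \<open>y\<close> is a nonzero element of a domain.\<close>

lemma algebraic_relation:
  assumes y: "y \<in> R" "y \<noteq> 0" and A: "is_subring A" "A \<subseteq> R" and "\<not> transcendental_over A y"
  obtains p where "p \<in> polys_over A" "poly p y = 0" "coeff p 0 \<noteq> 0"
proof -
  define P where "P p \<longleftrightarrow> p \<in> polys_over A \<and> poly p y = 0 \<and> p \<noteq> 0" for p
  from assms(5) obtain p0 where "P p0" by (auto simp: transcendental_over_def P_def)
  then obtain p where p: "P p" and pmin: "\<And>q. P q \<Longrightarrow> degree p \<le> degree q"
    using ex_has_least_nat[of P p0 degree] by blast
  have "coeff p 0 \<noteq> 0"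
  proof
    assume "coeff p 0 = 0"
    then obtain q where q: "p = pCons 0 q" by (metis coeff_pCons_0 pCons_cases)
    then have "q \<in> polys_over A" "q \<noteq> 0" using p pCons_polys_over[OF A(1), of 0 q] by (auto simp: P_def)
    moreover have "poly q y \<in> R"
      using \<open>q \<in> polys_over A\<close> A(2) y(1) poly_in_subring[OF R, of q y] by (auto simp: polys_over_def)
    then have "poly q y = 0" using p q y dom by (auto simp: P_def integral_domain_on_def)
    ultimately have "P q" by (simp add: P_def)
    then show False using pmin[of q] q \<open>q \<noteq> 0\<close> by simp
  qed
  then show ?thesis using that p by (auto simp: P_def)
qed

text \<open>The list \<open>xs\<close> lifts to a list \<open>ys\<close> in the image of \<theta>,
  again independent and with \<theta> injective on the ring it generates. By maximality
  \<open>q\<close> is algebraic over that ring. Applying \<theta> to a relation of \<open>q\<close>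
  leaves only its constant term, which would be a nonzero element of the kernel.\<close>

lemma kernel_stable_of_trdeg:
  assumes xs: "set xs \<subseteq> \<theta> ` \<theta> ` R" "alg_indep K xs"
    and max: "\<And>ys. set ys \<subseteq> \<theta> ` R \<Longrightarrow> alg_indep K ys \<Longrightarrow> length ys \<le> length xs"
    and q: "q \<in> \<theta> ` R" "\<theta> q = 0"
  shows "q = 0"
proof (rule ccontr)
  assume q0: "q \<noteq> 0"
  have "xs \<in> map \<theta> ` lists (\<theta> ` R)" using xs(1) unfolding lists_image[symmetric] by auto
  then obtain ys where ys: "set ys \<subseteq> \<theta> ` R" "xs = map \<theta> ys" by auto
  have ysR: "set ys \<subseteq> R" using ys(1) \<theta>(2) by blast
  have ind: "alg_indep K ys" and inj: "\<And>f. f \<in> adjoin_list K ys \<Longrightarrow> \<theta> f = 0 \<Longrightarrow> f = 0"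
    using alg_indep_pullback[OF ysR] xs(2) ys(2) by auto
  have "\<not> transcendental_over (adjoin_list K ys) q"
    using max[of "q # ys"] ind ys q(1) by auto
  then obtain p where p: "p \<in> polys_over (adjoin_list K ys)" "poly p q = 0" "coeff p 0 \<noteq> 0"
    using algebraic_relation[OF _ q0 is_subring_adjoin_list[OF K(1)] adjoin_sub[OF ysR]] q(1) \<theta>(2) by blast
  have pR: "p \<in> polys_over R" using p(1) adjoin_sub[OF ysR] by (auto simp: polys_over_def)
  have "0 = poly (map_poly \<theta> p) 0"
    using hom_poly[OF R \<theta>(1) pR, of q] q \<theta>(2) p(2) ring_hom_onD(1)[OF \<theta>(1)] by auto
  then have "\<theta> (coeff p 0) = 0" by (simp add: poly_0_coeff_0 coeff_map_poly_hom[OF R \<theta>(1)])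
  then show False using inj p(1,3) by (auto simp: polys_over_def)
qed

lemma bounded_trdeg_funpow: "bounded_trdeg K R N (\<theta> ^^ m)"
proof -
  have "ring_hom_on R (\<theta> ^^ m) \<and> (\<theta> ^^ m) ` R \<subseteq> R \<and> (\<forall>c\<in>K. (\<theta> ^^ m) c = c)"
  proof (induction m)
    case 0
    show ?case by (simp add: ring_hom_on_def)
  next
    case (Suc m)
    then have "x \<in> R \<Longrightarrow> (\<theta> ^^ m) x \<in> R" for x by auto
    then show ?case using Suc \<theta> by (auto simp: ring_hom_on_def)
  qed
  then show ?thesis using dom K bound unfolding bounded_trdeg_def by auto
qed

lemma injective_of_algebraic:
  assumes alg: "\<And>m h. h \<in> R \<Longrightarrow> \<not> transcendental_over ((\<theta> ^^ m) ` R) h"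
    and f: "f \<in> R" "\<theta> f = 0"
  shows "f = 0"
proof (rule ccontr)
  assume f0: "f \<noteq> 0"
  have sub: "(\<theta> ^^ m) ` R \<subseteq> R" for m
    using bounded_trdeg_funpow by (rule bounded_trdeg.\<theta>(2))
  \<comment> \<open>\<open>P m d\<close> says that the image of the \<open>m\<close>-th power has
    transcendence degree \<open>d\<close>. Requiring \<open>m > 0\<close> puts the kernel of
    \<theta> inside the kernel of that power.\<close>
  define P where "P m d \<longleftrightarrow> m > 0 \<and> (\<exists>xs. set xs \<subseteq> (\<theta> ^^ m) ` R \<and> alg_indep K xs \<and> length xs = d
    \<and> (\<forall>ys. set ys \<subseteq> (\<theta> ^^ m) ` R \<longrightarrow> alg_indep K ys \<longrightarrow> length ys \<le> d))" for m d
  have ex: "\<exists>d. P m d" if "m > 0" for m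
  proof -
    obtain xs where "set xs \<subseteq> (\<theta> ^^ m) ` R" "alg_indep K xs"
      "\<And>ys. set ys \<subseteq> (\<theta> ^^ m) ` R \<Longrightarrow> alg_indep K ys \<Longrightarrow> length ys \<le> length xs"
      using longest_alg_indep[OF sub[of m]] by blast
    then show ?thesis using that unfolding P_def by (intro exI[of _ "length xs"]) blast
  qed
  \<comment> \<open>With \<open>d\<close> least over all powers, the image of the power
    \<open>m + m\<close> has degree at least that of the power \<open>m\<close>; this is the
    maximality that makes the \<open>m\<close>-th power injective on its image.\<close>
  define d where "d = (LEAST d. \<exists>m. P m d)"
  have "\<exists>m. P m d"
    unfolding d_def using ex[of 1] by (intro LeastI_ex[of "\<lambda>d. \<exists>m. P m d"]) auto
  then obtain m where m: "P m d" by blast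
  have mpos: "m > 0" using m unfolding P_def by (rule conjunct1)
  have dmin: "d \<le> e" if "P m' e" for m' e
    unfolding d_def by (rule Least_le[of "\<lambda>d. \<exists>m. P m d"]) (use that in blast)
  interpret \<eta>: bounded_trdeg K R N "\<theta> ^^ m" by (rule bounded_trdeg_funpow)
  obtain e where e: "P (m + m) e" using ex[of "m + m"] mpos by auto
  have comp: "(\<theta> ^^ (m + m)) ` R = (\<theta> ^^ m) ` (\<theta> ^^ m) ` R"
    by (simp only: funpow_add image_comp)
  obtain xs where xs: "set xs \<subseteq> (\<theta> ^^ m) ` (\<theta> ^^ m) ` R" "alg_indep K xs" "length xs = e"
    using e unfolding P_def comp by blast
  have stable: "q = 0" if "q \<in> (\<theta> ^^ m) ` R" "(\<theta> ^^ m) q = 0" for q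
  proof (rule \<eta>.kernel_stable_of_trdeg[OF xs(1,2) _ that])
    fix ys assume "set ys \<subseteq> (\<theta> ^^ m) ` R" "alg_indep K ys"
    then have "length ys \<le> d" using m unfolding P_def by blast
    then show "length ys \<le> length xs" using dmin[OF e] xs(3) by simp
  qed
  have z: "(\<theta> ^^ k) 0 = 0" for k by (induction k) (auto simp: ring_hom_onD(1)[OF \<theta>(1)])
  obtain k where "m = Suc k" using mpos by (auto simp: gr0_conv_Suc)
  then have \<eta>f: "(\<theta> ^^ m) f = 0" using f(2) z by (simp add: funpow_Suc_right del: funpow.simps)
  \<comment> \<open>The constant term of this relation lies in the image of the power, where
    \<open>stable\<close> forbids a kernel.\<close>
  obtain p where p: "p \<in> polys_over ((\<theta> ^^ m) ` R)" "poly p f = 0" "coeff p 0 \<noteq> 0"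
    using algebraic_relation[OF f(1) f0 is_subring_image[OF R \<eta>.\<theta>(1)] sub alg[OF f(1)]] by blast
  have pR: "p \<in> polys_over R" using p(1) sub[of m] by (auto simp: polys_over_def)
  have "0 = poly (map_poly (\<theta> ^^ m) p) 0"
    using hom_poly[OF R \<eta>.\<theta>(1) pR f(1)] \<eta>f p(2) ring_hom_onD(1)[OF \<eta>.\<theta>(1)] by simp
  then have "(\<theta> ^^ m) (coeff p 0) = 0" by (simp add: poly_0_coeff_0 coeff_map_poly_hom[OF R \<eta>.\<theta>(1)])
  then show False using stable p(1,3) by (auto simp: polys_over_def)
qed

end

section \<open>Affine varieties and their endomorphisms\<close>

text \<open>A variety is a set \<open>X\<close> of points with its ring \<open>R\<close> of regular functions. To make equality of regular
  functions literal, they are functions on the whole type that are determined by their values on \<open>X\<close>.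
  The assumption \<open>point\<close> says that homomorphisms to the field are evaluations.\<close>

locale affine_variety =
  fixes X :: "'a set" and R :: "('a \<Rightarrow> 'k::alg_closed_field) set" and gens :: "('a \<Rightarrow> 'k) list"
  assumes dom: "integral_domain_on R"
    and gen: "R = adjoin_list consts_fn gens"
    and vanish: "f \<in> R \<Longrightarrow> (\<And>x. x \<in> X \<Longrightarrow> f x = 0) \<Longrightarrow> f = 0"
    and point: "ring_hom_on R \<psi> \<Longrightarrow> (\<And>c. \<psi> (\<lambda>_. c) = c) \<Longrightarrow> \<exists>x\<in>X. \<forall>f\<in>R. \<psi> f = f x"
    and separate: "x \<in> X \<Longrightarrow> y \<in> X \<Longrightarrow> (\<And>f. f \<in> R \<Longrightarrow> f x = f y) \<Longrightarrow> x = y"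
begin

lemma R: "is_subring R" using dom by (simp add: integral_domain_on_def)

lemma mult_nonzero: "f \<in> R \<Longrightarrow> g \<in> R \<Longrightarrow> f \<noteq> 0 \<Longrightarrow> g \<noteq> 0 \<Longrightarrow> f * g \<noteq> 0"
  using dom unfolding integral_domain_on_def by blast

lemma const_R: "consts_fn \<subseteq> R"
  unfolding gen by (rule adjoin_list_base[OF is_subring_consts_fn])

lemma gens: "set gens \<subseteq> R"
  unfolding gen by (rule adjoin_list_gen[OF is_subring_consts_fn])

lemma nonvanish: "f \<in> R \<Longrightarrow> f \<noteq> 0 \<Longrightarrow> \<exists>x\<in>X. f x \<noteq> 0"
  using vanish by blast

lemma eval_hom: "ring_hom_on A (\<lambda>f. f x)" for A :: "('a \<Rightarrow> 'k) set"
  by (simp add: ring_hom_on_def)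

lemma separate_gens:
  assumes "x \<in> X" "y \<in> X" "\<And>g. g \<in> set gens \<Longrightarrow> g x = g y"
  shows "x = y"
proof (rule separate[OF assms(1,2)])
  have "is_subring {f. f x = f y}" by (auto simp: is_subring_def)
  then have "R \<subseteq> {f. f x = f y}" unfolding gen using assms(3) by (intro adjoin_list_subset) auto
  then show "f x = f y" if "f \<in> R" for f using that by blast
qed

end

locale variety_endomorphism = affine_variety X R gens
  for X :: "'a set" and R :: "('a \<Rightarrow> 'k::alg_closed_field) set" and gens +
  fixes c :: "'a \<Rightarrow> 'a"
  assumes c: "\<And>x. x \<in> X \<Longrightarrow> c x \<in> X" and pullback: "\<And>f. f \<in> R \<Longrightarrow> f \<circ> c \<in> R"
begin

abbreviation "comorphism \<equiv> (\<lambda>f. f \<circ> c)"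

sublocale bounded_trdeg consts_fn R "length gens" comorphism
proof
  show "integral_domain_on R" by (rule dom)
  show "length xs \<le> length gens" if "set xs \<subseteq> R" "alg_indep consts_fn xs" for xs
    using that alg_indep_length_le gen by blast
  show "ring_hom_on R comorphism" by (auto simp: ring_hom_on_def fun_eq_iff)
qed (use const_R is_subring_consts_fn pullback in auto)

lemma consts_comorphism: "consts_fn \<subseteq> comorphism ` R"
proof
  fix f :: "'a \<Rightarrow> 'k" assume "f \<in> consts_fn"
  then show "f \<in> comorphism ` R" using const_R by (intro image_eqI[where x = f]) (auto simp: comp_def)
qed

lemma comorphism_funpow: "comorphism ^^ m = (\<lambda>f. f \<circ> (c ^^ m))"
  by (induction m) (auto simp: fun_eq_iff funpow_swap1)

lemma variety_endomorphism_funpow: "variety_endomorphism X R gens (c ^^ m)"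
proof
  show "(c ^^ m) x \<in> X" if "x \<in> X" for x using that by (induction m) (auto intro: c)
  show "f \<circ> (c ^^ m) \<in> R" if "f \<in> R" for f
    using bounded_trdeg.\<theta>(2)[OF bounded_trdeg_funpow[of m]] that
    unfolding comorphism_funpow by blast
qed

text \<open>Each generator satisfies a relation whose coefficients are functions of
  \<open>c\<close>, hence constant along a fibre. Where the leading coefficients survive, every
  generator takes finitely many values on the fibre, and these values determine the point.\<close>

lemma finite_fibre_of_injective:
  assumes inj: "\<And>f. f \<in> R \<Longrightarrow> f \<circ> c = 0 \<Longrightarrow> f = 0"
  shows "\<exists>x\<in>X. finite {z \<in> X. c z = c x}"
proof -
  let ?A = "comorphism ` R"
  have A: "is_subring ?A" "?A \<subseteq> R" using is_subring_image[OF R \<theta>(1)] \<theta>(2) by blast+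
  have "\<exists>p. p \<in> polys_over ?A \<and> poly p g = 0 \<and> p \<noteq> 0" if "g \<in> set gens" for g
    using algebraic_over_image[OF inj, of g] that gens by (auto simp: transcendental_over_def)
  then obtain P where P: "\<And>g. g \<in> set gens \<Longrightarrow> P g \<in> polys_over ?A \<and> poly (P g) g = 0 \<and> P g \<noteq> 0"
    by metis
  note subR = R
  \<comment> \<open>A point at which this product is nonzero keeps every specialised
    \<open>P g\<close> nonzero.\<close>
  define l where "l = (\<Prod>g\<in>set gens. lead_coeff (P g))"
  have lR: "lead_coeff (P g) \<in> R" if "g \<in> set gens" for g
    using P[OF that] A(2) coeff_polys_over by blast
  have "finite S \<Longrightarrow> S \<subseteq> set gens \<Longrightarrow> (\<Prod>g\<in>S. lead_coeff (P g)) \<in> R \<and> (\<Prod>g\<in>S. lead_coeff (P g)) \<noteq> 0" for S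
  proof (induction S rule: finite_induct)
    case empty
    show ?case unfolding prod.empty using is_subringD(2)[OF R] one_neq_zero by blast
  next
    case (insert g S)
    have "lead_coeff (P g) \<noteq> 0" using P[of g] insert.prems by simp
    moreover have R: "lead_coeff (P g) \<in> R" "(\<Prod>g\<in>S. lead_coeff (P g)) \<in> R"
      and "(\<Prod>g\<in>S. lead_coeff (P g)) \<noteq> 0"
      using insert lR[of g] by blast+
    ultimately show ?case
      unfolding prod.insert[OF insert.hyps] using mult_nonzero[OF R] is_subringD(5)[OF subR R] by blast
  qed
  from this[of "set gens"] have "l \<in> R" "l \<noteq> 0" by (auto simp: l_def)
  then obtain x where x: "x \<in> X" "l x \<noteq> 0" using nonvanish by blast
  have "(\<Prod>g\<in>S. lead_coeff (P g)) x = (\<Prod>g\<in>S. lead_coeff (P g) x)" for S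
    by (induction S rule: infinite_finite_induct) auto
  then have lx: "lead_coeff (P g) x \<noteq> 0" if "g \<in> set gens" for g
    using x(2) that by (auto simp: l_def)
  let ?Q = "\<lambda>g. map_poly (\<lambda>f. f x) (P g)"
  let ?F = "\<Union>g\<in>set gens. {t. poly (?Q g) t = 0}"
  have Q0: "?Q g \<noteq> 0" if "g \<in> set gens" for g
    using lx[OF that] by (metis (no_types, lifting) coeff_0 coeff_map_poly zero_fun_apply)
  then have finF: "finite ?F" by (auto intro: poly_roots_finite)
  have root: "g z \<in> ?F" if z: "z \<in> X" "c z = c x" and g: "g \<in> set gens" for z g
  proof -
    \<comment> \<open>The coefficients have the form \<open>f \<circ> c\<close>, so they agree at
      \<open>z\<close> and \<open>x\<close>.\<close>
    have "map_poly (\<lambda>f. f z) (P g) = ?Q g"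
    proof (rule poly_eqI)
      fix i
      obtain f where "coeff (P g) i = f \<circ> c" using P[OF g] coeff_polys_over by blast
      then show "coeff (map_poly (\<lambda>f. f z) (P g)) i = coeff (?Q g) i"
        using z(2) by (simp add: coeff_map_poly)
    qed
    moreover have "poly (map_poly (\<lambda>f. f z) (P g)) (g z) = poly (P g) g z"
      by (rule hom_poly[OF R eval_hom, symmetric]) (use P[OF g] A(2) g gens in \<open>auto simp: polys_over_def\<close>)
    ultimately show ?thesis using P[OF g] g by auto
  qed
  have "finite ((\<lambda>z. map (\<lambda>g. g z) gens) ` {z \<in> X. c z = c x})"
    by (rule finite_subset[OF _ finite_lists_length_eq[OF finF, of "length gens"]]) (use root in auto)
  moreover have "inj_on (\<lambda>z. map (\<lambda>g. g z) gens) {z \<in> X. c z = c x}"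
  proof (rule inj_onI)
    fix y z assume "y \<in> {z \<in> X. c z = c x}" "z \<in> {z \<in> X. c z = c x}"
      "map (\<lambda>g. g y) gens = map (\<lambda>g. g z) gens"
    then show "y = z" by (intro separate_gens) auto
  qed
  ultimately have "finite {z \<in> X. c z = c x}" by (rule finite_imageD)
  then show ?thesis using x(1) by blast
qed

text \<open>A point \<open>x\<close> defines a homomorphism on the image of the comorphism, taking
  \<open>f \<circ> c\<close> to \<open>f x\<close>. Off the zeros of \<open>b\<close> it extends to
  \<open>R\<close>, the extension is evaluation at some \<open>z\<close>, and then
  \<open>c z = x\<close>.\<close>

lemma image_contains_open:
  assumes inj: "\<And>f. f \<in> R \<Longrightarrow> f \<circ> c = 0 \<Longrightarrow> f = 0"
  shows "\<exists>b\<in>R. b \<noteq> 0 \<and> (\<forall>x\<in>X. b x \<noteq> 0 \<longrightarrow> x \<in> c ` X)"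
proof -
  let ?A = "comorphism ` R"
  have A: "is_subring ?A" "?A \<subseteq> R" using is_subring_image[OF R \<theta>(1)] \<theta>(2) by blast+
  have RA: "R \<subseteq> adjoin_list ?A gens"
    using adjoin_list_subset[OF is_subring_adjoin_list[OF A(1)], of consts_fn gens gens]
      adjoin_list_base[OF A(1), of gens] adjoin_list_gen[OF A(1), of gens] consts_comorphism
    unfolding gen by blast
  have one: "1 \<in> adjoin_list ?A gens" "(1 :: 'a \<Rightarrow> 'k) \<noteq> 0"
    using is_subringD(2)[OF is_subring_adjoin_list[OF A(1)]] by auto
  obtain a where a: "a \<in> ?A" "a \<noteq> 0" and ext: "\<forall>\<psi> :: ('a \<Rightarrow> 'k) \<Rightarrow> 'k. ring_hom_on ?A \<psi> \<longrightarrow> \<psi> a \<noteq> 0 \<longrightarrow>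
      (\<exists>\<psi>'. ring_hom_on (adjoin_list ?A gens) \<psi>' \<and> (\<forall>f\<in>?A. \<psi>' f = \<psi> f) \<and> \<psi>' 1 \<noteq> 0)"
    using extension_adjoin_list[OF dom A gens one, where ?'k = 'k] by (elim bexE conjE)
  obtain b where b: "b \<in> R" "a = b \<circ> c" using a(1) by blast
  have "x \<in> c ` X" if x: "x \<in> X" "b x \<noteq> 0" for x
  proof -
    \<comment> \<open>This inverts the comorphism; injectivity makes the chosen function
      unique.\<close>
    define g where "g h = (SOME f. f \<in> R \<and> h = f \<circ> c)" for h
    have g: "g (f \<circ> c) = f" if f: "f \<in> R" for f
    proof -
      define q where "q = g (f \<circ> c)"
      have "q \<in> R \<and> f \<circ> c = q \<circ> c"
        unfolding q_def g_def
        by (rule someI[of "\<lambda>f'. f' \<in> R \<and> f \<circ> c = f' \<circ> c" f]) (use f in simp)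
      then have q: "q \<in> R" "q \<circ> c = f \<circ> c" by simp_all
      have "(q - f) \<circ> c = 0" using q(2) by (simp add: fun_eq_iff)
      then have "q - f = 0" using inj is_subring_diff[OF R q(1) f] by blast
      then show ?thesis unfolding q_def by (simp only: right_minus_eq)
    qed
    let ?\<psi> = "\<lambda>h. g h x"
    have hom: "ring_hom_on ?A ?\<psi>"
      unfolding ring_hom_on_def
    proof (intro conjI ballI)
      show "g 0 x = 0" using g[OF is_subringD(1)[OF R]] by (simp add: zero_fun_def comp_def)
      show "g 1 x = 1" using g[OF is_subringD(2)[OF R]] by (simp add: one_fun_def comp_def)
      fix h1 h2 assume "h1 \<in> ?A" "h2 \<in> ?A"
      then obtain f1 f2 where f: "f1 \<in> R" "h1 = f1 \<circ> c" "f2 \<in> R" "h2 = f2 \<circ> c" by blast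
      have "h1 + h2 = (f1 + f2) \<circ> c" "h1 * h2 = (f1 * f2) \<circ> c" by (auto simp: f fun_eq_iff)
      then show "g (h1 + h2) x = g h1 x + g h2 x" "g (h1 * h2) x = g h1 x * g h2 x"
        using g[OF is_subringD(4)[OF R f(1,3)]] g[OF is_subringD(5)[OF R f(1,3)]] g[OF f(1)] g[OF f(3)]
        by (simp_all add: f(2,4))
    qed
    have nz: "?\<psi> a \<noteq> 0" using g[OF b(1)] b(2) x(2) by simp
    obtain \<psi>' where \<psi>': "ring_hom_on (adjoin_list ?A gens) \<psi>'" "\<forall>h\<in>?A. \<psi>' h = g h x"
      using mp[OF mp[OF spec[OF ext] hom] nz] by (elim exE conjE)
    have \<psi>c: "\<psi>' (f \<circ> c) = f x" if "f \<in> R" for f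
      using \<psi>'(2) g[OF that] that by simp
    have "\<psi>' (\<lambda>_. d) = d" for d
      using \<psi>c[of "\<lambda>_. d"] const_R by (auto simp: comp_def)
    then have "\<exists>z\<in>X. \<forall>f\<in>R. \<psi>' f = f z" by (rule point[OF ring_hom_on_subset[OF \<psi>'(1) RA]])
    then obtain z where z: "z \<in> X" "\<And>f. f \<in> R \<Longrightarrow> \<psi>' f = f z" by auto
    have "c z = x"
    proof (rule separate[OF c[OF z(1)] x(1)])
      show "f (c z) = f x" if "f \<in> R" for f
        using z(2)[OF pullback[OF that]] \<psi>c[OF that] by simp
    qed
    then show ?thesis using z(1) by blast
  qed
  moreover have "b \<noteq> 0" using a(2) b(2) by (auto simp: fun_eq_iff)
  ultimately show ?thesis using b(1) by blast
qed

text \<open>Evaluation at a suitable \<open>x\<close>, restricted to the image of the comorphism,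
  may be continued by sending \<open>h\<close> to all but finitely many \<open>t\<close>. Each
  choice extends to \<open>R\<close> and gives a point of the fibre through \<open>x\<close> at
  which \<open>h\<close> has the value \<open>t\<close>.\<close>

lemma infinite_fibre_of_transcendental:
  assumes h: "h \<in> R" "transcendental_over (comorphism ` R) h"
  shows "\<exists>x\<in>X. infinite {z \<in> X. c z = c x}"
proof -
  let ?A = "comorphism ` R"
  let ?B = "adjoin ?A h"
  have A: "is_subring ?A" "?A \<subseteq> R" using is_subring_image[OF R \<theta>(1)] \<theta>(2) by blast+
  have B: "is_subring ?B" "?B \<subseteq> R" using is_subring_adjoin[OF A(1)] adjoin_subset[OF R A(2) h(1)] by blast+
  have AB: "?A \<subseteq> ?B" by (rule adjoin_base[OF A(1)])
  have RB: "R \<subseteq> adjoin_list ?B gens"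
    using adjoin_list_subset[OF is_subring_adjoin_list[OF B(1)], of consts_fn gens gens]
      adjoin_list_base[OF B(1), of gens] adjoin_list_gen[OF B(1), of gens] AB
      consts_comorphism unfolding gen by blast
  have one: "1 \<in> adjoin_list ?B gens" "(1 :: 'a \<Rightarrow> 'k) \<noteq> 0"
    using is_subringD(2)[OF is_subring_adjoin_list[OF B(1)]] by auto
  obtain a where a: "a \<in> ?B" "a \<noteq> 0" and ext: "\<forall>\<psi> :: ('a \<Rightarrow> 'k) \<Rightarrow> 'k. ring_hom_on ?B \<psi> \<longrightarrow> \<psi> a \<noteq> 0 \<longrightarrow>
      (\<exists>\<psi>'. ring_hom_on (adjoin_list ?B gens) \<psi>' \<and> (\<forall>f\<in>?B. \<psi>' f = \<psi> f) \<and> \<psi>' 1 \<noteq> 0)"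
    using extension_adjoin_list[OF dom B gens one, where ?'k = 'k] by (elim bexE conjE)
  obtain q where q: "q \<in> polys_over ?A" "a = poly q h" using a(1) by (auto simp: adjoin_def)
  have "q \<noteq> 0" using q(2) a(2) by auto
  then have "lead_coeff q \<in> R" "lead_coeff q \<noteq> 0"
    using subsetD[OF A(2) coeff_polys_over[OF q(1)]] by simp_all
  then obtain x where x: "x \<in> X" "lead_coeff q x \<noteq> 0" using nonvanish by blast
  let ?q = "map_poly (\<lambda>f. f x) q"
  have "?q \<noteq> 0" using x(2) by (metis (no_types, lifting) coeff_0 coeff_map_poly zero_fun_apply)
  then have inf: "infinite (- {t. poly ?q t = 0})"
    using alg_closed_infinite[where ?'k = 'k] poly_roots_finite[of ?q]
    by (metis finite_compl)
  have "- {t. poly ?q t = 0} \<subseteq> h ` {z \<in> X. c z = c x}"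
  proof
    fix t assume t: "t \<in> - {t. poly ?q t = 0}"
    obtain \<psi> where \<psi>: "ring_hom_on ?B \<psi>" "\<And>f. f \<in> ?A \<Longrightarrow> \<psi> f = f x"
      "\<And>r. r \<in> polys_over ?A \<Longrightarrow> \<psi> (poly r h) = poly (map_poly (\<lambda>f. f x) r) t"
      using h(2) by (elim hom_extend[OF A(1) eval_hom, of h x t, rotated]) (auto simp: transcendental_over_def)
    have nz: "\<psi> a \<noteq> 0" using \<psi>(3)[OF q(1)] q(2) t by simp
    obtain \<psi>' where \<psi>': "ring_hom_on (adjoin_list ?B gens) \<psi>'" "\<forall>f\<in>?B. \<psi>' f = \<psi> f"
      using mp[OF mp[OF spec[OF ext] \<psi>(1)] nz] by (elim exE conjE)
    have \<psi>c: "\<psi>' (f \<circ> c) = f (c x)" if "f \<in> R" for f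
    proof -
      have "f \<circ> c \<in> ?A" using that by simp
      then show ?thesis using \<psi>'(2) \<psi>(2)[of "f \<circ> c"] subsetD[OF AB, of "f \<circ> c"] by simp
    qed
    have "\<psi>' (\<lambda>_. d) = d" for d
      using \<psi>c[of "\<lambda>_. d"] const_R by (auto simp: comp_def)
    then have "\<exists>z\<in>X. \<forall>f\<in>R. \<psi>' f = f z" by (rule point[OF ring_hom_on_subset[OF \<psi>'(1) RB]])
    then obtain z where z: "z \<in> X" "\<And>f. f \<in> R \<Longrightarrow> \<psi>' f = f z" by auto
    have "c z = c x"
    proof (rule separate[OF c[OF z(1)] c[OF x(1)]])
      show "f (c z) = f (c x)" if "f \<in> R" for f
        using z(2)[OF pullback[OF that]] \<psi>c[OF that] by simp
    qed
    moreover have "h z = t"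
      using z(2)[OF h(1)] bspec[OF \<psi>'(2) adjoin_gen[OF A(1)]] \<psi>(3)[of "[:0,1:]"]
        pCons_polys_over[OF A(1), of 0 "[:1:]"] is_subringD(1,2)[OF A(1)]
      by (simp add: A(1) map_poly_pCons)
    ultimately show "t \<in> h ` {z \<in> X. c z = c x}" using z(1) by blast
  qed
  then have "infinite {z \<in> X. c z = c x}" using inf by (meson finite_imageI finite_subset)
  then show ?thesis using x(1) by blast
qed

lemma finite_fibres_funpow:
  assumes "\<And>x. x \<in> X \<Longrightarrow> finite {z \<in> X. c z = c x}" and "x \<in> X"
  shows "finite {z \<in> X. (c ^^ m) z = (c ^^ m) x}"
  using assms(2)
proof (induction m arbitrary: x)
  case 0
  have "{z \<in> X. (c ^^ 0) z = (c ^^ 0) x} \<subseteq> {x}" by auto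
  then show ?case using finite_subset by blast
next
  case (Suc m)
  let ?S = "{w \<in> X. (c ^^ m) w = (c ^^ m) (c x)}"
  have "{z \<in> X. (c ^^ Suc m) z = (c ^^ Suc m) x} \<subseteq> (\<Union>w\<in>?S. {z \<in> X. c z = w})"
    using c by (auto simp: funpow_Suc_right simp del: funpow.simps)
  moreover have "finite {z \<in> X. c z = w}" for w
  proof (cases "\<exists>y\<in>X. c y = w")
    case True
    then show ?thesis using assms(1) by blast
  next
    case False
    then have "{z \<in> X. c z = w} = {}" by blast
    then show ?thesis by (simp only: finite.emptyI)
  qed
  ultimately show ?case using Suc.IH[OF c[OF Suc.prems]] by (meson finite_UN_I finite_subset)
qed

text \<open>Iterates inherit finite fibres, so no regular function is transcendental over the image
  of any power of the comorphism, as the algebraic criterion requires.\<close>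

lemma injective_of_finite_fibres:
  assumes "\<And>x. x \<in> X \<Longrightarrow> finite {z \<in> X. c z = c x}" and "f \<in> R" "f \<circ> c = 0"
  shows "f = 0"
proof (rule injective_of_algebraic[OF _ assms(2,3)])
  fix m h assume "h \<in> R"
  interpret m: variety_endomorphism X R gens "c ^^ m" by (rule variety_endomorphism_funpow)
  show "\<not> transcendental_over ((comorphism ^^ m) ` R) h"
    using m.infinite_fibre_of_transcendental[OF \<open>h \<in> R\<close>] finite_fibres_funpow[OF assms(1), where m = m]
    unfolding comorphism_funpow by blast
qed

end

section \<open>Regular maps on the general linear group\<close>

lemma carrier_GL: "A \<in> carrier (GL n :: 'k::field mat monoid) \<longleftrightarrow> A \<in> carrier_mat n n \<and> det A \<noteq> 0"
  using unit_imp_det_non_zero[of A n "()"] det_non_zero_imp_unit[of A n "()"]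
  by (auto simp: units_of_carrier Units_def ring_mat_simps)

lemma mult_GL: "x \<otimes>\<^bsub>GL n\<^esub> y = x * y"
  by (simp add: units_of_mult ring_mat_simps)

lemma one_GL: "\<one>\<^bsub>GL n\<^esub> = 1\<^sub>m n"
  by (simp add: units_of_one ring_mat_simps)

text \<open>Cramer's rule, which will show that inversion has regular entries.\<close>

lemma inv_GL:
  fixes A :: "'k::field mat"
  assumes A: "A \<in> carrier (GL n)"
  shows "inv\<^bsub>GL n\<^esub> A = inverse (det A) \<cdot>\<^sub>m adj_mat A"
proof -
  interpret group "GL n :: 'k mat monoid" by (rule group_GL)
  have cA: "A \<in> carrier_mat n n" "det A \<noteq> 0" using A by (auto simp: carrier_GL)
  let ?B = "inverse (det A) \<cdot>\<^sub>m adj_mat A"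
  have B: "?B \<in> carrier_mat n n" using adj_mat(1)[OF cA(1)] by simp
  have "?B * A = 1\<^sub>m n"
    using adj_mat[OF cA(1)] cA by (subst mult_smult_assoc_mat[of _ n n _ n]) (auto intro!: eq_matI)
  moreover from this have "det ?B * det A = 1" using det_mult[OF B cA(1)] by simp
  then have "?B \<in> carrier (GL n)" using B by (auto simp: carrier_GL)
  ultimately show ?thesis using A by (intro inv_equality) (auto simp: mult_GL one_GL)
qed

definition regular_on :: "nat \<Rightarrow> 'k::field mat set \<Rightarrow> ('k mat \<Rightarrow> 'k) \<Rightarrow> bool" where
  "regular_on n S f \<longleftrightarrow> (\<exists>h\<in>regular_fun n. \<forall>A\<in>S. f A = h A)"

lemma regular_onI: "f \<in> regular_fun n \<Longrightarrow> regular_on n S f"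
  by (auto simp: regular_on_def)

lemma regular_on_cong: "(\<And>A. A \<in> S \<Longrightarrow> f A = g A) \<Longrightarrow> regular_on n S f \<longleftrightarrow> regular_on n S g"
  by (auto simp: regular_on_def)

lemma regular_on_subset: "regular_on n T f \<Longrightarrow> S \<subseteq> T \<Longrightarrow> regular_on n S f"
  by (auto simp: regular_on_def)

lemma regular_on_const: "regular_on n S (\<lambda>_. c)"
  by (intro regular_onI regular_fun.const)

lemma regular_on_add: "regular_on n S f \<Longrightarrow> regular_on n S g \<Longrightarrow> regular_on n S (\<lambda>A. f A + g A)"
  unfolding regular_on_def by (force intro: regular_fun.add)

lemma regular_on_mult: "regular_on n S f \<Longrightarrow> regular_on n S g \<Longrightarrow> regular_on n S (\<lambda>A. f A * g A)"
  unfolding regular_on_def by (force intro: regular_fun.mult)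

lemma regular_on_sum: "(\<And>i. i \<in> I \<Longrightarrow> regular_on n S (f i)) \<Longrightarrow> regular_on n S (\<lambda>A. \<Sum>i\<in>I. f i A)"
  by (induction I rule: infinite_finite_induct) (auto intro: regular_on_const regular_on_add)

lemma regular_on_prod: "(\<And>i. i \<in> I \<Longrightarrow> regular_on n S (f i)) \<Longrightarrow> regular_on n S (\<lambda>A. \<Prod>i\<in>I. f i A)"
  by (induction I rule: infinite_finite_induct) (auto intro: regular_on_const regular_on_mult)

lemma regular_on_det:
  assumes "\<And>A. A \<in> S \<Longrightarrow> B A \<in> carrier_mat m m"
    and "\<And>i j. i < m \<Longrightarrow> j < m \<Longrightarrow> regular_on n S (\<lambda>A. B A $$ (i, j))"
  shows "regular_on n S (\<lambda>A. det (B A))"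
proof -
  have "regular_on n S (\<lambda>A. \<Sum>p\<in>{p. p permutes {0..<m}}. signof p * (\<Prod>i = 0..<m. B A $$ (i, p i)))"
    by (intro regular_on_sum regular_on_mult regular_on_const regular_on_prod assms(2))
       (auto simp: permutes_in_image dest: permutes_in_image[of _ "{0..<m}"])
  then show ?thesis
    by (rule iffD1[OF regular_on_cong, rotated]) (simp add: det_def'[OF assms(1)])
qed

text \<open>Only the pullback condition is recorded; where the values lie is stated separately at
  each use.\<close>

definition regular_map :: "nat \<Rightarrow> 'k::field mat set \<Rightarrow> ('k mat \<Rightarrow> 'k mat) \<Rightarrow> bool" where
  "regular_map n S \<psi> \<longleftrightarrow> (\<forall>f\<in>regular_fun n. regular_on n S (\<lambda>A. f (\<psi> A)))"

lemma regular_mapI: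
  assumes "\<And>i j. i < n \<Longrightarrow> j < n \<Longrightarrow> regular_on n S (\<lambda>A. \<psi> A $$ (i, j))"
    and "regular_on n S (\<lambda>A. inverse (det (\<psi> A)))"
  shows "regular_map n S \<psi>"
  unfolding regular_map_def
proof
  fix f :: "'a mat \<Rightarrow> 'a" assume "f \<in> regular_fun n"
  then show "regular_on n S (\<lambda>A. f (\<psi> A))"
    by induction (auto intro: assms regular_on_const regular_on_add regular_on_mult)
qed

lemma regular_mapD: "regular_map n S \<psi> \<Longrightarrow> f \<in> regular_fun n \<Longrightarrow> regular_on n S (\<lambda>A. f (\<psi> A))"
  by (simp add: regular_map_def)

lemma regular_map_subset: "regular_map n T \<psi> \<Longrightarrow> S \<subseteq> T \<Longrightarrow> regular_map n S \<psi>"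
  unfolding regular_map_def using regular_on_subset by blast

lemma regular_map_id: "regular_map n S (\<lambda>A. A)"
  by (simp add: regular_map_def regular_onI)

lemma regular_map_const: "regular_map n S (\<lambda>_. B)"
  by (simp add: regular_map_def regular_on_const)

lemma regular_map_comp:
  assumes "regular_map n S \<psi>" "regular_map n T \<chi>" "\<And>A. A \<in> S \<Longrightarrow> \<psi> A \<in> T"
  shows "regular_map n S (\<lambda>A. \<chi> (\<psi> A))"
  unfolding regular_map_def
proof
  fix f :: "'a mat \<Rightarrow> 'a" assume "f \<in> regular_fun n"
  then obtain h where h: "h \<in> regular_fun n" "\<forall>A\<in>T. f (\<chi> A) = h A"
    using assms(2) by (auto simp: regular_map_def regular_on_def)
  have "regular_on n S (\<lambda>A. h (\<psi> A))" using assms(1) h(1) by (rule regular_mapD)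
  then show "regular_on n S (\<lambda>A. f (\<chi> (\<psi> A)))"
    by (rule iffD1[OF regular_on_cong, rotated]) (use h(2) assms(3) in auto)
qed

lemma regular_map_mult:
  fixes \<psi> \<chi> :: "'k::field mat \<Rightarrow> 'k mat"
  assumes \<psi>: "regular_map n S \<psi>" "\<And>A. A \<in> S \<Longrightarrow> \<psi> A \<in> carrier (GL n)"
    and \<chi>: "regular_map n S \<chi>" "\<And>A. A \<in> S \<Longrightarrow> \<chi> A \<in> carrier (GL n)"
  shows "regular_map n S (\<lambda>A. \<psi> A \<otimes>\<^bsub>GL n\<^esub> \<chi> A)"
proof (rule regular_mapI)
  fix i j assume ij: "i < n" "j < n"
  have "regular_on n S (\<lambda>A. \<Sum>k = 0..<n. \<psi> A $$ (i, k) * \<chi> A $$ (k, j))"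
    using ij by (intro regular_on_sum regular_on_mult regular_mapD[OF \<psi>(1)] regular_mapD[OF \<chi>(1)]
        regular_fun.entry) auto
  then show "regular_on n S (\<lambda>A. (\<psi> A \<otimes>\<^bsub>GL n\<^esub> \<chi> A) $$ (i, j))"
  proof (rule iffD1[OF regular_on_cong, rotated])
    fix A assume "A \<in> S"
    then have "\<psi> A \<in> carrier_mat n n" "\<chi> A \<in> carrier_mat n n" using \<psi>(2) \<chi>(2) by (auto simp: carrier_GL)
    then show "(\<Sum>k = 0..<n. \<psi> A $$ (i, k) * \<chi> A $$ (k, j)) = (\<psi> A \<otimes>\<^bsub>GL n\<^esub> \<chi> A) $$ (i, j)"
      using ij by (simp add: mult_GL scalar_prod_def)
  qed
next
  have "regular_on n S (\<lambda>A. inverse (det (\<psi> A)) * inverse (det (\<chi> A)))"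
    by (intro regular_on_mult regular_mapD[OF \<psi>(1)] regular_mapD[OF \<chi>(1)] regular_fun.inv_det)
  then show "regular_on n S (\<lambda>A. inverse (det (\<psi> A \<otimes>\<^bsub>GL n\<^esub> \<chi> A)))"
  proof (rule iffD1[OF regular_on_cong, rotated])
    fix A assume "A \<in> S"
    then have "\<psi> A \<in> carrier_mat n n" "\<chi> A \<in> carrier_mat n n" using \<psi>(2) \<chi>(2) by (auto simp: carrier_GL)
    then show "inverse (det (\<psi> A)) * inverse (det (\<chi> A)) = inverse (det (\<psi> A \<otimes>\<^bsub>GL n\<^esub> \<chi> A))"
      by (simp add: mult_GL det_mult)
  qed
qed

lemma regular_on_entry: "i < n \<Longrightarrow> j < n \<Longrightarrow> regular_on n S (\<lambda>A. A $$ (i, j))"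
  by (intro regular_onI regular_fun.entry)

text \<open>Entries of the inverse are cofactors times the inverse determinant, and the inverse
  determinant of the inverse is the determinant itself, a polynomial.\<close>

lemma regular_map_inv: "regular_map n (carrier (GL n :: 'k::field mat monoid)) (m_inv (GL n :: 'k mat monoid))"
proof (rule regular_mapI)
  let ?S = "carrier (GL n :: 'k mat monoid)"
  interpret group "GL n :: 'k mat monoid" by (rule group_GL)
  fix i j assume ij: "i < n" "j < n"
  have cof: "regular_on n ?S (\<lambda>A. det (mat_delete A j i))"
  proof (rule regular_on_det)
    show "mat_delete A j i \<in> carrier_mat (n - 1) (n - 1)" if "A \<in> ?S" for A
      using that mat_delete_carrier[of A n n j i] by (simp add: carrier_GL)
    fix i' j' assume ij': "i' < n - 1" "j' < n - 1"
    have "regular_on n ?S (\<lambda>A. A $$ (insert_index j i', insert_index i j'))"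
      using ij' by (intro regular_on_entry) (auto simp: insert_index_def)
    then show "regular_on n ?S (\<lambda>A. mat_delete A j i $$ (i', j'))"
    proof (rule iffD1[OF regular_on_cong, rotated])
      fix A assume "A \<in> ?S"
      then show "A $$ (insert_index j i', insert_index i j') = mat_delete A j i $$ (i', j')"
        using ij ij' mat_delete_index[of A "n - 1" j i i' j'] by (simp add: carrier_GL)
    qed
  qed
  have "regular_on n ?S (\<lambda>A. inverse (det A) * ((-1) ^ (j + i) * det (mat_delete A j i)))"
    by (intro regular_on_mult regular_on_const cof regular_onI regular_fun.inv_det)
  then show "regular_on n ?S (\<lambda>A. (inv\<^bsub>GL n\<^esub> A) $$ (i, j))"
  proof (rule iffD1[OF regular_on_cong, rotated])
    fix A assume A: "A \<in> ?S"
    then have "A \<in> carrier_mat n n" by (simp add: carrier_GL)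
    then show "inverse (det A) * ((-1) ^ (j + i) * det (mat_delete A j i)) = (inv\<^bsub>GL n\<^esub> A) $$ (i, j)"
      using ij adj_mat(1)[of A n] by (simp add: inv_GL[OF A] adj_mat_def cofactor_def)
  qed
next
  let ?S = "carrier (GL n :: 'k mat monoid)"
  interpret group "GL n :: 'k mat monoid" by (rule group_GL)
  have "regular_on n ?S det"
    by (rule regular_on_det[of _ "\<lambda>A. A"]) (auto simp: carrier_GL intro: regular_on_entry)
  then show "regular_on n ?S (\<lambda>A. inverse (det (inv\<^bsub>GL n\<^esub> A)))"
  proof (rule iffD1[OF regular_on_cong, rotated])
    fix A assume A: "A \<in> ?S"
    then have "det A * det (inv\<^bsub>GL n\<^esub> A) = 1"
      using r_inv[OF A] inv_closed[OF A] det_mult[of A n "inv\<^bsub>GL n\<^esub> A"] by (simp add: carrier_GL mult_GL one_GL)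
    then show "det A = inverse (det (inv\<^bsub>GL n\<^esub> A))" by (metis inverse_unique mult.commute)
  qed
qed

section \<open>Zariski closures and irreducible sets\<close>

definition zclosure :: "nat \<Rightarrow> 'k::field mat set \<Rightarrow> 'k mat set" where
  "zclosure n D = zero_locus n {f \<in> regular_fun n. \<forall>B\<in>D. f B = 0}"

lemma closedin_zclosure: "closedin (zariski n) (zclosure n D)"
  unfolding closedin_zariski zclosure_def by (intro exI[of _ "{f \<in> regular_fun n. \<forall>B\<in>D. f B = 0}"] conjI refl Collect_restrict)

lemma zero_locusD: "A \<in> zero_locus n F \<Longrightarrow> f \<in> F \<Longrightarrow> f A = 0"
  unfolding zero_locus_def by (elim CollectE conjE) (drule (1) bspec)

lemma zero_locusI: "A \<in> carrier (GL n) \<Longrightarrow> (\<And>f. f \<in> F \<Longrightarrow> f A = 0) \<Longrightarrow> A \<in> zero_locus n F"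
  unfolding zero_locus_def by (intro CollectI conjI ballI)

lemma zclosure_carrier: "zclosure n D \<subseteq> carrier (GL n)"
  unfolding zclosure_def zero_locus_def by (rule Collect_restrict)

lemma zclosureD:
  assumes "A \<in> zclosure n D" "f \<in> regular_fun n" "\<And>B. B \<in> D \<Longrightarrow> f B = 0"
  shows "f A = 0"
  using assms(1) unfolding zclosure_def by (rule zero_locusD) (use assms(2,3) in simp)

lemma zclosureI:
  assumes "A \<in> carrier (GL n)" "\<And>f. f \<in> regular_fun n \<Longrightarrow> \<forall>B\<in>D. f B = 0 \<Longrightarrow> f A = 0"
  shows "A \<in> zclosure n D"
  unfolding zclosure_def by (rule zero_locusI[OF assms(1)]) (elim CollectE conjE, rule assms(2))

lemma zclosure_subset:
  assumes "D \<subseteq> carrier (GL n)"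
  shows "D \<subseteq> zclosure n D"
proof
  fix A assume A: "A \<in> D"
  show "A \<in> zclosure n D" by (rule zclosureI[OF subsetD[OF assms A]]) (erule bspec[OF _ A])
qed

lemma zclosure_minimal:
  assumes "closedin (zariski n) V" "D \<subseteq> V"
  shows "zclosure n D \<subseteq> V"
proof
  fix A assume A: "A \<in> zclosure n D"
  obtain F where F: "F \<subseteq> regular_fun n" "V = zero_locus n F"
    using assms(1) unfolding closedin_zariski by blast
  have "f A = 0" if f: "f \<in> F" for f
  proof (rule zclosureD[OF A])
    show "f \<in> regular_fun n" using F(1) f by (rule subsetD)
    show "f B = 0" if "B \<in> D" for B
      using subsetD[OF assms(2) that] f unfolding F(2) by (rule zero_locusD)
  qed
  then show "A \<in> V" unfolding F(2) by (rule zero_locusI[OF subsetD[OF zclosure_carrier A]])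
qed

lemma zclosure_closed: "closedin (zariski n) V \<Longrightarrow> zclosure n V = V"
  using closedin_subset[of "zariski n" V] unfolding topspace_zariski
  by (metis subset_antisym zclosure_minimal zclosure_subset order_refl)

lemma zclosure_vanish:
  assumes "regular_on n (zclosure n D) f" "D \<subseteq> carrier (GL n)" "\<And>B. B \<in> D \<Longrightarrow> f B = 0" "A \<in> zclosure n D"
  shows "f A = 0"
proof -
  obtain h where h: "h \<in> regular_fun n" "\<forall>B\<in>zclosure n D. f B = h B"
    using assms(1) unfolding regular_on_def by blast
  have "h B = 0" if "B \<in> D" for B
    using bspec[OF h(2) subsetD[OF zclosure_subset[OF assms(2)] that]] assms(3)[OF that] by simp
  then have "h A = 0" by (rule zclosureD[OF assms(4) h(1)])
  then show ?thesis using bspec[OF h(2) assms(4)] by simp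
qed

text \<open>Continuity of regular maps: if \<open>f\<close> vanishes on \<open>E\<close>, its
  pullback vanishes on \<open>D\<close> and therefore on the closure of \<open>D\<close>.\<close>

lemma zclosure_image:
  assumes \<psi>: "regular_map n (zclosure n D) \<psi>" "\<And>A. A \<in> zclosure n D \<Longrightarrow> \<psi> A \<in> carrier (GL n)"
    and "D \<subseteq> carrier (GL n)" "\<And>B. B \<in> D \<Longrightarrow> \<psi> B \<in> E" "A \<in> zclosure n D"
  shows "\<psi> A \<in> zclosure n E"
proof -
  have "f (\<psi> A) = 0" if "f \<in> regular_fun n" "\<forall>B\<in>E. f B = 0" for f
    by (rule zclosure_vanish[OF regular_mapD[OF \<psi>(1) that(1)] assms(3) _ assms(5)])
       (rule bspec[OF that(2) assms(4)])
  then show ?thesis by (rule zclosureI[OF \<psi>(2)[OF assms(5)]])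
qed

text \<open>Primality of the vanishing ideal, phrased through principal open subsets. It makes sense
  for sets that are not closed, so commutator sets and derived subgroups can be treated before their
  closures are taken.\<close>

definition irreducible_set :: "nat \<Rightarrow> 'k::field mat set \<Rightarrow> bool" where
  "irreducible_set n X \<longleftrightarrow> X \<noteq> {} \<and> (\<forall>f\<in>regular_fun n. \<forall>g\<in>regular_fun n.
     (\<exists>A\<in>X. f A \<noteq> 0) \<longrightarrow> (\<exists>A\<in>X. g A \<noteq> 0) \<longrightarrow> (\<exists>A\<in>X. f A \<noteq> 0 \<and> g A \<noteq> 0))"

lemma irreducible_setD:
  assumes "irreducible_set n X" "regular_on n X f" "regular_on n X g" "\<exists>A\<in>X. f A \<noteq> 0" "\<exists>A\<in>X. g A \<noteq> 0"
  shows "\<exists>A\<in>X. f A \<noteq> 0 \<and> g A \<noteq> 0"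
proof -
  obtain f' g' where f': "f' \<in> regular_fun n" "\<And>A. A \<in> X \<Longrightarrow> f A = f' A"
    and g': "g' \<in> regular_fun n" "\<And>A. A \<in> X \<Longrightarrow> g A = g' A"
    using assms(2,3) unfolding regular_on_def by blast
  have "\<exists>A\<in>X. f' A \<noteq> 0" "\<exists>A\<in>X. g' A \<noteq> 0" using assms(4,5) f'(2) g'(2) by auto
  then obtain A where "A \<in> X" "f' A \<noteq> 0" "g' A \<noteq> 0"
    using assms(1) f'(1) g'(1) unfolding irreducible_set_def by blast
  then show ?thesis using f'(2) g'(2) by auto
qed

lemma irreducible_set_zclosure:
  assumes "irreducible_set n D" "D \<subseteq> carrier (GL n)"
  shows "irreducible_set n (zclosure n D)"
  unfolding irreducible_set_def
proof (intro conjI ballI impI)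
  show "zclosure n D \<noteq> {}" using assms(1) zclosure_subset[OF assms(2)] unfolding irreducible_set_def by blast
  fix f g :: "'a mat \<Rightarrow> 'a" assume fg: "f \<in> regular_fun n" "g \<in> regular_fun n"
    and ex: "\<exists>A\<in>zclosure n D. f A \<noteq> 0" "\<exists>A\<in>zclosure n D. g A \<noteq> 0"
  have "\<exists>A\<in>D. f A \<noteq> 0" "\<exists>A\<in>D. g A \<noteq> 0"
    using ex zclosure_vanish[OF regular_onI[OF fg(1)] assms(2)] zclosure_vanish[OF regular_onI[OF fg(2)] assms(2)]
    by blast+
  then have "\<exists>A\<in>D. f A \<noteq> 0 \<and> g A \<noteq> 0" using assms(1) fg by (auto simp: irreducible_set_def)
  then show "\<exists>A\<in>zclosure n D. f A \<noteq> 0 \<and> g A \<noteq> 0" using zclosure_subset[OF assms(2)] by blast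
qed

text \<open>Separate regularity suffices: freeze the variables one after the other.\<close>

lemma irreducible_set_binary_image:
  assumes S: "irreducible_set n S" and T: "irreducible_set n T"
    and right: "\<And>s. s \<in> S \<Longrightarrow> regular_map n T (m s)"
    and left: "\<And>t. t \<in> T \<Longrightarrow> regular_map n S (\<lambda>s. m s t)"
  shows "irreducible_set n {m s t | s t. s \<in> S \<and> t \<in> T}"
  unfolding irreducible_set_def
proof (intro conjI ballI impI)
  show "{m s t |s t. s \<in> S \<and> t \<in> T} \<noteq> {}" using S T by (auto simp: irreducible_set_def)
  fix f g :: "'a mat \<Rightarrow> 'a" assume fg: "f \<in> regular_fun n" "g \<in> regular_fun n"
    and ex: "\<exists>A\<in>{m s t |s t. s \<in> S \<and> t \<in> T}. f A \<noteq> 0" "\<exists>A\<in>{m s t |s t. s \<in> S \<and> t \<in> T}. g A \<noteq> 0"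
  then obtain s1 t1 s2 t2 where st: "s1 \<in> S" "t1 \<in> T" "f (m s1 t1) \<noteq> 0" "s2 \<in> S" "t2 \<in> T" "g (m s2 t2) \<noteq> 0"
    by blast
  have "\<exists>t\<in>T. f (m s1 t) \<noteq> 0 \<and> g (m s2 t) \<noteq> 0"
    using st by (intro irreducible_setD[OF T] regular_mapD[OF right] fg) auto
  then obtain t where t: "t \<in> T" "f (m s1 t) \<noteq> 0" "g (m s2 t) \<noteq> 0" by blast
  have "\<exists>s\<in>S. f (m s t) \<noteq> 0 \<and> g (m s t) \<noteq> 0"
    using st t by (intro irreducible_setD[OF S] regular_mapD[OF left] fg) auto
  then show "\<exists>A\<in>{m s t |s t. s \<in> S \<and> t \<in> T}. f A \<noteq> 0 \<and> g A \<noteq> 0" using t(1) by blast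
qed

lemma irreducible_set_Union:
  assumes irr: "\<And>i::nat. irreducible_set n (C i)" and mono: "\<And>i. C i \<subseteq> C (Suc i)"
  shows "irreducible_set n (\<Union>i. C i)"
  unfolding irreducible_set_def
proof (intro conjI ballI impI)
  show "(\<Union>i. C i) \<noteq> {}" using irr[of 0] by (auto simp: irreducible_set_def)
  fix f g :: "'a mat \<Rightarrow> 'a" assume fg: "f \<in> regular_fun n" "g \<in> regular_fun n"
    and "\<exists>A\<in>(\<Union>i. C i). f A \<noteq> 0" "\<exists>A\<in>(\<Union>i. C i). g A \<noteq> 0"
  then obtain A i B j where AB: "A \<in> C i" "f A \<noteq> 0" "B \<in> C j" "g B \<noteq> 0" by blast
  have "A \<in> C (max i j)" "B \<in> C (max i j)"
    using AB lift_Suc_mono_le[of C, OF mono] by (meson max.cobounded1 max.cobounded2 subsetD)+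
  then have "\<exists>A\<in>C (max i j). f A \<noteq> 0 \<and> g A \<noteq> 0"
    using irr[of "max i j"] fg AB unfolding irreducible_set_def by blast
  then show "\<exists>A\<in>(\<Union>i. C i). f A \<noteq> 0 \<and> g A \<noteq> 0" by blast
qed

section \<open>The coordinate ring of a closed irreducible set\<close>

context
  fixes n :: nat and X :: "'k::alg_closed_field mat set"
  assumes X: "closedin (zariski n) X" "irreducible_set n X"
begin

text \<open>Composing with this map turns restriction to \<open>X\<close> into an operation on total
  functions: two composites are equal exactly when the functions agree on \<open>X\<close>.\<close>

definition retract :: "'k mat \<Rightarrow> 'k mat" where
  "retract A = (if A \<in> X then A else (SOME B. B \<in> X))"

definition coordinate_ring :: "('k mat \<Rightarrow> 'k) set" where
  "coordinate_ring = (\<lambda>f. f \<circ> retract) ` regular_fun n"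

definition coordinates :: "('k mat \<Rightarrow> 'k) list" where
  "coordinates = map (\<lambda>f. f \<circ> retract)
    ((\<lambda>A. inverse (det A)) # map (\<lambda>p A. A $$ p) (List.product [0..<n] [0..<n]))"

lemma retract_in: "retract A \<in> X"
  using X(2) some_in_eq[of X] by (auto simp: retract_def irreducible_set_def)

lemma retract_id: "A \<in> X \<Longrightarrow> retract A = A"
  by (simp add: retract_def)

lemma X_GL: "X \<subseteq> carrier (GL n)"
  using closedin_subset[OF X(1)] by (simp add: topspace_zariski)

lemma is_subring_coordinate_ring: "is_subring coordinate_ring"
  unfolding is_subring_def coordinate_ring_def
proof (intro conjI ballI; (elim imageE)?)
  show "0 \<in> (\<lambda>f. f \<circ> retract) ` regular_fun n"
    by (rule image_eqI[OF _ regular_fun.const[of 0]]) (simp add: fun_eq_iff)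
  show "1 \<in> (\<lambda>f. f \<circ> retract) ` regular_fun n"
    by (rule image_eqI[OF _ regular_fun.const[of 1]]) (simp add: fun_eq_iff)
  show "- x \<in> (\<lambda>f. f \<circ> retract) ` regular_fun n" if "x = f \<circ> retract" "f \<in> regular_fun n" for x f
    by (rule image_eqI[OF _ regular_fun.mult[OF regular_fun.const[of "- 1"] that(2)]]) (simp add: fun_eq_iff that(1))
  fix x y f g assume fg: "x = f \<circ> retract" "f \<in> regular_fun n" "y = g \<circ> retract" "g \<in> regular_fun n"
  show "x + y \<in> (\<lambda>f. f \<circ> retract) ` regular_fun n"
    by (rule image_eqI[OF _ regular_fun.add[OF fg(2,4)]]) (simp add: fun_eq_iff fg(1,3))
  show "x * y \<in> (\<lambda>f. f \<circ> retract) ` regular_fun n"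
    by (rule image_eqI[OF _ regular_fun.mult[OF fg(2,4)]]) (simp add: fun_eq_iff fg(1,3))
qed

lemma entry_in_coordinates: "i < n \<Longrightarrow> j < n \<Longrightarrow> (\<lambda>A. A $$ (i, j)) \<circ> retract \<in> set coordinates"
  unfolding coordinates_def set_map list.set by (intro imageI insertI2) (simp add: image_eqI[of _ _ "(i, j)"])

lemma inv_det_in_coordinates: "(\<lambda>A. inverse (det A)) \<circ> retract \<in> set coordinates"
  unfolding coordinates_def set_map list.set by (intro imageI insertI1)

lemma coordinate_ring_generated: "coordinate_ring = adjoin_list consts_fn coordinates"
proof
  let ?R = "adjoin_list consts_fn coordinates"
  have R: "is_subring ?R" by (rule is_subring_adjoin_list[OF is_subring_consts_fn])
  note gens = subsetD[OF adjoin_list_gen[OF is_subring_consts_fn]]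
  note base = subsetD[OF adjoin_list_base[OF is_subring_consts_fn]]
  show "coordinate_ring \<subseteq> ?R"
    unfolding coordinate_ring_def
  proof (rule image_subsetI)
    fix f :: "'k mat \<Rightarrow> 'k" assume "f \<in> regular_fun n"
    then show "f \<circ> retract \<in> ?R"
    proof induction
      case (const c)
      have "(\<lambda>_. c) \<circ> retract = (\<lambda>_. c)" by (simp add: fun_eq_iff)
      then show ?case using base[of "\<lambda>_. c"] by simp
    next
      case (entry i j)
      then show ?case by (intro gens entry_in_coordinates)
    next
      case inv_det
      show ?case by (intro gens inv_det_in_coordinates)
    next
      case (add f g)
      have "(\<lambda>A. f A + g A) \<circ> retract = (f \<circ> retract) + (g \<circ> retract)" by (simp add: fun_eq_iff)
      then show ?case using is_subringD(4)[OF R add.IH] by (simp only:)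
    next
      case (mult f g)
      have "(\<lambda>A. f A * g A) \<circ> retract = (f \<circ> retract) * (g \<circ> retract)" by (simp add: fun_eq_iff)
      then show ?case using is_subringD(5)[OF R mult.IH] by (simp only:)
    qed
  qed
  show "?R \<subseteq> coordinate_ring"
  proof (rule adjoin_list_subset[OF is_subring_coordinate_ring])
    show "consts_fn \<subseteq> coordinate_ring"
      unfolding coordinate_ring_def
      by (rule image_subsetI, rule image_eqI[OF _ regular_fun.const]) (simp add: fun_eq_iff)
    show "set coordinates \<subseteq> coordinate_ring"
      unfolding coordinates_def coordinate_ring_def set_map
      by (rule image_mono) (auto intro: regular_fun.inv_det regular_fun.entry)
  qed
qed

text \<open>The images of the entry functions form a matrix \<open>M\<close>. It is invertible
  because the determinant has an inverse in the coordinate ring, and it satisfies the equations of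
  \<open>X\<close> because these are 0 in that ring.\<close>

lemma hom_is_evaluation:
  assumes \<psi>: "ring_hom_on coordinate_ring \<psi>" "\<And>c. \<psi> (\<lambda>_. c) = c"
  shows "\<exists>A\<in>X. \<forall>f\<in>coordinate_ring. \<psi> f = f A"
proof -
  define M where "M = mat n n (\<lambda>(i, j). \<psi> ((\<lambda>A. A $$ (i, j)) \<circ> retract))"
  have M: "M \<in> carrier_mat n n" by (simp add: M_def)
  note H = ring_hom_onD[OF \<psi>(1)] and S = is_subringD[OF is_subring_coordinate_ring]
  have mem: "f \<circ> retract \<in> coordinate_ring" if "f \<in> regular_fun n" for f
    using that by (auto simp: coordinate_ring_def)
  have M_entry: "M $$ (i, j) = \<psi> ((\<lambda>A. A $$ (i, j)) \<circ> retract)" if "i < n" "j < n" for i j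
    using that by (simp add: M_def)
  let ?e = "\<lambda>i j. (\<lambda>A. A $$ (i, j)) \<circ> retract"
  have e: "?e i j \<in> coordinate_ring" if "i < n" "j < n" for i j
    by (rule mem[OF regular_fun.entry[OF that]])
  \<comment> \<open>The determinant is spelled out by the Leibniz formula inside the ring of
    functions, so that the homomorphism can be pushed through its sums and products.\<close>
  define D where "D = (\<Sum>p\<in>{p. p permutes {0..<n}}. (\<lambda>_. signof p) * (\<Prod>i = 0..<n. ?e i (p i)))"
  have const: "(\<lambda>_. c) \<in> coordinate_ring" for c
    using mem[OF regular_fun.const[of c]] by (simp add: comp_def)
  have prod_in: "(\<Prod>i = 0..<n. ?e i (p i)) \<in> coordinate_ring" if "p permutes {0..<n}" for p
    by (rule is_subring_prod[OF is_subring_coordinate_ring e]) (use permutes_in_image[OF that] in auto)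
  have DR: "D \<in> coordinate_ring"
    unfolding D_def by (intro is_subring_sum[OF is_subring_coordinate_ring] S(5) const prod_in) auto
  have sum_app: "(\<Sum>i\<in>I. F i) A = (\<Sum>i\<in>I. F i A)" for F :: "'z \<Rightarrow> 'k mat \<Rightarrow> 'k" and I A
    by (induction I rule: infinite_finite_induct) auto
  have prod_app: "(\<Prod>i\<in>I. F i) A = (\<Prod>i\<in>I. F i A)" for F :: "'z \<Rightarrow> 'k mat \<Rightarrow> 'k" and I A
    by (induction I rule: infinite_finite_induct) auto
  have D: "D A = det (retract A)" for A
  proof -
    have "retract A \<in> carrier_mat n n" using retract_in X_GL carrier_GL by blast
    then show ?thesis by (simp add: D_def det_def' sum_app prod_app)
  qed
  have "\<psi> D = (\<Sum>p\<in>{p. p permutes {0..<n}}. \<psi> ((\<lambda>_. signof p) * (\<Prod>i = 0..<n. ?e i (p i))))"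
    unfolding D_def
    by (rule ring_hom_on_sum[OF is_subring_coordinate_ring \<psi>(1)]) (intro S(5) const prod_in, simp)
  also have "\<dots> = (\<Sum>p\<in>{p. p permutes {0..<n}}. signof p * (\<Prod>i = 0..<n. M $$ (i, p i)))"
  proof (rule sum.cong[OF refl])
    fix p assume p: "p \<in> {p. p permutes {0..<n}}"
    then have lt: "p i < n" if "i < n" for i using permutes_in_image[of p "{0..<n}" i] that by simp
    have "\<psi> (\<Prod>i = 0..<n. ?e i (p i)) = (\<Prod>i = 0..<n. \<psi> (?e i (p i)))"
      by (rule ring_hom_on_prod[OF is_subring_coordinate_ring \<psi>(1)]) (use lt in \<open>auto intro: e\<close>)
    also have "\<dots> = (\<Prod>i = 0..<n. M $$ (i, p i))"
      by (rule prod.cong[OF refl]) (use M_entry lt in auto)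
    finally show "\<psi> ((\<lambda>_. signof p) * (\<Prod>i = 0..<n. ?e i (p i))) = signof p * (\<Prod>i = 0..<n. M $$ (i, p i))"
      using H(4)[OF const prod_in] p \<psi>(2) by simp
  qed
  also have "\<dots> = det M" by (rule det_def'[OF M, symmetric])
  finally have detM: "\<psi> D = det M" .
  let ?d = "(\<lambda>A. inverse (det A)) \<circ> retract"
  have "D * ?d = 1"
  proof
    fix A
    have "det (retract A) \<noteq> 0" using retract_in[of A] X_GL carrier_GL by blast
    then show "(D * ?d) A = 1 A" using D[of A] by simp
  qed
  then have "det M * \<psi> ?d = 1"
    using H(4)[OF DR mem[OF regular_fun.inv_det]] H(2) detM by simp
  then have det0: "det M \<noteq> 0" and invdet: "\<psi> ?d = inverse (det M)" by (auto simp: inverse_unique)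
  have eval: "\<psi> (f \<circ> retract) = f M" if "f \<in> regular_fun n" for f
    using that
  proof induction
    case (const c)
    show ?case using \<psi>(2)[of c] by (simp add: comp_def)
  next
    case (entry i j)
    then show ?case by (rule M_entry[symmetric])
  next
    case inv_det
    show ?case by (rule invdet)
  next
    case (add f g)
    have "(\<lambda>A. f A + g A) \<circ> retract = (f \<circ> retract) + (g \<circ> retract)" by (simp add: fun_eq_iff)
    then show ?case using H(3)[OF mem[OF add.hyps(1)] mem[OF add.hyps(2)]] add.IH by (simp only:)
  next
    case (mult f g)
    have "(\<lambda>A. f A * g A) \<circ> retract = (f \<circ> retract) * (g \<circ> retract)" by (simp add: fun_eq_iff)
    then show ?case using H(4)[OF mem[OF mult.hyps(1)] mem[OF mult.hyps(2)]] mult.IH by (simp only:)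
  qed
  have "M \<in> X"
  proof -
    obtain F where F: "F \<subseteq> regular_fun n" "X = zero_locus n F" using X(1) unfolding closedin_zariski by blast
    have "f M = 0" if f: "f \<in> F" for f
    proof -
      have "f (retract A) = 0" for A
        using retract_in[of A] f unfolding F(2) by (rule zero_locusD)
      then have "f \<circ> retract = (\<lambda>_. 0)" by (simp add: fun_eq_iff)
      then show ?thesis using eval[OF subsetD[OF F(1) f]] \<psi>(2)[of 0] by simp
    qed
    then show ?thesis unfolding F(2) using zero_locusI[OF iffD2[OF carrier_GL conjI[OF M det0]]] by blast
  qed
  moreover have "\<psi> f = f M" if f: "f \<in> coordinate_ring" for f
  proof -
    obtain f' where "f' \<in> regular_fun n" "f = f' \<circ> retract"
      using f unfolding coordinate_ring_def by blast
    then show ?thesis using eval retract_id[OF \<open>M \<in> X\<close>] by simp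
  qed
  ultimately show ?thesis by blast
qed

lemma affine_variety_coordinate_ring: "affine_variety X coordinate_ring coordinates"
proof
  show "integral_domain_on coordinate_ring"
    unfolding integral_domain_on_def
  proof (intro conjI is_subring_coordinate_ring ballI impI)
    fix u v assume "u \<in> coordinate_ring" "v \<in> coordinate_ring" and uv: "u * v = 0"
    then obtain f g where fg: "f \<in> regular_fun n" "g \<in> regular_fun n" "u = f \<circ> retract" "v = g \<circ> retract"
      by (auto simp: coordinate_ring_def)
    have z: "f A * g A = 0" if "A \<in> X" for A
      using fun_cong[OF uv, of A] retract_id[OF that] by (simp add: fg)
    then have "(\<forall>A\<in>X. f A = 0) \<or> (\<forall>A\<in>X. g A = 0)"
      using irreducible_setD[OF X(2) regular_onI[OF fg(1)] regular_onI[OF fg(2)]] by auto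
    then show "u = 0 \<or> v = 0" using retract_in by (auto simp: fg fun_eq_iff)
  qed
  show "coordinate_ring = adjoin_list consts_fn coordinates" by (rule coordinate_ring_generated)
  show "f = 0" if f: "f \<in> coordinate_ring" "\<And>A. A \<in> X \<Longrightarrow> f A = 0" for f
  proof -
    obtain f' where f': "f = f' \<circ> retract" using f(1) unfolding coordinate_ring_def by blast
    have "f' (retract A) = 0" for A using f(2)[OF retract_in[of A]] retract_id[OF retract_in[of A]] by (simp add: f')
    then show ?thesis by (simp add: f' fun_eq_iff)
  qed
  show "\<exists>A\<in>X. \<forall>f\<in>coordinate_ring. \<psi> f = f A" if "ring_hom_on coordinate_ring \<psi>" "\<And>c. \<psi> (\<lambda>_. c) = c" for \<psi>
    using that by (rule hom_is_evaluation)
  show "A = B" if AB: "A \<in> X" "B \<in> X" and eq: "\<And>f. f \<in> coordinate_ring \<Longrightarrow> f A = f B" for A B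
  proof (rule eq_matI)
    have AB': "A \<in> carrier_mat n n" "B \<in> carrier_mat n n" using AB X_GL carrier_GL by blast+
    then show "dim_row A = dim_row B" "dim_col A = dim_col B" by auto
    fix i j assume "i < dim_row B" "j < dim_col B"
    then have "i < n" "j < n" using AB' by auto
    then have "(\<lambda>A. A $$ (i, j)) \<circ> retract \<in> coordinate_ring"
      using regular_fun.entry by (auto simp: coordinate_ring_def)
    from eq[OF this] show "A $$ (i, j) = B $$ (i, j)" using retract_id AB by simp
  qed
qed

context
  fixes \<psi> :: "'k mat \<Rightarrow> 'k mat"
  assumes \<psi>: "regular_map n X \<psi>" "\<And>A. A \<in> X \<Longrightarrow> \<psi> A \<in> X"
begin

lemma variety_endomorphism_retract: "variety_endomorphism X coordinate_ring coordinates (\<psi> \<circ> retract)"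
proof (intro variety_endomorphism.intro affine_variety_coordinate_ring variety_endomorphism_axioms.intro)
  show "(\<psi> \<circ> retract) x \<in> X" if "x \<in> X" for x using \<psi>(2) retract_in by simp
  fix f assume "f \<in> coordinate_ring"
  then obtain f' where f': "f' \<in> regular_fun n" "f = f' \<circ> retract" by (auto simp: coordinate_ring_def)
  then obtain h where h: "h \<in> regular_fun n" "\<And>A. A \<in> X \<Longrightarrow> f' (\<psi> A) = h A"
    using \<psi>(1) by (auto simp: regular_map_def regular_on_def)
  have "f \<circ> (\<psi> \<circ> retract) = h \<circ> retract"
    using h(2)[OF retract_in] retract_id[OF \<psi>(2)[OF retract_in]] by (auto simp: f'(2) fun_eq_iff)
  then show "f \<circ> (\<psi> \<circ> retract) \<in> coordinate_ring" using h(1) by (auto simp: coordinate_ring_def)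
qed

interpretation E: variety_endomorphism X coordinate_ring coordinates "\<psi> \<circ> retract"
  by (rule variety_endomorphism_retract)

lemma fibre_retract: "A \<in> X \<Longrightarrow> {B \<in> X. (\<psi> \<circ> retract) B = (\<psi> \<circ> retract) A} = {B \<in> X. \<psi> B = \<psi> A}"
  using retract_id by auto

text \<open>The left side is density of the image in \<open>X\<close>, the right side triviality of
  the kernel of the comorphism.\<close>

lemma dense_iff_injective:
  "(\<forall>f\<in>regular_fun n. (\<forall>A\<in>X. f (\<psi> A) = 0) \<longrightarrow> (\<forall>A\<in>X. f A = 0)) \<longleftrightarrow>
   (\<forall>f\<in>coordinate_ring. f \<circ> (\<psi> \<circ> retract) = 0 \<longrightarrow> f = 0)"
proof -
  have *: "(\<forall>A\<in>X. f A = 0) \<longleftrightarrow> f \<circ> retract = 0" for f :: "'k mat \<Rightarrow> 'k"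
  proof
    assume "\<forall>A\<in>X. f A = 0"
    then show "f \<circ> retract = 0" using retract_in by (simp add: fun_eq_iff)
  next
    assume "f \<circ> retract = 0"
    then have "f (retract A) = 0" for A by (simp add: fun_eq_iff)
    then show "\<forall>A\<in>X. f A = 0" using retract_id by metis
  qed
  have eq: "(f \<circ> retract) \<circ> (\<psi> \<circ> retract) = (\<lambda>A. f (\<psi> A)) \<circ> retract" for f
    using retract_id[OF \<psi>(2)[OF retract_in]] by (simp add: fun_eq_iff)
  show ?thesis unfolding coordinate_ring_def ball_simps(9) * eq ..
qed

lemma finite_fibre_of_dense:
  assumes "\<And>f A. f \<in> regular_fun n \<Longrightarrow> \<forall>A\<in>X. f (\<psi> A) = 0 \<Longrightarrow> A \<in> X \<Longrightarrow> f A = 0"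
  shows "\<exists>A\<in>X. finite {B \<in> X. \<psi> B = \<psi> A}"
proof -
  have "\<forall>f\<in>coordinate_ring. f \<circ> (\<psi> \<circ> retract) = 0 \<longrightarrow> f = 0"
    unfolding dense_iff_injective[symmetric] using assms by blast
  then obtain A where "A \<in> X" "finite {B \<in> X. (\<psi> \<circ> retract) B = (\<psi> \<circ> retract) A}"
    using E.finite_fibre_of_injective by blast
  then show ?thesis using fibre_retract by auto
qed

lemma image_contains_open_of_finite_fibres:
  assumes "\<And>A. A \<in> X \<Longrightarrow> finite {B \<in> X. \<psi> B = \<psi> A}"
  shows "\<exists>b\<in>regular_fun n. (\<exists>A\<in>X. b A \<noteq> 0) \<and> (\<forall>A\<in>X. b A \<noteq> 0 \<longrightarrow> A \<in> \<psi> ` X)"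
proof -
  have "\<And>f. f \<in> coordinate_ring \<Longrightarrow> f \<circ> (\<psi> \<circ> retract) = 0 \<Longrightarrow> f = 0"
    using E.injective_of_finite_fibres assms fibre_retract by simp
  from E.image_contains_open[OF this] obtain b where b: "b \<in> coordinate_ring" "b \<noteq> 0"
    "\<forall>A\<in>X. b A \<noteq> 0 \<longrightarrow> A \<in> (\<psi> \<circ> retract) ` X" by blast
  obtain b' where b': "b' \<in> regular_fun n" "b = b' \<circ> retract" using b(1) by (auto simp: coordinate_ring_def)
  have eq: "b A = b' A" if "A \<in> X" for A using retract_id[OF that] b'(2) by simp
  have "\<exists>A\<in>X. b' A \<noteq> 0" using E.nonvanish[OF b(1,2)] eq by auto
  moreover have "(\<psi> \<circ> retract) ` X = \<psi> ` X" using retract_id by (auto simp: image_iff)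
  ultimately show ?thesis using b(3) eq b'(1) by (intro bexI[of _ b']) auto
qed

end

end

section \<open>Noetherian rings\<close>

definition lin_span :: "'r::comm_ring_1 set \<Rightarrow> (nat \<Rightarrow> 'r) \<Rightarrow> nat \<Rightarrow> 'r set" where
  "lin_span A f m = {\<Sum>i<m. a i * f i | a. \<forall>i. a i \<in> A}"

text \<open>The ascending chain condition, in a form to which a sequence of witnesses can be fed
  directly.\<close>

definition noetherian_on :: "'r::comm_ring_1 set \<Rightarrow> bool" where
  "noetherian_on A \<longleftrightarrow> (\<forall>f. (\<forall>i. f i \<in> A) \<longrightarrow> (\<exists>m. f m \<in> lin_span A f m))"

lemma lin_spanI: "(\<And>i. a i \<in> A) \<Longrightarrow> (\<Sum>i<m. a i * f i) \<in> lin_span A f m"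
  unfolding lin_span_def by blast

lemma lin_spanE:
  assumes "x \<in> lin_span A f m"
  obtains a where "\<And>i. a i \<in> A" "x = (\<Sum>i<m. a i * f i)"
  using assms unfolding lin_span_def by blast

lemma lin_span_cong: "(\<And>i. i < m \<Longrightarrow> f i = g i) \<Longrightarrow> lin_span A f m = lin_span A g m"
  unfolding lin_span_def by (auto intro!: sum.cong exI)

lemma lin_span_add:
  assumes A: "is_subring A" and "x \<in> lin_span A f m" "y \<in> lin_span A f m"
  shows "x + y \<in> lin_span A f m"
proof -
  obtain a where a: "\<And>i. a i \<in> A" "x = (\<Sum>i<m. a i * f i)" using assms(2) by (elim lin_spanE) blast
  obtain b where b: "\<And>i. b i \<in> A" "y = (\<Sum>i<m. b i * f i)" using assms(3) by (elim lin_spanE) blast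
  have "x + y = (\<Sum>i<m. (a i + b i) * f i)" by (simp add: a(2) b(2) sum.distrib distrib_right)
  then show ?thesis using lin_spanI[of "\<lambda>i. a i + b i" A f m] is_subringD(4)[OF A a(1) b(1)] by simp
qed

lemma lin_span_scale:
  assumes A: "is_subring A" and c: "c \<in> A" and "x \<in> lin_span A f m"
  shows "c * x \<in> lin_span A f m"
proof -
  obtain a where a: "\<And>i. a i \<in> A" "x = (\<Sum>i<m. a i * f i)" using assms(3) by (elim lin_spanE) blast
  have "c * x = (\<Sum>i<m. (c * a i) * f i)" by (simp add: a(2) sum_distrib_left mult.assoc)
  then show ?thesis using lin_spanI[of "\<lambda>i. c * a i" A f m] is_subringD(5)[OF A c a(1)] by simp
qed

lemma lin_span_zero: "is_subring A \<Longrightarrow> 0 \<in> lin_span A f m"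
  using lin_spanI[of "\<lambda>_. 0" A f m] by (simp add: is_subringD(1))

lemma lin_span_gen:
  assumes A: "is_subring A" and i: "i < m"
  shows "f i \<in> lin_span A f m"
proof -
  have "(\<Sum>j<m. (if j = i then 1 else 0) * f j) = (\<Sum>j<m. if j = i then f j else 0)"
    by (rule sum.cong) auto
  also have "\<dots> = f i" using i by simp
  finally show ?thesis
    using lin_spanI[of "\<lambda>j. if j = i then 1 else 0" A f m] is_subringD(1,2)[OF A] by simp
qed

lemma lin_span_subset:
  assumes A: "is_subring A" and sub: "\<And>i. i < m \<Longrightarrow> f i \<in> lin_span A g k"
  shows "lin_span A f m \<subseteq> lin_span A g k"
proof
  fix x assume "x \<in> lin_span A f m"
  then obtain a where a: "\<And>i. a i \<in> A" "x = (\<Sum>i<m. a i * f i)" by (elim lin_spanE) blast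
  have "(\<Sum>i<j. a i * f i) \<in> lin_span A g k" if "j \<le> m" for j
    using that
  proof (induction j)
    case 0
    show ?case using lin_span_zero[OF A] by simp
  next
    case (Suc j)
    then show ?case
      using lin_span_add[OF A Suc.IH lin_span_scale[OF A a(1) sub, of j]] by (simp add: add.commute)
  qed
  then show "x \<in> lin_span A g k" using a(2) by simp
qed

lemma lin_span_mono: "is_subring A \<Longrightarrow> m \<le> k \<Longrightarrow> lin_span A f m \<subseteq> lin_span A f k"
  by (rule lin_span_subset) (auto intro: lin_span_gen)

text \<open>Hilbert's basis theorem: choose successively elements of least degree outside the ideal generated
  so far; a relation between their leading coefficients lowers the degree.\<close>

lemma noetherian_polys_over:
  assumes A: "is_subring A" and N: "noetherian_on A"
  shows "noetherian_on (polys_over A)"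
  unfolding noetherian_on_def
proof (intro allI impI, rule ccontr)
  let ?P = "polys_over A"
  note P = is_subring_polys_over[OF A]
  fix F :: "nat \<Rightarrow> 'a poly" assume F: "\<forall>i. F i \<in> ?P" and none: "\<nexists>m. F m \<in> lin_span ?P F m"
  define I where "I = (\<Union>m. lin_span ?P F m)"
  have I_P: "I \<subseteq> ?P"
    unfolding I_def
  proof (intro UN_least subsetI)
    fix m p assume "p \<in> lin_span ?P F m"
    then obtain a where "\<And>i. a i \<in> ?P" "p = (\<Sum>i<m. a i * F i)" by (elim lin_spanE) blast
    then show "p \<in> ?P" using F by (simp add: is_subring_sum[OF P] is_subringD(5)[OF P])
  qed
  have common: "\<exists>M. \<forall>i<k. g i \<in> lin_span ?P F M" if "\<And>i. i < k \<Longrightarrow> g i \<in> I" for g :: "nat \<Rightarrow> 'a poly" and k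
    using that
  proof (induction k)
    case (Suc k)
    then obtain M where M: "\<forall>i<k. g i \<in> lin_span ?P F M" by auto
    obtain M' where M': "g k \<in> lin_span ?P F M'" using Suc.prems[of k] by (auto simp: I_def)
    have "g i \<in> lin_span ?P F (max M M')" if "i < Suc k" for i
      using M M' that lin_span_mono[OF P, of M "max M M'" F] lin_span_mono[OF P, of M' "max M M'" F]
      by (cases "i = k") auto
    then show ?case by blast
  qed simp
  \<comment> \<open>\<open>I\<close> is not finitely generated: any finite part of it lies in some
    \<open>lin_span ?P F M\<close>, and that span misses \<open>F M\<close>.\<close>
  have exists: "\<exists>p. p \<in> I \<and> p \<notin> lin_span ?P g k" if g: "\<And>i. i < k \<Longrightarrow> g i \<in> I" for g k
  proof -
    obtain M where M: "\<forall>i<k. g i \<in> lin_span ?P F M" using common[of k g] g by blast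
    have "lin_span ?P g k \<subseteq> lin_span ?P F M" by (rule lin_span_subset[OF P]) (use M in simp)
    moreover have "F M \<notin> lin_span ?P F M" using none by simp
    moreover have "F M \<in> I" using lin_span_gen[OF P, of M "Suc M" F] by (auto simp: I_def)
    ultimately show ?thesis by blast
  qed
  define Q where "Q g k p \<longleftrightarrow> p \<in> I \<and> p \<notin> lin_span ?P g k \<and>
    (\<forall>q. q \<in> I \<and> q \<notin> lin_span ?P g k \<longrightarrow> degree p \<le> degree q)" for g k p
  have "\<exists>g. \<forall>k. Q g k (g k)"
  proof (rule dependent_wellorder_choice[of Q])
    show "Q f k p = Q g k p" if "\<And>i. i < k \<Longrightarrow> f i = g i" for p f g k
      unfolding Q_def using lin_span_cong[of k f g ?P] that by simp
    show "\<exists>p. Q g k p" if "\<And>i. i < k \<Longrightarrow> Q g i (g i)" for k g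
    proof -
      define C where "C p \<longleftrightarrow> p \<in> I \<and> p \<notin> lin_span ?P g k" for p
      have "\<exists>p. C p" unfolding C_def by (rule exists) (use that in \<open>simp add: Q_def\<close>)
      then obtain p0 where "C p0" ..
      then obtain p where "C p" "\<forall>q. C q \<longrightarrow> degree p \<le> degree q"
        using ex_has_least_nat[of C p0 degree] by blast
      then show ?thesis unfolding Q_def C_def by blast
    qed
  qed
  then obtain g where Qg: "\<And>k. Q g k (g k)" by blast
  have gI: "g k \<in> I" and gn: "g k \<notin> lin_span ?P g k" for k using Qg[of k] by (simp_all add: Q_def)
  have gmin: "degree (g k) \<le> degree q" if "q \<in> I" "q \<notin> lin_span ?P g k" for k q
    using Qg[of k] that by (simp add: Q_def)
  have gP: "g k \<in> ?P" for k using gI I_P by blast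
  have "\<forall>k. lead_coeff (g k) \<in> A" using gP coeff_polys_over by blast
  then obtain m where "lead_coeff (g m) \<in> lin_span A (\<lambda>k. lead_coeff (g k)) m"
    using N[unfolded noetherian_on_def, rule_format, of "\<lambda>k. lead_coeff (g k)"] by blast
  then obtain b where b: "\<And>i. b i \<in> A" "lead_coeff (g m) = (\<Sum>i<m. b i * lead_coeff (g i))"
    by (elim lin_spanE) blast
  \<comment> \<open>\<open>g m\<close> was already a candidate at stage \<open>i\<close>, since it
    avoids even the larger span of stage \<open>m\<close>.\<close>
  have deg: "degree (g i) \<le> degree (g m)" if "i < m" for i
    using gmin[OF gI[of m], of i] gn[of m] lin_span_mono[OF P, of i m g] that by auto
  define s where "s = (\<Sum>i<m. monom (b i) (degree (g m) - degree (g i)) * g i)"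
  have s: "s \<in> lin_span ?P g m"
    unfolding s_def by (rule lin_spanI) (rule monom_polys_over[OF A b(1)])
  have sI: "lin_span ?P g m \<subseteq> I"
  proof -
    obtain M where M: "\<forall>i<m. g i \<in> lin_span ?P F M" using common[of m g] gI by blast
    have "lin_span ?P g m \<subseteq> lin_span ?P F M" by (rule lin_span_subset[OF P]) (use M in simp)
    then show ?thesis unfolding I_def by blast
  qed
  define p where "p = g m - s"
  have "g m \<in> lin_span ?P F M \<Longrightarrow> s \<in> lin_span ?P F M \<Longrightarrow> p \<in> lin_span ?P F M" for M
    using lin_span_add[OF P, of "g m" F M "- s"] lin_span_scale[OF P is_subringD(3)[OF P is_subringD(2)[OF P]], of s F M]
    by (simp add: p_def)
  moreover obtain M where "g m \<in> lin_span ?P F M" "s \<in> lin_span ?P F M"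
  proof -
    \<comment> \<open>A family of two elements, so that \<open>common\<close> places
      \<open>g m\<close> and \<open>s\<close> in one span.\<close>
    have "\<forall>i<2. (if i = 0 then g m else s) \<in> I" using gI s sI by auto
    then obtain M where M: "\<forall>i<2. (if i = (0::nat) then g m else s) \<in> lin_span ?P F M"
      using common[of 2 "\<lambda>i. if i = 0 then g m else s"] by blast
    show ?thesis by (rule that[of M]) (use spec[OF M, of 0] spec[OF M, of 1] in auto)
  qed
  ultimately have pI: "p \<in> I" unfolding I_def by blast
  have pn: "p \<notin> lin_span ?P g m"
  proof
    assume "p \<in> lin_span ?P g m"
    from lin_span_add[OF P this s] show False using gn[of m] by (simp add: p_def)
  qed
  have "degree s \<le> degree (g m)"
    unfolding s_def
  proof (rule degree_sum_le)
    fix i assume "i \<in> {..<m}"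
    then have i: "degree (g i) \<le> degree (g m)" using deg by simp
    have "degree (monom (b i) (degree (g m) - degree (g i)) * g i)
        \<le> degree (monom (b i) (degree (g m) - degree (g i))) + degree (g i)" by (rule degree_mult_le)
    also have "\<dots> \<le> degree (g m)" using degree_monom_le[of "b i" "degree (g m) - degree (g i)"] i by simp
    finally show "degree (monom (b i) (degree (g m) - degree (g i)) * g i) \<le> degree (g m)" .
  qed simp
  then have le: "degree p \<le> degree (g m)" unfolding p_def by (intro degree_diff_le) auto
  have "coeff s (degree (g m)) = (\<Sum>i<m. b i * lead_coeff (g i))"
    unfolding s_def coeff_sum
    by (rule sum.cong[OF refl]) (use deg in \<open>simp add: coeff_monom_mult\<close>)
  then have "coeff p (degree (g m)) = 0" using b(2) by (simp add: p_def)
  \<comment> \<open>\<open>p\<close> is itself a candidate at stage \<open>m\<close>, so its degree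
    cannot drop; yet its coefficient in that degree has cancelled.\<close>
  moreover have "degree p = degree (g m)" using le gmin[OF pI pn] by simp
  ultimately have "p = 0" by (metis leading_coeff_0_iff)
  then show False using pn lin_span_zero[OF P] by simp
qed

text \<open>The ring \<open>adjoin A y\<close> is a quotient of the polynomial ring: the sequence is
  lifted, a relation is found there and evaluated at \<open>y\<close>.\<close>

lemma noetherian_adjoin:
  fixes y :: "'r::comm_ring_1"
  assumes A: "is_subring A" and N: "noetherian_on A"
  shows "noetherian_on (adjoin A y)"
  unfolding noetherian_on_def
proof (intro allI impI)
  fix f :: "nat \<Rightarrow> 'r" assume "\<forall>i. f i \<in> adjoin A y"
  then have "\<forall>i. \<exists>p. p \<in> polys_over A \<and> f i = poly p y" unfolding adjoin_def by blast
  then obtain p where p: "\<And>i. p i \<in> polys_over A" "\<And>i. f i = poly (p i) y" by metis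
  obtain m where "p m \<in> lin_span (polys_over A) p m"
    using noetherian_polys_over[OF A N] p(1) unfolding noetherian_on_def by blast
  then obtain a where a: "\<And>i. a i \<in> polys_over A" "p m = (\<Sum>i<m. a i * p i)" by (elim lin_spanE) blast
  have "f m = (\<Sum>i<m. poly (a i) y * f i)" by (simp add: p(2) a(2) poly_sum)
  also have "\<dots> \<in> lin_span (adjoin A y) f m"
    by (rule lin_spanI) (use a(1) in \<open>simp add: adjoin_def\<close>)
  finally show "\<exists>m. f m \<in> lin_span (adjoin A y) f m" ..
qed

lemma noetherian_consts_fn: "noetherian_on (consts_fn :: ('a \<Rightarrow> 'k::field) set)"
  unfolding noetherian_on_def
proof (intro allI impI)
  fix f :: "nat \<Rightarrow> 'a \<Rightarrow> 'k" assume "\<forall>i. f i \<in> consts_fn"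
  then have "\<forall>i. \<exists>c. f i = (\<lambda>_. c)" by blast
  then obtain c where c: "\<And>i. f i = (\<lambda>_. c i)" by metis
  show "\<exists>m. f m \<in> lin_span consts_fn f m"
  proof (cases "c 0 = 0")
    case True
    then have "f 0 = 0" by (simp add: c fun_eq_iff)
    \<comment> \<open>Here the index is 0: the empty span already contains 0.\<close>
    then show ?thesis using lin_span_zero[OF is_subring_consts_fn, of f 0] by metis
  next
    case False
    have "(\<Sum>i<1. (\<lambda>_. c 1 / c 0) * f i) = f 1" using False by (simp add: c fun_eq_iff)
    moreover have "(\<Sum>i<1. (\<lambda>_. c 1 / c 0) * f i) \<in> lin_span consts_fn f 1"
      by (rule lin_spanI) simp
    ultimately show ?thesis by metis
  qed
qed

lemma noetherian_adjoin_list: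
  assumes "is_subring A" "noetherian_on A"
  shows "noetherian_on (adjoin_list A ys)"
  by (induction ys) (use assms in \<open>simp_all add: noetherian_adjoin is_subring_adjoin_list\<close>)

text \<open>The basis theorem in pointwise form; the coefficients are plain functions, because the
  relation will be evaluated at a single point.\<close>

lemma regular_fun_relation:
  fixes e :: "nat \<Rightarrow> 'k::field mat \<Rightarrow> 'k"
  assumes "\<And>i. e i \<in> regular_fun n"
  shows "\<exists>m a. \<forall>A. e m A = (\<Sum>i<m. a i A * e i A)"
proof -
  define gens :: "('k mat \<Rightarrow> 'k) list" where
    "gens = (\<lambda>A. inverse (det A)) # map (\<lambda>p A. A $$ p) (List.product [0..<n] [0..<n])"
  let ?R = "adjoin_list consts_fn gens"
  have R: "is_subring ?R" by (rule is_subring_adjoin_list[OF is_subring_consts_fn])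
  note gens = subsetD[OF adjoin_list_gen[OF is_subring_consts_fn, of gens]]
  note base = subsetD[OF adjoin_list_base[OF is_subring_consts_fn, of gens]]
  have "f \<in> ?R" if "f \<in> regular_fun n" for f
    using that
  proof induction
    case (const c)
    show ?case by (rule base) simp
  next
    case (entry i j)
    then show ?case
      by (intro gens) (unfold gens_def list.set set_map, intro insertI2, simp add: image_eqI[of _ _ "(i, j)"])
  next
    case inv_det
    show ?case by (rule gens) (simp add: gens_def)
  next
    case (add f g)
    show ?case using is_subringD(4)[OF R add.IH] unfolding plus_fun_def .
  next
    case (mult f g)
    show ?case using is_subringD(5)[OF R mult.IH] unfolding times_fun_def .
  qed
  then obtain m where "e m \<in> lin_span ?R e m"
    using noetherian_adjoin_list[OF is_subring_consts_fn noetherian_consts_fn, of gens] assms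
    unfolding noetherian_on_def by blast
  then obtain a where a: "e m = (\<Sum>i<m. a i * e i)" by (elim lin_spanE) blast
  have "(\<Sum>i<j. a i * e i) A = (\<Sum>i<j. a i A * e i A)" for A j
    by (induction j) simp_all
  then have "e m A = (\<Sum>i<m. a i A * e i A)" for A using fun_cong[OF a] by simp
  then show ?thesis by blast
qed

section \<open>Connected groups are irreducible\<close>

lemma openin_nonvanishing:
  assumes "regular_on n (carrier (GL n)) h"
  shows "openin (zariski n) {A \<in> carrier (GL n). h A \<noteq> 0}"
proof -
  obtain h' where h': "h' \<in> regular_fun n" "\<forall>A\<in>carrier (GL n). h A = h' A"
    using assms unfolding regular_on_def by blast
  have "{A \<in> carrier (GL n). h A \<noteq> 0} = carrier (GL n) - zero_locus n {h'}"
    using h'(2) unfolding zero_locus_def by auto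
  then show ?thesis unfolding openin_zariski using h'(1) by (intro exI[of _ "{h'}"]) simp
qed

text \<open>Otherwise one can keep splitting a nonempty open set into two disjoint ones, against Noetherianity.\<close>

lemma exists_irreducible_open_subset:
  fixes X :: "'k::field mat set"
  assumes X: "X \<noteq> {}"
  shows "\<exists>f\<in>regular_fun n. irreducible_set n {A \<in> X. f A \<noteq> 0}"
proof (rule ccontr)
  assume neg: "\<not> (\<exists>f\<in>regular_fun n. irreducible_set n {A \<in> X. f A \<noteq> 0})"
  define P where "P (k::nat) f \<longleftrightarrow> f \<in> regular_fun n \<and> (\<exists>A\<in>X. f A \<noteq> 0)" for k and f :: "'k mat \<Rightarrow> 'k"
  \<comment> \<open>The nonvanishing sets shrink: \<open>h\<close> is nonzero somewhere on that of
    \<open>f\<close> but zero on that of \<open>f'\<close>.\<close>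
  define Q where "Q (k::nat) f f' \<longleftrightarrow> (\<exists>g\<in>regular_fun n. \<exists>h\<in>regular_fun n. f' = (\<lambda>A. f A * g A) \<and>
    (\<exists>A\<in>X. f A * h A \<noteq> 0) \<and> (\<forall>A\<in>X. f A * g A * h A = 0))" for k and f f' :: "'k mat \<Rightarrow> 'k"
  have "\<exists>f. P 0 f" unfolding P_def using X by (intro exI[of _ "\<lambda>_. 1"]) (auto intro: regular_fun.const)
  moreover have "\<exists>f'. P (Suc k) f' \<and> Q k f f'" if f: "P k f" for f k
  proof -
    have fr: "f \<in> regular_fun n" using f by (simp add: P_def)
    then have "\<not> irreducible_set n {A \<in> X. f A \<noteq> 0}" using neg by blast
    moreover have "{A \<in> X. f A \<noteq> 0} \<noteq> {}" using f by (auto simp: P_def)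
    ultimately obtain g h where gh: "g \<in> regular_fun n" "h \<in> regular_fun n"
      "\<exists>A\<in>{A \<in> X. f A \<noteq> 0}. g A \<noteq> 0" "\<exists>A\<in>{A \<in> X. f A \<noteq> 0}. h A \<noteq> 0"
      "\<not> (\<exists>A\<in>{A \<in> X. f A \<noteq> 0}. g A \<noteq> 0 \<and> h A \<noteq> 0)"
      unfolding irreducible_set_def by blast
    have "P (Suc k) (\<lambda>A. f A * g A)" unfolding P_def using regular_fun.mult[OF fr gh(1)] gh(3) by auto
    moreover have "Q k f (\<lambda>A. f A * g A)"
      unfolding Q_def using gh by (intro bexI[OF _ gh(1)] bexI[OF _ gh(2)] conjI refl) auto
    ultimately show ?thesis by blast
  qed
  ultimately obtain f where f: "\<And>k. P k (f k)" "\<And>k. Q k (f k) (f (Suc k))"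
    using dependent_nat_choice[of P Q] by blast
  define S where "S k h g \<longleftrightarrow> h \<in> regular_fun n \<and> f (Suc k) = (\<lambda>A. f k A * g A) \<and>
    (\<exists>A\<in>X. f k A * h A \<noteq> 0) \<and> (\<forall>A\<in>X. f k A * g A * h A = 0)" for k g h
  have "\<exists>h g. S k h g" for k
    using f(2)[of k] unfolding Q_def S_def by blast
  then obtain h g where "\<And>k. S k (h k) (g k)" by metis
  then have hg: "\<And>k. h k \<in> regular_fun n" "\<And>k. f (Suc k) = (\<lambda>A. f k A * g k A)"
    "\<And>k. \<exists>A\<in>X. f k A * h k A \<noteq> 0" "\<And>k. \<forall>A\<in>X. f k A * g k A * h k A = 0"
    unfolding S_def by simp_all
  have fr: "f k \<in> regular_fun n" for k using f(1)[of k] by (simp add: P_def)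
  have zero: "f (k + Suc j) A * h k A = 0" if "A \<in> X" for k j A
    by (induction j) (use hg(4) that in \<open>auto simp: hg(2)\<close>)
  obtain m a where a: "\<And>A. f m A * h m A = (\<Sum>i<m. a i A * (f i A * h i A))"
    using regular_fun_relation[of "\<lambda>k A. f k A * h k A" n, OF regular_fun.mult[OF fr hg(1)]] by blast
  obtain A where A: "A \<in> X" "f m A * h m A \<noteq> 0" using hg(3) by blast
  \<comment> \<open>\<open>f m\<close> contains the factor \<open>f (Suc i)\<close>, on whose
    nonvanishing set \<open>h i\<close> is zero. Hence every term of the relation disappears at
    \<open>A\<close>.\<close>
  have "h i A = 0" if "i < m" for i
    using zero[OF A(1), of i "m - Suc i"] A(2) that by simp
  then have "f m A * h m A = 0" unfolding a by simp
  then show False using A(2) by simp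
qed

locale matrix_group =
  fixes n :: nat and G :: "'k::field mat set"
  assumes subgroup: "subgroup G (GL n)"
begin

sublocale group "GL n :: 'k mat monoid" by (rule group_GL)

abbreviation gmult (infixl "\<cdot>" 70) where "x \<cdot> y \<equiv> x \<otimes>\<^bsub>GL n\<^esub> y"
abbreviation ginv where "ginv x \<equiv> inv\<^bsub>GL n\<^esub> x"

lemma G_carrier: "x \<in> G \<Longrightarrow> x \<in> carrier (GL n)"
  using subgroup.subset[OF subgroup] by blast

lemmas G_closed = subgroup.m_closed[OF subgroup] subgroup.m_inv_closed[OF subgroup] subgroup.one_closed[OF subgroup]

end

lemma regular_map_left_mult:
  "g \<in> carrier (GL n) \<Longrightarrow> regular_map n (carrier (GL n)) (\<lambda>A. g \<otimes>\<^bsub>GL n\<^esub> A)"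
  by (intro regular_map_mult regular_map_const regular_map_id)

lemma regular_map_right_mult:
  "g \<in> carrier (GL n) \<Longrightarrow> regular_map n (carrier (GL n)) (\<lambda>A. A \<otimes>\<^bsub>GL n\<^esub> g)"
  by (intro regular_map_mult regular_map_const regular_map_id)

text \<open>The translates of an irreducible open subset are irreducible neighbourhoods, so the closure of one of
  them is open.\<close>

lemma irreducible_of_connected:
  fixes G :: "'k::field mat set"
  assumes G: "subgroup G (GL n)" and closed: "closedin (zariski n) G" and conn: "connectedin (zariski n) G"
  shows "irreducible_set n G"
proof -
  interpret matrix_group n G using G by (rule matrix_group.intro)
  have "G \<noteq> {}" using G_closed(3) by blast
  then obtain f where f: "f \<in> regular_fun n" and irr: "irreducible_set n {A \<in> G. f A \<noteq> 0}"
    using exists_irreducible_open_subset by blast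
  define U where "U = {A \<in> G. f A \<noteq> 0}"
  have UG: "U \<subseteq> G" and UC: "U \<subseteq> carrier (GL n)" using G_carrier by (auto simp: U_def)
  define C where "C = zclosure n U"
  have C: "C \<subseteq> G" "U \<subseteq> C" "C \<subseteq> carrier (GL n)"
    unfolding C_def by (rule zclosure_minimal[OF closed UG] zclosure_subset[OF UC] zclosure_carrier)+
  \<comment> \<open>This is the translate by \<open>g\<close> of the open set where \<open>f\<close>
    is nonzero; inside \<open>G\<close> it is the translate of \<open>U\<close>.\<close>
  define W where "W g = {A \<in> carrier (GL n). f (ginv g \<cdot> A) \<noteq> 0}" for g
  have reg: "regular_on n (carrier (GL n)) (\<lambda>A. f (ginv g \<cdot> A))" if "g \<in> G" for g
    using regular_mapD[OF regular_map_left_mult f] inv_closed G_carrier that by blast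
  have W_open: "openin (zariski n) (W g)" if "g \<in> G" for g
    unfolding W_def by (rule openin_nonvanishing[OF reg[OF that]])
  have W_trans: "ginv g \<cdot> A \<in> U" if "g \<in> G" "A \<in> W g \<inter> G" for g A
    using that G_closed by (auto simp: W_def U_def)
  have sub: "W g \<inter> G \<subseteq> C" if g: "g \<in> G" and meet: "C \<inter> W g \<noteq> {}" for g
  proof -
    obtain z where z: "z \<in> C" "f (ginv g \<cdot> z) \<noteq> 0" using meet by (auto simp: W_def)
    have "\<exists>u\<in>U. f (ginv g \<cdot> u) \<noteq> 0"
    proof (rule ccontr)
      assume "\<not> (\<exists>u\<in>U. f (ginv g \<cdot> u) \<noteq> 0)"
      then have "f (ginv g \<cdot> z) = 0"
        using zclosure_vanish[OF regular_on_subset[OF reg[OF g] zclosure_carrier] UC] z(1) C_def by blast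
      then show False using z(2) by simp
    qed
    then obtain u where u: "u \<in> U" "f (ginv g \<cdot> u) \<noteq> 0" by blast
    show ?thesis
    proof
      fix A assume A: "A \<in> W g \<inter> G"
      show "A \<in> C"
        unfolding C_def
      proof (rule zclosureI)
        show "A \<in> carrier (GL n)" using A G_carrier by blast
        fix r assume r: "r \<in> regular_fun n" "\<forall>B\<in>U. r B = 0"
        show "r A = 0"
        proof (rule ccontr)
          assume rA: "r A \<noteq> 0"
          have gc: "g \<in> carrier (GL n)" using g by (rule G_carrier)
          have regg: "regular_on n U (\<lambda>B. q (g \<cdot> B))" if "q \<in> regular_fun n" for q
            using regular_mapD[OF regular_map_left_mult[OF gc] that] UC by (rule regular_on_subset)
          have cancel: "g \<cdot> (ginv g \<cdot> B) = B" if "B \<in> G" for B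
            using G_carrier[OF that] gc by (simp add: m_assoc[symmetric])
          \<comment> \<open>Pulled back to \<open>U\<close> along the translation, both functions
            are nonzero somewhere, \<open>r\<close> because of \<open>A\<close> and \<open>f\<close>
            because of \<open>u\<close>. A common point yields an element of \<open>U\<close> at
            which \<open>r\<close> does not vanish.\<close>
          have "\<exists>B\<in>U. r (g \<cdot> B) \<noteq> 0 \<and> f (g \<cdot> B) \<noteq> 0"
          proof (rule irreducible_setD[OF irr[folded U_def] regg[OF r(1)] regg[OF f]])
            show "\<exists>B\<in>U. r (g \<cdot> B) \<noteq> 0"
              using W_trans[OF g A] cancel[of A] A rA by (intro bexI[of _ "ginv g \<cdot> A"]) auto
            have "u \<in> W g \<inter> G" using u UG G_carrier by (auto simp: W_def)
            from W_trans[OF g this] show "\<exists>B\<in>U. f (g \<cdot> B) \<noteq> 0"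
              using cancel[of u] u(1) by (intro bexI[of _ "ginv g \<cdot> u"]) (auto simp: U_def)
          qed
          then obtain B where B: "B \<in> U" "r (g \<cdot> B) \<noteq> 0" "f (g \<cdot> B) \<noteq> 0" by blast
          have "g \<cdot> B \<in> U" using B UG g G_closed(1) by (auto simp: U_def)
          then show False using r(2) B(2) by blast
        qed
      qed
    qed
  qed
  \<comment> \<open>The translates meeting \<open>C\<close> cover \<open>C\<close> and, within
    \<open>G\<close>, stay inside it, so \<open>C\<close> is open in \<open>G\<close>;
    \<open>E2\<close> is the complementary open set.\<close>
  define E1 where "E1 = \<Union> (W ` {g \<in> G. C \<inter> W g \<noteq> {}})"
  define E2 where "E2 = carrier (GL n) - C"
  have E1: "E1 \<inter> G \<subseteq> C" unfolding E1_def using sub by blast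
  have CE1: "C \<subseteq> E1"
  proof
    fix z assume z: "z \<in> C"
    obtain u where u: "u \<in> U" using irr unfolding U_def irreducible_set_def by blast
    \<comment> \<open>Translation by this element carries \<open>u\<close> to
      \<open>z\<close>.\<close>
    define g where "g = z \<cdot> ginv u"
    have mem: "z \<in> G" "u \<in> G" using z u C(1) UG by auto
    then have gG: "g \<in> G" unfolding g_def using G_closed by blast
    have "ginv g \<cdot> z = u"
      unfolding g_def using mem G_carrier by (simp add: inv_mult_group m_assoc)
    then have "z \<in> W g" using u G_carrier[OF mem(1)] by (auto simp: W_def U_def)
    then show "z \<in> E1" unfolding E1_def using gG z by blast
  qed
  have "E2 \<inter> G = {}"
  proof (rule ccontr)
    assume "E2 \<inter> G \<noteq> {}"
    moreover have "openin (zariski n) E1" unfolding E1_def using W_open by (intro openin_Union) auto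
    moreover have "openin (zariski n) E2"
      unfolding E2_def C_def using closedin_zclosure[of n U] unfolding closedin_def topspace_zariski by (rule conjunct2)
    moreover have "G \<subseteq> E1 \<union> E2" using CE1 G_carrier unfolding E2_def by blast
    moreover have "E1 \<inter> E2 \<inter> G = {}" using E1 unfolding E2_def by blast
    moreover have "E1 \<inter> G \<noteq> {}"
    proof -
      have "U \<noteq> {}" using irr unfolding U_def irreducible_set_def by (rule conjunct1)
      then show ?thesis using CE1 C(2) UG by blast
    qed
    ultimately have "\<exists>E1 E2. openin (zariski n) E1 \<and> openin (zariski n) E2 \<and> G \<subseteq> E1 \<union> E2 \<and>
        E1 \<inter> E2 \<inter> G = {} \<and> E1 \<inter> G \<noteq> {} \<and> E2 \<inter> G \<noteq> {}"
      by (intro exI[of _ E1] exI[of _ E2] conjI)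
    then show False using conjunct2[OF conn[unfolded connectedin]] by (rule rev_notE)
  qed
  then have "G = C" using C(1) G_carrier unfolding E2_def by blast
  then show ?thesis using irreducible_set_zclosure[OF irr[folded U_def] UC] unfolding C_def by simp
qed

section \<open>Derived subgroups\<close>

lemma (in group) cancel_inv:
  "x \<in> carrier G \<Longrightarrow> y \<in> carrier G \<Longrightarrow> inv x \<otimes> (x \<otimes> y) = y"
  "x \<in> carrier G \<Longrightarrow> y \<in> carrier G \<Longrightarrow> x \<otimes> (inv x \<otimes> y) = y"
  by (simp_all add: m_assoc[symmetric])

context
  fixes n :: nat
begin

interpretation group "GL n :: 'k::field mat monoid" by (rule group_GL)

abbreviation (input) mul :: "'k::field mat \<Rightarrow> 'k mat \<Rightarrow> 'k mat" (infixl "\<cdot>" 70) where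
  "x \<cdot> y \<equiv> x \<otimes>\<^bsub>GL n\<^esub> y"

abbreviation (input) inverse_mat :: "'k::field mat \<Rightarrow> 'k mat" where
  "inverse_mat x \<equiv> inv\<^bsub>GL n\<^esub> x"

abbreviation (input) comm :: "'k::field mat \<Rightarrow> 'k mat \<Rightarrow> 'k mat" where
  "comm a b \<equiv> a \<cdot> b \<cdot> inverse_mat a \<cdot> inverse_mat b"

lemma regular_map_comm:
  fixes a :: "'k::field mat"
  assumes a: "a \<in> carrier (GL n)"
  shows "regular_map n (carrier (GL n)) (\<lambda>b. comm a b)" "regular_map n (carrier (GL n)) (\<lambda>b. comm b a)"
proof -
  note invr = regular_map_inv[of n, where ?'k = 'k]
  have inv: "inverse_mat b \<in> carrier (GL n)" if "b \<in> carrier (GL n)" for b :: "'k mat"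
    using that by (rule inv_closed)
  show "regular_map n (carrier (GL n)) (\<lambda>b. comm a b)"
    by (intro regular_map_mult regular_map_const regular_map_id invr m_closed inv a)
  show "regular_map n (carrier (GL n)) (\<lambda>b. comm b a)"
    by (intro regular_map_mult regular_map_const regular_map_id invr m_closed inv a)
qed

text \<open>One argument at a time: with the first in \<open>D\<close>, the second may move to the
  closure; then the first moves as well, and closing twice adds nothing.\<close>

lemma zclosure_binary:
  fixes D :: "'k::field mat set"
  assumes D: "D \<subseteq> carrier (GL n)"
    and reg: "\<And>a. a \<in> carrier (GL n) \<Longrightarrow> regular_map n (carrier (GL n)) (m a)"
      "\<And>b. b \<in> carrier (GL n) \<Longrightarrow> regular_map n (carrier (GL n)) (\<lambda>a. m a b)"
    and closed: "\<And>a b. a \<in> carrier (GL n) \<Longrightarrow> b \<in> carrier (GL n) \<Longrightarrow> m a b \<in> carrier (GL n)"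
    and E: "\<And>a b. a \<in> D \<Longrightarrow> b \<in> D \<Longrightarrow> m a b \<in> E"
    and ab: "a \<in> zclosure n D" "b \<in> zclosure n D"
  shows "m a b \<in> zclosure n E"
proof -
  note sub = subsetD[OF zclosure_carrier]
  have 1: "m a' b \<in> zclosure n E" if a': "a' \<in> D" for a'
  proof (rule zclosure_image[OF _ _ D _ ab(2)])
    show "regular_map n (zclosure n D) (m a')"
      by (rule regular_map_subset[OF reg(1) zclosure_carrier]) (use a' D in blast)
  qed (use a' D E sub closed in blast)+
  have "m a b \<in> zclosure n (zclosure n E)"
  proof (rule zclosure_image[OF _ _ D _ ab(1), of "\<lambda>a. m a b"])
    show "regular_map n (zclosure n D) (\<lambda>a. m a b)"
      by (rule regular_map_subset[OF reg(2)[OF sub[OF ab(2)]] zclosure_carrier])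
  qed (use 1 sub closed ab in blast)+
  then show ?thesis by (simp only: zclosure_closed[OF closedin_zclosure])
qed

lemma subgroup_zclosure:
  fixes D :: "'k::field mat set"
  assumes D: "subgroup D (GL n)"
  shows "subgroup (zclosure n D) (GL n)"
proof (rule subgroupI)
  have DC: "D \<subseteq> carrier (GL n)" using D by (rule subgroup.subset)
  note sub = subsetD[OF zclosure_carrier]
  show "zclosure n D \<subseteq> carrier (GL n)" by (rule zclosure_carrier)
  show "zclosure n D \<noteq> {}" using subgroup.one_closed[OF D] zclosure_subset[OF DC] by blast
  show "inverse_mat a \<in> zclosure n D" if "a \<in> zclosure n D" for a
    by (rule zclosure_image[OF regular_map_subset[OF regular_map_inv zclosure_carrier] _ DC _ that])
       (use sub inv_closed subgroup.m_inv_closed[OF D] in blast)+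
  show "a \<cdot> b \<in> zclosure n D" if "a \<in> zclosure n D" "b \<in> zclosure n D" for a b
    by (rule zclosure_binary[OF DC _ _ _ _ that])
       (intro regular_map_left_mult regular_map_right_mult m_closed subgroup.m_closed[OF D]; assumption)+
qed

text \<open>The commutators form an irreducible set; the derived subgroup is the increasing union of its powers.\<close>

lemma irreducible_derived:
  fixes H :: "'k::field mat set"
  assumes H: "subgroup H (GL n)" and irr: "irreducible_set n H"
  shows "irreducible_set n (derived (GL n) H)"
proof -
  have HC: "H \<subseteq> carrier (GL n)" using H by (rule subgroup.subset)
  have HCD: "x \<in> carrier (GL n)" if "x \<in> H" for x using HC that by blast
  define S where "S = {comm a b | a b. a \<in> H \<and> b \<in> H}"
  \<comment> \<open>\<open>T k\<close> consists of the products of \<open>k + 1\<close> commutators,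
    whence the shifted index in \<open>T_mult\<close>.\<close>
  define T where "T = rec_nat S (\<lambda>_ X. {x \<cdot> y | x y. x \<in> X \<and> y \<in> S})"
  have T0: "T 0 = S" and TS: "T (Suc k) = {x \<cdot> y | x y. x \<in> T k \<and> y \<in> S}" for k
    by (simp_all add: T_def)
  have S_sub: "S \<subseteq> carrier (GL n)" unfolding S_def using HCD by auto
  have T_sub: "T k \<subseteq> carrier (GL n)" for k
  proof (induction k)
    case (Suc k)
    then show ?case unfolding TS using S_sub m_closed by blast
  qed (simp add: T0 S_sub)
  have irrS: "irreducible_set n S"
    unfolding S_def
    by (rule irreducible_set_binary_image[OF irr irr])
       (rule regular_map_subset[OF regular_map_comm(1) HC] regular_map_subset[OF regular_map_comm(2) HC], erule HCD)+
  have irrT: "irreducible_set n (T k)" for k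
  proof (induction k)
    case (Suc k)
    show ?case
      unfolding TS
    proof (rule irreducible_set_binary_image[OF Suc irrS])
      show "regular_map n S (\<lambda>y. x \<cdot> y)" if "x \<in> T k" for x
        by (rule regular_map_subset[OF regular_map_left_mult S_sub]) (use that T_sub in blast)
      show "regular_map n (T k) (\<lambda>x. x \<cdot> y)" if "y \<in> S" for y
        by (rule regular_map_subset[OF regular_map_right_mult T_sub]) (use that S_sub in blast)
    qed
  qed (simp add: T0 irrS)
  have one_H: "\<one>\<^bsub>GL n\<^esub> \<in> H" using H by (rule subgroup.one_closed)
  \<comment> \<open>Because the identity is a commutator, the sets \<open>T k\<close>
    increase.\<close>
  have oneS: "\<one>\<^bsub>GL n\<^esub> \<in> S"
    unfolding S_def using one_H by (intro CollectI exI[of _ "\<one>\<^bsub>GL n\<^esub>"] exI[of _ "\<one>\<^bsub>GL n\<^esub>"]) simp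
  have mono: "T k \<subseteq> T (Suc k)" for k
  proof
    fix x assume x: "x \<in> T k"
    then have "x = x \<cdot> \<one>\<^bsub>GL n\<^esub>" using T_sub[of k] by (simp add: subset_eq)
    then show "x \<in> T (Suc k)" unfolding TS using x oneS by blast
  qed
  have T_mult: "x \<cdot> y \<in> T (Suc (i + j))" if x: "x \<in> T i" and y: "y \<in> T j" for x y i j
    using y
  proof (induction j arbitrary: y)
    case 0
    then show ?case using x unfolding add_0_right TS T0 by blast
  next
    case (Suc j)
    then obtain u v where uv: "u \<in> T j" "v \<in> S" "y = u \<cdot> v" unfolding TS by blast
    have "x \<cdot> y = (x \<cdot> u) \<cdot> v" using uv x T_sub[of i] T_sub[of j] S_sub
      by (simp add: m_assoc subset_eq)
    then show ?case using Suc.IH[OF uv(1)] uv(2) unfolding add_Suc_right TS[of "Suc (i + j)"] by blast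
  qed
  have eq: "derived_set (GL n) H = S" unfolding S_def by blast
  have "derived (GL n) H = (\<Union>k. T k)"
  proof
    have S_T: "x \<in> (\<Union>k. T k)" if "x \<in> S" for x using that T0 by blast
    have "x \<in> (\<Union>k. T k)" if "x \<in> generate (GL n) S" for x
      using that
    proof induction
      case one
      show ?case by (rule S_T[OF oneS])
    next
      case (incl h)
      then show ?case by (rule S_T)
    next
      case (inv h)
      then obtain a b where ab: "a \<in> H" "b \<in> H" "h = comm a b" unfolding S_def by blast
      have "inverse_mat h = comm b a"
        using ab HCD by (simp add: inv_mult_group m_assoc)
      then show ?case using ab by (intro S_T) (auto simp: S_def)
    next
      case (eng h1 h2)
      then show ?case using T_mult by blast
    qed
    then show "derived (GL n) H \<subseteq> (\<Union>k. T k)" unfolding derived_def eq by blast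
    have "T k \<subseteq> generate (GL n) S" for k
    proof (induction k)
      case 0
      show ?case unfolding T0 by (auto intro: generate.incl)
    next
      case (Suc k)
      then show ?case unfolding TS by (auto intro: generate.incl generate.eng)
    qed
    then show "(\<Union>k. T k) \<subseteq> derived (GL n) H" unfolding derived_def eq by blast
  qed
  then show ?thesis using irreducible_set_Union[of n T, OF irrT mono] by simp
qed

end

section \<open>Twisted conjugacy\<close>

locale regular_group_endomorphism =
  fixes n :: nat and G :: "'k::alg_closed_field mat set" and \<phi> :: "'k mat \<Rightarrow> 'k mat"
  assumes G: "subgroup G (GL n)" and closed: "closedin (zariski n) G" and irr: "irreducible_set n G"
    and \<phi>_closed: "x \<in> G \<Longrightarrow> \<phi> x \<in> G"
    and \<phi>_mult: "x \<in> G \<Longrightarrow> y \<in> G \<Longrightarrow> \<phi> (x \<otimes>\<^bsub>GL n\<^esub> y) = \<phi> x \<otimes>\<^bsub>GL n\<^esub> \<phi> y"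
    and \<phi>_reg: "regular_map n G \<phi>"
begin

sublocale group "GL n :: 'k mat monoid" by (rule group_GL)

abbreviation mul (infixl "\<cdot>" 70) where "x \<cdot> y \<equiv> x \<otimes>\<^bsub>GL n\<^esub> y"
abbreviation inverse_mat where "inverse_mat x \<equiv> inv\<^bsub>GL n\<^esub> x"
text \<open>The map c of the overview; its image is the twisted orbit of the identity.\<close>

abbreviation displacement where "displacement x \<equiv> x \<cdot> inverse_mat (\<phi> x)"

lemma GC: "x \<in> G \<Longrightarrow> x \<in> carrier (GL n)"
  using subgroup.subset[OF G] by blast

lemmas G_mult = subgroup.m_closed[OF G] and G_inv = subgroup.m_inv_closed[OF G]
  and G_one = subgroup.one_closed[OF G]

lemma \<phi>_one: "\<phi> \<one>\<^bsub>GL n\<^esub> = \<one>\<^bsub>GL n\<^esub>"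
  using \<phi>_mult[OF G_one G_one] GC[OF \<phi>_closed[OF G_one]] by simp

lemma \<phi>_inv:
  assumes x: "x \<in> G"
  shows "\<phi> (inverse_mat x) = inverse_mat (\<phi> x)"
proof (rule inv_equality[symmetric])
  show "\<phi> (inverse_mat x) \<cdot> \<phi> x = \<one>\<^bsub>GL n\<^esub>"
    using \<phi>_mult[OF G_inv[OF x] x] GC[OF x] by (simp add: \<phi>_one)
qed (use x in \<open>simp_all add: GC \<phi>_closed G_inv\<close>)

lemma regular_map_displacement:
  assumes "S \<subseteq> G"
  shows "regular_map n S displacement"
proof (rule regular_map_mult)
  show "regular_map n S (\<lambda>x. inverse_mat (\<phi> x))"
    by (rule regular_map_comp[OF regular_map_subset[OF \<phi>_reg assms] regular_map_inv])
       (use assms in \<open>auto intro: GC \<phi>_closed\<close>)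
qed (use assms in \<open>auto intro: GC \<phi>_closed G_inv regular_map_id\<close>)

definition fixed_points where "fixed_points = {x \<in> G. \<phi> x = x}"

text \<open>Moving factors across turns equality of displacements into \<phi> fixing the quotient;
  the fibres are therefore left cosets of the fixed points.\<close>

lemma displacement_eq_iff:
  assumes x: "x \<in> G" and y: "y \<in> G"
  shows "displacement y = displacement x \<longleftrightarrow> inverse_mat x \<cdot> y \<in> fixed_points"
proof -
  have c: "x \<in> carrier (GL n)" "y \<in> carrier (GL n)" "\<phi> x \<in> carrier (GL n)" "\<phi> y \<in> carrier (GL n)"
    using x y by (auto intro: GC \<phi>_closed)
  have "displacement y = displacement x \<longleftrightarrow> inverse_mat x \<cdot> y = inverse_mat (\<phi> x) \<cdot> \<phi> y"
  proof
    assume "displacement y = displacement x"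
    from arg_cong[OF this, of "\<lambda>w. inverse_mat x \<cdot> w \<cdot> \<phi> y"]
    show "inverse_mat x \<cdot> y = inverse_mat (\<phi> x) \<cdot> \<phi> y" using c by (simp add: m_assoc cancel_inv)
  next
    assume "inverse_mat x \<cdot> y = inverse_mat (\<phi> x) \<cdot> \<phi> y"
    from arg_cong[OF this, of "\<lambda>w. x \<cdot> w \<cdot> inverse_mat (\<phi> y)"]
    show "displacement y = displacement x" using c by (simp add: m_assoc cancel_inv)
  qed
  also have "\<dots> \<longleftrightarrow> inverse_mat x \<cdot> y = \<phi> (inverse_mat x \<cdot> y)"
    using \<phi>_mult[OF G_inv[OF x] y] \<phi>_inv[OF x] by simp
  finally show ?thesis using x y G_mult G_inv by (auto simp: fixed_points_def)
qed

text \<open>Density provides one finite fibre, and that fibre contains a translate of the fixed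
  points.\<close>

lemma finite_fixed_points:
  assumes dense: "\<forall>f\<in>regular_fun n. (\<forall>y\<in>G. f (displacement y) = 0) \<longrightarrow> (\<forall>x\<in>G. f x = 0)"
  shows "finite fixed_points"
proof -
  have "\<exists>x\<in>G. finite {y \<in> G. displacement y = displacement x}"
  proof (rule finite_fibre_of_dense[OF closed irr regular_map_displacement[OF order_refl]])
    show "displacement x \<in> G" if "x \<in> G" for x using that G_mult G_inv \<phi>_closed by blast
    fix f x assume f: "f \<in> regular_fun n" "\<forall>y\<in>G. f (displacement y) = 0" and x: "x \<in> G"
    show "f x = 0" by (rule bspec[OF mp[OF bspec[OF dense f(1)] f(2)] x])
  qed
  then obtain x where x: "x \<in> G" "finite {y \<in> G. displacement y = displacement x}" by blast
  have "(\<lambda>z. x \<cdot> z) ` fixed_points \<subseteq> {y \<in> G. displacement y = displacement x}"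
  proof (rule image_subsetI)
    fix z assume z: "z \<in> fixed_points"
    then have zG: "z \<in> G" by (simp add: fixed_points_def)
    have "displacement (x \<cdot> z) = displacement x"
      using displacement_eq_iff[OF x(1) G_mult[OF x(1) zG]] z cancel_inv(1)[OF GC[OF x(1)] GC[OF zG]] by simp
    then show "x \<cdot> z \<in> {y \<in> G. displacement y = displacement x}" using G_mult[OF x(1) zG] by blast
  qed
  then have "finite ((\<lambda>z. x \<cdot> z) ` fixed_points)" using x(2) by (rule finite_subset)
  moreover have "inj_on (\<lambda>z. x \<cdot> z) fixed_points"
  proof (rule inj_onI)
    fix y z assume "y \<in> fixed_points" "z \<in> fixed_points" and eq: "x \<cdot> y = x \<cdot> z"
    then have "y \<in> carrier (GL n)" "z \<in> carrier (GL n)" using GC by (simp_all add: fixed_points_def)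
    then show "y = z" using arg_cong[OF eq, of "\<lambda>w. inverse_mat x \<cdot> w"] GC[OF x(1)] by (simp add: cancel_inv)
  qed
  ultimately show ?thesis by (rule finite_imageD)
qed

text \<open>On a closed irreducible stable subgroup \<open>N\<close> the displacement again has finite fibres, so its image contains a
  nonempty open subset \<open>U\<close> of \<open>N\<close>; as \<open>N\<close> is irreducible, \<open>U\<close> and \<open>x U\<^sup>-\<^sup>1\<close> meet for every \<open>x\<close> in \<open>N\<close>.\<close>

lemma product_of_displacements:
  assumes fin: "finite fixed_points" and N: "subgroup N (GL n)" "N \<subseteq> G" "closedin (zariski n) N" "irreducible_set n N"
    and stable: "\<And>x. x \<in> N \<Longrightarrow> \<phi> x \<in> N" and x: "x \<in> N"
  shows "\<exists>g\<in>N. \<exists>h\<in>N. x = displacement g \<cdot> displacement h"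
proof -
  have NG: "y \<in> G" "y \<in> carrier (GL n)" if "y \<in> N" for y using that N(2) GC by blast+
  note N_mult = subgroup.m_closed[OF N(1)] and N_inv = subgroup.m_inv_closed[OF N(1)]
  have disp: "displacement y \<in> N" if "y \<in> N" for y using that N_mult N_inv stable by blast
  \<comment> \<open>A fibre in \<open>N\<close> lies in a coset of the fixed points of all of
    \<open>G\<close>, whose finiteness is given.\<close>
  have "finite {z \<in> N. displacement z = displacement y}" if y: "y \<in> N" for y
  proof (rule finite_subset[OF _ finite_imageI[OF fin, of "\<lambda>z. y \<cdot> z"]], rule subsetI)
    fix z assume z: "z \<in> {z \<in> N. displacement z = displacement y}"
    then have zN: "z \<in> N" and "displacement z = displacement y" by simp_all
    then have "inverse_mat y \<cdot> z \<in> fixed_points" using displacement_eq_iff NG y by blast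
    moreover have "z = y \<cdot> (inverse_mat y \<cdot> z)" using cancel_inv(2)[OF NG(2)[OF y] NG(2)[OF zN]] by simp
    ultimately show "z \<in> (\<lambda>z. y \<cdot> z) ` fixed_points" by (rule image_eqI[rotated])
  qed
  from image_contains_open_of_finite_fibres[OF N(3,4) regular_map_displacement[OF N(2)] disp this]
  obtain b where b: "b \<in> regular_fun n" "\<exists>y\<in>N. b y \<noteq> 0" "\<And>y. y \<in> N \<Longrightarrow> b y \<noteq> 0 \<Longrightarrow> y \<in> displacement ` N"
    by blast
  obtain w where w: "w \<in> N" "b w \<noteq> 0" using b(2) by blast
  have reg: "regular_map n N (\<lambda>u. inverse_mat u \<cdot> x)"
    by (rule regular_map_comp[OF regular_map_subset[OF regular_map_inv] regular_map_right_mult[OF NG(2)[OF x]]])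
       (use NG in auto)
  have "\<exists>u\<in>N. b u \<noteq> 0 \<and> b (inverse_mat u \<cdot> x) \<noteq> 0"
  proof (rule irreducible_setD[OF N(4) regular_onI[OF b(1)] regular_mapD[OF reg b(1)] b(2)])
    \<comment> \<open>The witness is solved for: at \<open>x \<cdot> inverse_mat w\<close> the
      second function takes the value \<open>b w\<close>.\<close>
    have "inverse_mat (x \<cdot> inverse_mat w) \<cdot> x = w"
      using NG(2)[OF x] NG(2)[OF w(1)] by (simp add: inv_mult_group m_assoc)
    then show "\<exists>u\<in>N. b (inverse_mat u \<cdot> x) \<noteq> 0"
      using w x N_mult N_inv by (intro bexI[of _ "x \<cdot> inverse_mat w"]) simp_all
  qed
  then obtain u where u: "u \<in> N" "b u \<noteq> 0" "b (inverse_mat u \<cdot> x) \<noteq> 0" by blast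
  have "u \<in> displacement ` N" using b(3) u by blast
  moreover have "inverse_mat u \<cdot> x \<in> displacement ` N" using b(3) u x N_mult N_inv by blast
  ultimately obtain g h where gh: "g \<in> N" "u = displacement g" "h \<in> N" "inverse_mat u \<cdot> x = displacement h" by blast
  have "displacement g \<cdot> displacement h = u \<cdot> (inverse_mat u \<cdot> x)"
    unfolding gh(2)[symmetric] gh(4)[symmetric] ..
  also have "\<dots> = x" using cancel_inv(2)[OF NG(2)[OF u(1)] NG(2)[OF x]] .
  finally show ?thesis by (intro bexI[OF _ gh(1)] bexI[OF _ gh(3)]) (rule sym)
qed

text \<open>A cocycle identity: passing from \<open>h\<close> to \<open>g \<cdot> h\<close> applies
  twisted conjugation by \<open>g\<close> to the displacement of \<open>h\<close>.\<close>

lemma displacement_mult: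
  assumes g: "g \<in> G" and h: "h \<in> G"
  shows "displacement (g \<cdot> h) = g \<cdot> displacement h \<cdot> inverse_mat (\<phi> g)"
proof -
  have "g \<in> carrier (GL n)" "h \<in> carrier (GL n)" "\<phi> g \<in> carrier (GL n)" "\<phi> h \<in> carrier (GL n)"
    using g h by (auto intro: GC \<phi>_closed)
  then show ?thesis using \<phi>_mult[OF g h] by (simp add: inv_mult_group m_assoc)
qed

text \<open>Modulo \<open>M\<close> the elements of \<open>N\<close> commute and the displacement is
  multiplicative, so \<open>x\<close> is a displacement up to a factor in \<open>M\<close>;
  surjectivity on \<open>M\<close> absorbs that factor.\<close>

lemma displacement_surjective_step:
  assumes fin: "finite fixed_points" and N: "subgroup N (GL n)" "N \<subseteq> G" "closedin (zariski n) N" "irreducible_set n N"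
    and stable: "\<And>x. x \<in> N \<Longrightarrow> \<phi> x \<in> N"
    and M: "subgroup M (GL n)" "M \<subseteq> N"
    and comm: "\<And>a b. a \<in> N \<Longrightarrow> b \<in> N \<Longrightarrow> a \<cdot> b \<cdot> inverse_mat a \<cdot> inverse_mat b \<in> M"
    and surj: "M \<subseteq> displacement ` M"
  shows "N \<subseteq> displacement ` N"
proof
  fix x assume x: "x \<in> N"
  obtain g h where gh: "g \<in> N" "h \<in> N" "x = displacement g \<cdot> displacement h"
    using product_of_displacements[OF fin N stable x] by blast
  have NG: "y \<in> G" "y \<in> carrier (GL n)" if "y \<in> N" for y using that N(2) GC by blast+
  have MC: "y \<in> carrier (GL n)" if "y \<in> M" for y using that M(2) NG by blast
  note N_mult = subgroup.m_closed[OF N(1)] and N_inv = subgroup.m_inv_closed[OF N(1)]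
  define a where "a = inverse_mat (\<phi> g)"
  define b where "b = displacement h"
  have ab: "a \<in> N" "b \<in> N" unfolding a_def b_def using gh N_mult N_inv stable by blast+
  note C = NG(2)[OF ab(1)] NG(2)[OF ab(2)] NG(2)[OF gh(1)] NG(2)[OF gh(2)] NG(2)[OF stable[OF gh(1)]]
  \<comment> \<open>\<open>x\<close> agrees with the displacement of \<open>g h\<close> up to the commutator of \<open>a\<close> and \<open>b\<close>.\<close>
  have x1: "x = displacement (g \<cdot> h) \<cdot> (inverse_mat a \<cdot> inverse_mat b \<cdot> a \<cdot> b)"
    unfolding displacement_mult[OF NG(1)[OF gh(1)] NG(1)[OF gh(2)]] gh(3)
    unfolding a_def[symmetric] b_def[symmetric] using C by (simp add: m_assoc cancel_inv)
  define k where "k = g \<cdot> h"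
  define y where "y = inverse_mat a \<cdot> inverse_mat b \<cdot> a \<cdot> b"
  have k: "k \<in> N" unfolding k_def using gh N_mult by blast
  have y: "y \<in> M"
    unfolding y_def using comm[OF N_inv[OF ab(1)] N_inv[OF ab(2)]] C by simp
  have pk: "\<phi> k \<in> N" using stable k by blast
  note C' = NG(2)[OF k] NG(2)[OF pk] MC[OF y]
  \<comment> \<open>Chosen so that \<open>displacement (k \<cdot> u)\<close> becomes
    \<open>displacement k \<cdot> y\<close> once \<open>displacement u = z\<close>. It lies in
    \<open>M\<close> because it differs from \<open>y\<close> by a commutator of elements of
    \<open>N\<close>.\<close>
  define z where "z = inverse_mat (\<phi> k) \<cdot> y \<cdot> \<phi> k"
  have "inverse_mat (\<phi> k) \<cdot> y \<cdot> inverse_mat (inverse_mat (\<phi> k)) \<cdot> inverse_mat y \<in> M"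
    using comm[OF N_inv[OF pk]] y M(2) by blast
  then have "inverse_mat (\<phi> k) \<cdot> y \<cdot> inverse_mat (inverse_mat (\<phi> k)) \<cdot> inverse_mat y \<cdot> y \<in> M"
    using y subgroup.m_closed[OF M(1)] by blast
  then have "z \<in> M" unfolding z_def using C' by (simp add: m_assoc)
  then obtain u where u: "u \<in> M" "z = displacement u" using surj by blast
  have "displacement (k \<cdot> u) = k \<cdot> z \<cdot> inverse_mat (\<phi> k)"
    using displacement_mult[of k u] k u M(2) NG(1) by auto
  also have "\<dots> = displacement k \<cdot> y" unfolding z_def using C' by (simp add: m_assoc cancel_inv)
  finally have "x = displacement (k \<cdot> u)" using x1 unfolding k_def y_def by simp
  moreover have "k \<cdot> u \<in> N" using k u(1) M(2) N_mult by blast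
  ultimately show "x \<in> displacement ` N" by (rule image_eqI)
qed

lemma derived_stable:
  assumes D: "subgroup D (GL n)" "D \<subseteq> G" and stable: "\<And>x. x \<in> D \<Longrightarrow> \<phi> x \<in> D"
    and x: "x \<in> derived (GL n) D"
  shows "\<phi> x \<in> derived (GL n) D"
proof -
  have DG: "derived (GL n) D \<subseteq> G" using derived_incl[OF order_refl D(1)] D(2) by blast
  have gen: "derived_set (GL n) D \<subseteq> G" using derived_set_incl[OF order_refl D(1)] D(2) by blast
  have step: "\<phi> h \<in> derived_set (GL n) D" if "h \<in> derived_set (GL n) D" for h
  proof -
    obtain a b where ab: "a \<in> D" "b \<in> D" "h = a \<cdot> b \<cdot> inverse_mat a \<cdot> inverse_mat b" using \<open>h \<in> _\<close> by blast
    have abG: "a \<in> G" "b \<in> G" using ab D(2) by auto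
    have "\<phi> h = \<phi> a \<cdot> \<phi> b \<cdot> inverse_mat (\<phi> a) \<cdot> inverse_mat (\<phi> b)"
      unfolding ab(3) using abG by (simp add: \<phi>_mult \<phi>_inv G_mult G_inv)
    then show ?thesis using stable ab(1,2) by blast
  qed
  have "\<phi> x \<in> generate (GL n) (derived_set (GL n) D)" if "x \<in> generate (GL n) (derived_set (GL n) D)"
    using that
  proof induction
    case one
    show ?case unfolding \<phi>_one by (rule generate.one)
  next
    case (incl h)
    then show ?case by (intro generate.incl step)
  next
    case (inv h)
    have "h \<in> G" using inv gen by blast
    then show ?case unfolding \<phi>_inv[OF \<open>h \<in> G\<close>] by (intro generate.inv step inv)
  next
    case (eng h1 h2)
    have "h1 \<in> G" "h2 \<in> G" using eng(1,2) DG unfolding derived_def by blast+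
    then show ?case unfolding \<phi>_mult[OF \<open>h1 \<in> G\<close> \<open>h2 \<in> G\<close>] by (intro generate.eng eng.IH)
  qed
  then show ?thesis using x unfolding derived_def by blast
qed

theorem displacement_surjective:
  assumes dense: "\<forall>f\<in>regular_fun n. (\<forall>y\<in>G. f (displacement y) = 0) \<longrightarrow> (\<forall>x\<in>G. f x = 0)"
    and solvable: "(derived (GL n) ^^ d) G = {\<one>\<^bsub>GL n\<^esub>}"
  shows "G \<subseteq> displacement ` G"
proof -
  define D where "D i = (derived (GL n) ^^ i) G" for i
  \<comment> \<open>Closures make the terms affine varieties, while commutators of elements of
    \<open>N i\<close> still fall into \<open>N (Suc i)\<close>.\<close>
  define N where "N i = zclosure n (D i)" for i
  have DS: "D (Suc i) = derived (GL n) (D i)" for i by (simp add: D_def)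
  have D: "subgroup (D i) (GL n) \<and> D i \<subseteq> G \<and> irreducible_set n (D i) \<and> (\<forall>x\<in>D i. \<phi> x \<in> D i)" for i
  proof (induction i)
    case 0
    show ?case using G irr \<phi>_closed by (simp add: D_def)
  next
    case (Suc i)
    then have IH: "subgroup (D i) (GL n)" "D i \<subseteq> G" "irreducible_set n (D i)" "\<And>x. x \<in> D i \<Longrightarrow> \<phi> x \<in> D i"
      by blast+
    show ?case
      unfolding DS
    proof (intro conjI ballI)
      show "subgroup (derived (GL n) (D i)) (GL n)" by (rule derived_is_subgroup[OF subgroup.subset[OF IH(1)]])
      show "derived (GL n) (D i) \<subseteq> G" using derived_incl[OF order_refl IH(1)] IH(2) by blast
      show "irreducible_set n (derived (GL n) (D i))" by (rule irreducible_derived[OF IH(1,3)])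
      show "\<phi> x \<in> derived (GL n) (D i)" if "x \<in> derived (GL n) (D i)" for x
        by (rule derived_stable[OF IH(1,2,4) that])
    qed
  qed
  have DC: "D i \<subseteq> carrier (GL n)" for i using D[of i] subgroup.subset by blast
  have N_sub: "subgroup (N i) (GL n)" for i unfolding N_def using D[of i] subgroup_zclosure by blast
  have NG: "N i \<subseteq> G" for i unfolding N_def using D[of i] zclosure_minimal[OF closed] by blast
  have N_stable: "\<phi> x \<in> N i" if "x \<in> N i" for i x
    unfolding N_def
  proof (rule zclosure_image[OF _ _ DC _ that[unfolded N_def]])
    show "regular_map n (zclosure n (D i)) \<phi>"
      by (rule regular_map_subset[OF \<phi>_reg NG[of i, unfolded N_def]])
  qed (use D[of i] NG[of i] \<phi>_closed GC in \<open>unfold N_def, blast+\<close>)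
  have N_Suc: "N (Suc i) \<subseteq> N i" for i
  proof -
    have "D (Suc i) \<subseteq> D i" unfolding DS using derived_incl[OF order_refl] D[of i] by blast
    then show ?thesis unfolding N_def
      using zclosure_minimal[OF closedin_zclosure] zclosure_subset[OF DC[of i]] by blast
  qed
  have N_comm: "a \<cdot> b \<cdot> inverse_mat a \<cdot> inverse_mat b \<in> N (Suc i)" if "a \<in> N i" "b \<in> N i" for a b i
    unfolding N_def
  proof (rule zclosure_binary[OF DC[of i] _ _ _ _ that[unfolded N_def]])
    show "a \<cdot> b \<cdot> inverse_mat a \<cdot> inverse_mat b \<in> D (Suc i)" if "a \<in> D i" "b \<in> D i" for a b
      unfolding DS derived_def using that by (intro generate.incl) blast
  qed (use regular_map_comm in \<open>simp_all\<close>)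
  have fin: "finite fixed_points" by (rule finite_fixed_points[OF dense])
  have "N d \<subseteq> displacement ` N d"
  proof -
    have Dd: "D d = {\<one>\<^bsub>GL n\<^esub>}" using solvable by (simp add: D_def)
    \<comment> \<open>A single matrix is closed: each entry minus its prescribed value is a regular
      function.\<close>
    have "x = \<one>\<^bsub>GL n\<^esub>" if x: "x \<in> N d" for x
    proof -
      have xC: "x \<in> carrier_mat n n" using x NG GC carrier_GL by blast
      have "x $$ (i, j) = 1\<^sub>m n $$ (i, j)" if ij: "i < n" "j < n" for i j
      proof -
        have "(\<lambda>A. A $$ (i, j) + - (1\<^sub>m n $$ (i, j))) \<in> regular_fun n"
          by (intro regular_fun.add regular_fun.entry regular_fun.const ij)
        from zclosureD[OF x[unfolded N_def] this] show ?thesis by (simp add: Dd one_GL)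
      qed
      then show ?thesis unfolding one_GL using xC by (intro eq_matI) auto
    qed
    moreover have "\<one>\<^bsub>GL n\<^esub> \<in> N d" using N_sub by (rule subgroup.one_closed)
    moreover have "displacement \<one>\<^bsub>GL n\<^esub> = \<one>\<^bsub>GL n\<^esub>" by (simp add: \<phi>_one)
    ultimately show ?thesis
    proof (intro subsetI)
      fix x assume "x \<in> N d"
      then have "x = \<one>\<^bsub>GL n\<^esub>" by fact
      then show "x \<in> displacement ` N d"
        using \<open>\<one>\<^bsub>GL n\<^esub> \<in> N d\<close> \<open>displacement \<one>\<^bsub>GL n\<^esub> = \<one>\<^bsub>GL n\<^esub>\<close>
        by (intro image_eqI[where x = "\<one>\<^bsub>GL n\<^esub>"]) simp_all
    qed
  qed
  \<comment> \<open>Descent from \<open>N d\<close>; subtraction is truncated, so once the index has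
    reached 0 the step is trivial.\<close>
  then have "N (d - j) \<subseteq> displacement ` N (d - j)" for j
  proof (induction j)
    case (Suc j)
    show ?case
    proof (cases "d - j = 0")
      case True
      then show ?thesis using Suc by simp
    next
      case False
      then have eq: "d - j = Suc (d - Suc j)" by simp
      have irrN: "irreducible_set n (N (d - Suc j))"
        unfolding N_def using irreducible_set_zclosure[OF _ DC] D by blast
      have clN: "closedin (zariski n) (N (d - Suc j))" unfolding N_def by (rule closedin_zclosure)
      show ?thesis
        by (rule displacement_surjective_step[OF fin N_sub NG clN irrN N_stable N_sub N_Suc N_comm Suc.IH[OF Suc.prems, unfolded eq]])
    qed
  qed simp
  from this[of d] have "N 0 \<subseteq> displacement ` N 0" by simp
  moreover have "N 0 = G" unfolding N_def D_def using zclosure_closed[OF closed] by simp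
  ultimately show ?thesis by simp
qed

end

text \<open>Functions vanishing on the single members are multiplied, and irreducibility keeps the
  product nonzero on \<open>G\<close>. Hence finitely many orbits that cover \<open>G\<close> cannot
  all fail to be dense.\<close>

lemma irreducible_finite_cover:
  assumes irr: "irreducible_set n G" and fin: "finite \<O>"
    and proper: "\<And>S. S \<in> \<O> \<Longrightarrow> \<exists>f\<in>regular_fun n. (\<forall>A\<in>S. f A = 0) \<and> (\<exists>A\<in>G. f A \<noteq> 0)"
  shows "\<exists>f\<in>regular_fun n. (\<forall>A\<in>\<Union>\<O>. f A = 0) \<and> (\<exists>A\<in>G. f A \<noteq> 0)"
  using fin proper
proof (induction \<O> rule: finite_induct)
  case empty
  have "G \<noteq> {}" using irr unfolding irreducible_set_def by (rule conjunct1)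
  then show ?case by (intro bexI[OF _ regular_fun.const[of 1]]) auto
next
  case (insert S \<O>)
  have "\<exists>f\<in>regular_fun n. (\<forall>A\<in>\<Union>\<O>. f A = 0) \<and> (\<exists>A\<in>G. f A \<noteq> 0)"
    by (rule insert.IH) (rule insert.prems[OF insertI2])
  then obtain f where f: "f \<in> regular_fun n" "\<forall>A\<in>\<Union>\<O>. f A = 0" "\<exists>A\<in>G. f A \<noteq> 0"
    by - (erule bexE, (erule conjE)+, rule that)
  obtain g where g: "g \<in> regular_fun n" "\<forall>A\<in>S. g A = 0" "\<exists>A\<in>G. g A \<noteq> 0"
    using insert.prems[OF insertI1] by - (erule bexE, (erule conjE)+, rule that)
  have "\<exists>A\<in>G. f A \<noteq> 0 \<and> g A \<noteq> 0"
    by (rule irreducible_setD[OF irr regular_onI[OF f(1)] regular_onI[OF g(1)] f(3) g(3)])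
  then have "\<exists>A\<in>G. f A * g A \<noteq> 0" by auto
  moreover have "\<forall>A\<in>\<Union>(insert S \<O>). f A * g A = 0" using f(2) g(2) by (auto elim: bspec)
  ultimately show ?case by (intro bexI[OF _ regular_fun.mult[OF f(1) g(1)]] conjI)
qed

text \<open>Solvability speaks of commutators formed in the subgroup as a group of its own; this
  moves the series into the ambient group, where closures are taken.\<close>

lemma (in group) exp_of_derived_consistent:
  assumes "subgroup H G"
  shows "(derived (G\<lparr>carrier := H\<rparr>) ^^ m) H = (derived G ^^ m) H"
proof (induction m)
  case (Suc m)
  have "(derived G ^^ j) H \<subseteq> H" for j
  proof (induction j)
    case (Suc j)
    show ?case using derived_incl[OF Suc assms] by simp
  qed simp
  from derived_consistent[OF this[of m] assms] show ?case using Suc by simp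
qed simp

theorem theorem2p4:
  fixes n :: nat and G :: "'k::alg_closed_field mat set" and \<phi> :: "'k mat \<Rightarrow> 'k mat"
  assumes "algebraic_group n G"
    and "connectedin (zariski n) G"
    and "solvable (GL n\<lparr>carrier := G\<rparr>)"
    and "\<phi> \<in> Aut_alg n G"
  shows "Reidemeister_number (GL n\<lparr>carrier := G\<rparr>) \<phi> \<in> {1, \<infinity>} \<and>
    (transitive_action (GL n\<lparr>carrier := G\<rparr>) G (twisted_conj (GL n\<lparr>carrier := G\<rparr>) \<phi>) \<or>
     infinite (orbits (GL n\<lparr>carrier := G\<rparr>) G (twisted_conj (GL n\<lparr>carrier := G\<rparr>) \<phi>)))"
proof -
  let ?\<Gamma> = "GL n :: 'k mat monoid"
  let ?G = "?\<Gamma>\<lparr>carrier := G\<rparr>"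
  let ?t = "twisted_conj ?G \<phi>"
  interpret group ?\<Gamma> by (rule group_GL)
  have G: "subgroup G ?\<Gamma>" and closed: "closedin (zariski n) G"
    using assms(1) by (auto simp: algebraic_group_def)
  have grpG: "group ?G" by (rule subgroup.subgroup_is_group[OF G group_GL])
  have irr: "irreducible_set n G" by (rule irreducible_of_connected[OF G closed assms(2)])
  have GC: "x \<in> carrier ?\<Gamma>" if "x \<in> G" for x using subgroup.subset[OF G] that by blast
  note G_mult = subgroup.m_closed[OF G] and G_inv = subgroup.m_inv_closed[OF G]
  have "\<phi> \<in> auto ?G" and mor: "variety_morphism n G n G \<phi>" using assms(4) unfolding Aut_alg_def by simp_all
  then have hom: "\<phi> \<in> hom ?G ?G" unfolding auto_def by simp
  have \<phi>_reg: "regular_map n G \<phi>"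
    using mor unfolding variety_morphism_def regular_map_def regular_on_def by (rule conjunct2)
  have \<phi>_closed: "\<phi> x \<in> G" if "x \<in> G" for x using hom that unfolding hom_def by auto
  have \<phi>_mult: "\<phi> (x \<otimes>\<^bsub>?\<Gamma>\<^esub> y) = \<phi> x \<otimes>\<^bsub>?\<Gamma>\<^esub> \<phi> y" if "x \<in> G" "y \<in> G" for x y
    using hom_mult[OF hom] that by simp
  interpret id: regular_group_endomorphism n G \<phi>
    by (rule regular_group_endomorphism.intro[OF G closed irr \<phi>_closed \<phi>_mult \<phi>_reg])
  have t: "?t g x = g \<otimes>\<^bsub>?\<Gamma>\<^esub> x \<otimes>\<^bsub>?\<Gamma>\<^esub> inv\<^bsub>?\<Gamma>\<^esub> (\<phi> g)" if "g \<in> G" "x \<in> G" for g x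
    using that id.\<phi>_inv m_inv_consistent[OF G] by (simp add: twisted_conj_def)
  interpret act: group_action ?G G ?t
    using group_action_twisted_conj[OF grpG hom] by simp
  obtain d where d: "(derived ?\<Gamma> ^^ d) G = {\<one>\<^bsub>?\<Gamma>\<^esub>}"
    using group.solvable_imp_trivial_derived_seq[OF grpG assms(3)[unfolded solvable_def]]
      exp_of_derived_consistent[OF G] by auto
  have trans: "transitive_action ?G G ?t" if fin: "finite (orbits ?G G ?t)"
  proof -
    \<comment> \<open>One orbit is dense: otherwise finitely many proper closed subsets would cover
      the irreducible \<open>G\<close>.\<close>
    have "\<exists>x\<in>G. \<forall>f\<in>regular_fun n. (\<forall>A\<in>orbit ?G ?t x. f A = 0) \<longrightarrow> (\<forall>A\<in>G. f A = 0)"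
    proof (rule ccontr)
      assume neg: "\<not> ?thesis"
      have "\<exists>f\<in>regular_fun n. (\<forall>A\<in>\<Union>(orbits ?G G ?t). f A = 0) \<and> (\<exists>A\<in>G. f A \<noteq> 0)"
      proof (rule irreducible_finite_cover[OF irr fin])
        fix S assume "S \<in> orbits ?G G ?t"
        then obtain x where x: "x \<in> G" "S = orbit ?G ?t x" unfolding orbits_def by blast
        have "\<not> (\<forall>f\<in>regular_fun n. (\<forall>A\<in>S. f A = 0) \<longrightarrow> (\<forall>A\<in>G. f A = 0))"
          using neg x by blast
        then show "\<exists>f\<in>regular_fun n. (\<forall>A\<in>S. f A = 0) \<and> (\<exists>A\<in>G. f A \<noteq> 0)" by blast
      qed
      then show False unfolding act.orbits_coverture by blast
    qed
    then obtain x where x: "x \<in> G" and dense: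
      "\<forall>f\<in>regular_fun n. (\<forall>A\<in>orbit ?G ?t x. f A = 0) \<longrightarrow> (\<forall>A\<in>G. f A = 0)" by (elim bexE)
    \<comment> \<open>Right translation by \<open>x\<close> turns the orbits of \<open>\<psi>\<close> into those of \<open>\<phi>\<close>.\<close>
    define \<psi> where "\<psi> g = x \<otimes>\<^bsub>?\<Gamma>\<^esub> \<phi> g \<otimes>\<^bsub>?\<Gamma>\<^esub> inv\<^bsub>?\<Gamma>\<^esub> x" for g
    note xC = GC[OF x]
    interpret \<psi>: regular_group_endomorphism n G \<psi>
    proof (rule regular_group_endomorphism.intro[OF G closed irr])
      show "\<psi> g \<in> G" if "g \<in> G" for g unfolding \<psi>_def by (intro G_mult G_inv \<phi>_closed x that)
      show "\<psi> (g \<otimes>\<^bsub>?\<Gamma>\<^esub> h) = \<psi> g \<otimes>\<^bsub>?\<Gamma>\<^esub> \<psi> h" if "g \<in> G" "h \<in> G" for g h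
        unfolding \<psi>_def \<phi>_mult[OF that]
        using xC GC[OF \<phi>_closed[OF that(1)]] GC[OF \<phi>_closed[OF that(2)]] by (simp add: m_assoc cancel_inv)
      have "regular_map n G (\<lambda>g. (x \<otimes>\<^bsub>?\<Gamma>\<^esub> \<phi> g) \<otimes>\<^bsub>?\<Gamma>\<^esub> inv\<^bsub>?\<Gamma>\<^esub> x)"
        by (intro regular_map_mult regular_map_const \<phi>_reg m_closed inv_closed xC GC \<phi>_closed)
      then show "regular_map n G \<psi>" unfolding \<psi>_def .
    qed
    have disp: "g \<otimes>\<^bsub>?\<Gamma>\<^esub> inv\<^bsub>?\<Gamma>\<^esub> (\<psi> g) = ?t g x \<otimes>\<^bsub>?\<Gamma>\<^esub> inv\<^bsub>?\<Gamma>\<^esub> x" if g: "g \<in> G" for g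
      unfolding t[OF g x] \<psi>_def
      using xC GC[OF g] GC[OF \<phi>_closed[OF g]] by (simp add: inv_mult_group m_assoc)
    have tG: "?t g x \<in> G" if "g \<in> G" for g
      unfolding t[OF that x] by (intro G_mult G_inv \<phi>_closed x that)
    \<comment> \<open>Density of the orbit is transported by right translation to density of the
      displacements of \<psi>.\<close>
    have "\<forall>f\<in>regular_fun n. (\<forall>g\<in>G. f (g \<otimes>\<^bsub>?\<Gamma>\<^esub> inv\<^bsub>?\<Gamma>\<^esub> (\<psi> g)) = 0) \<longrightarrow> (\<forall>y\<in>G. f y = 0)"
    proof (intro ballI impI)
      fix f y assume f: "f \<in> regular_fun n" "\<forall>g\<in>G. f (g \<otimes>\<^bsub>?\<Gamma>\<^esub> inv\<^bsub>?\<Gamma>\<^esub> (\<psi> g)) = 0" and y: "y \<in> G"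
      obtain h where h: "h \<in> regular_fun n" "\<forall>A\<in>carrier ?\<Gamma>. f (A \<otimes>\<^bsub>?\<Gamma>\<^esub> inv\<^bsub>?\<Gamma>\<^esub> x) = h A"
        using regular_mapD[OF regular_map_right_mult[OF inv_closed[OF xC]] f(1)] unfolding regular_on_def by blast
      have "h (?t g x) = 0" if g: "g \<in> G" for g
        using bspec[OF h(2) GC[OF tG[OF g]]] bspec[OF f(2) g] disp[OF g] by simp
      then have "\<forall>A\<in>orbit ?G ?t x. h A = 0" unfolding orbit_def by auto
      from bspec[OF mp[OF bspec[OF dense h(1)] this] G_mult[OF y x]]
      have "h (y \<otimes>\<^bsub>?\<Gamma>\<^esub> x) = 0" .
      then show "f y = 0"
        using bspec[OF h(2) GC[OF G_mult[OF y x]]] xC GC[OF y] by (simp add: m_assoc)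
    qed
    from \<psi>.displacement_surjective[OF this d]
    have surj: "G \<subseteq> (\<lambda>g. g \<otimes>\<^bsub>?\<Gamma>\<^esub> inv\<^bsub>?\<Gamma>\<^esub> (\<psi> g)) ` G" .
    have orb: "y \<in> orbit ?G ?t x" if y: "y \<in> G" for y
    proof -
      obtain g where g: "g \<in> G" "y \<otimes>\<^bsub>?\<Gamma>\<^esub> inv\<^bsub>?\<Gamma>\<^esub> x = g \<otimes>\<^bsub>?\<Gamma>\<^esub> inv\<^bsub>?\<Gamma>\<^esub> (\<psi> g)"
        using subsetD[OF surj G_mult[OF y G_inv[OF x]]] by blast
      then have "y = ?t g x"
        using disp[OF g(1)] GC[OF y] GC[OF tG[OF g(1)]] xC by simp
      then show ?thesis unfolding orbit_def using g(1) by auto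
    qed
    show ?thesis
    proof (intro transitive_action.intro act.group_action_axioms transitive_action_axioms.intro)
      fix y z assume yz: "y \<in> G" "z \<in> G"
      have "z \<in> orbit ?G ?t y"
        by (rule act.orbit_trans[OF yz(1) x yz(2) act.orbit_sym[OF x yz(1) orb[OF yz(1)]] orb[OF yz(2)]])
      then show "\<exists>g\<in>carrier ?G. ?t g y = z" unfolding orbit_def by blast
    qed
  qed
  have R: "Reidemeister_number ?G \<phi> = (if finite (orbits ?G G ?t) then enat (card (orbits ?G G ?t)) else \<infinity>)"
    unfolding Reidemeister_number_def Let_def by simp
  show ?thesis
  proof (cases "finite (orbits ?G G ?t)")
    case True
    have "G \<noteq> {}" using subgroup.one_closed[OF G] by blast
    then have "card (orbits ?G G ?t) = 1" by (rule transitive_action.one_orbit[OF trans[OF True]])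
    then have "Reidemeister_number ?G \<phi> = 1" using True unfolding R by (simp only: if_True one_enat_def)
    then show ?thesis using trans[OF True] by blast
  next
    case False
    then have "Reidemeister_number ?G \<phi> = \<infinity>" unfolding R by (simp only: if_False)
    then show ?thesis using False by blast
  qed
qed

end
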